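(* Let $n\in\mathbb{N}$. For a real symmetric $n\times n$ matrix $A$ with spectrum $\sigma(A)$ put $$m(A):=\min\{\dim\operatorname{kernel}(A-\lambda\,\mathrm{id}):\lambda\in\sigma(A)\}\in\{1,\ldots,n\}.$$ There is a Type-2 machine which, given a $\rho^{n(n+1)/2}$-name of a real symmetric $n\times n$ matrix $A$ together with the integer $\lfloor\log_2 m(A)\rfloor\in\{0,1,\ldots,\lfloor\log_2 n\rfloor\}$, outputs a $\rho^n$-name of some eigenvector of $A$.
   Context: $\rho$ is the Cauchy representation of $\mathbb{R}$ (a name of $x$ is an infinite binary string encoding rationals $q_k$ with $|x-q_k|\le 2^{-k}$), $\rho^k$ its componentwise extension to $\mathbb{R}^k$; symmetric matrices are given by their upper triangular entries. Eigenvectors are nonzero. *)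

theory Defs
  imports
    "HOL-Library.Stream"
    "Jordan_Normal_Form.Matrix_Kernel"
    "Jordan_Normal_Form.Spectral_Radius"
begin

section \<open>Type-2 machines\<close>

text \<open>
  A Type-2 machine is a deterministic Turing machine with finitely many one-way read-only input
  tapes over the alphabet \<open>{0,1}\<close>, finitely many two-way infinite read/write work tapes, and one
  one-way write-only output tape over \<open>{0,1}\<close>. States and work symbols are initial segments of
  the naturals; state \<open>0\<close> is the initial one and work symbol \<open>0\<close> is the blank. \<open>None\<close> is the blank
  of an input tape.

  The transition function maps the current state, the scanned input symbols and the scanned work
  symbols to the new state, a flag per input tape telling whether its head advances, a symbol
  to write and a head move per work tape, and at most one bit to append to the output; the value
  \<open>None\<close> means that the machine halts. Only finitely many arguments are relevant, because the
  argument lists have fixed lengths and range over finite alphabets.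
\<close>

datatype head_move = Move_Left | Move_None | Move_Right

type_synonym action = "nat \<times> bool list \<times> (nat \<times> head_move) list \<times> bool option"

record type2_machine =
  num_states :: nat
  num_symbols :: nat
  num_inputs :: nat
  num_work :: nat
  trans_fun :: "nat \<Rightarrow> bool option list \<Rightarrow> nat list \<Rightarrow> action option"

definition wf_type2_machine :: "type2_machine \<Rightarrow> bool" where
  "wf_type2_machine M \<longleftrightarrow>
     0 < num_states M \<and> 0 < num_symbols M \<and>
     (\<forall>q xs ws q' adv acts ob.
        q < num_states M \<and>
        length xs = num_inputs M \<and>
        length ws = num_work M \<and> set ws \<subseteq> {..<num_symbols M} \<and>
        trans_fun M q xs ws = Some (q', adv, acts, ob) \<longrightarrow>
          q' < num_states M \<and>
          length adv = num_inputs M \<and>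
          length acts = num_work M \<and> fst ` set acts \<subseteq> {..<num_symbols M})"

record config =
  cur_state :: nat
  input_heads :: "nat list"
  work_tapes :: "((int \<Rightarrow> nat) \<times> int) list"
  written :: "bool list"

definition init_config :: "type2_machine \<Rightarrow> config" where
  "init_config M =
     \<lparr> cur_state = 0,
       input_heads = replicate (num_inputs M) 0,
       work_tapes = replicate (num_work M) (\<lambda>_. 0, 0),
       written = [] \<rparr>"

type_synonym input_tape = "nat \<Rightarrow> bool option"

fun move_head :: "head_move \<Rightarrow> int \<Rightarrow> int" where
  "move_head Move_Left h = h - 1"
| "move_head Move_None h = h"
| "move_head Move_Right h = h + 1"

definition step_config :: "type2_machine \<Rightarrow> input_tape list \<Rightarrow> config \<Rightarrow> config" where
  "step_config M ins c =
     (case trans_fun M (cur_state c)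
             (map2 (\<lambda>tape h. tape h) ins (input_heads c))
             (map (\<lambda>(tape, h). tape h) (work_tapes c)) of
        None \<Rightarrow> c
      | Some (q, adv, acts, ob) \<Rightarrow>
          \<lparr> cur_state = q,
            input_heads = map2 (\<lambda>h a. if a then Suc h else h) (input_heads c) adv,
            work_tapes = map2 (\<lambda>(tape, h) (s, d). (tape(h := s), move_head d h)) (work_tapes c) acts,
            written = written c @ (case ob of None \<Rightarrow> [] | Some b \<Rightarrow> [b]) \<rparr>)"

definition run_config :: "type2_machine \<Rightarrow> input_tape list \<Rightarrow> nat \<Rightarrow> config" where
  "run_config M ins t = (step_config M ins ^^ t) (init_config M)"

definition outputs :: "type2_machine \<Rightarrow> input_tape list \<Rightarrow> bool stream \<Rightarrow> bool" where
  "outputs M ins y \<longleftrightarrow>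
     (\<forall>t. written (run_config M ins t) = stake (length (written (run_config M ins t))) y) \<and>
     (\<forall>k. \<exists>t. k \<le> length (written (run_config M ins t)))"

definition stream_tape :: "bool stream \<Rightarrow> input_tape" where
  "stream_tape p = (\<lambda>i. Some (p !! i))"

definition word_tape :: "bool list \<Rightarrow> input_tape" where
  "word_tape w = (\<lambda>i. if i < length w then Some (w ! i) else None)"


section \<open>The Cauchy representation\<close>

text \<open>Binary numerals, least significant bit first; \<open>0\<close> is denoted by the empty word.\<close>

fun nat_word :: "nat \<Rightarrow> bool list" where
  "nat_word n = (if n = 0 then [] else odd n # nat_word (n div 2))"

declare nat_word.simps [simp del]

text \<open>Self-delimiting form: each bit is preceded by a \<open>1\<close>, and a single \<open>0\<close> ends the numeral.\<close>

definition nat_code :: "nat \<Rightarrow> bool list" where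
  "nat_code n = concat (map (\<lambda>b. [True, b]) (nat_word n)) @ [False]"

text \<open>
  A pair \<open>(a, b)\<close> with \<open>b > 0\<close> stands for the fraction \<open>a / b\<close>, which need not be in lowest
  terms; its code consists of a sign bit, the numeral of \<open>\<bar>a\<bar>\<close> and the numeral of \<open>b\<close>.
\<close>

definition frac_code :: "int \<times> nat \<Rightarrow> bool list" where
  "frac_code = (\<lambda>(a, b). (a < 0) # nat_code (nat \<bar>a\<bar>) @ nat_code b)"

definition frac_value :: "int \<times> nat \<Rightarrow> real" where
  "frac_value = (\<lambda>(a, b). real_of_int a / real b)"

definition cauchy_name :: "bool stream \<Rightarrow> real \<Rightarrow> bool" where
  "cauchy_name p x \<longleftrightarrow>
     (\<exists>q :: (int \<times> nat) stream.
        p = flat (smap frac_code q) \<and>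
        (\<forall>k. 0 < snd (q !! k) \<and> \<bar>x - frac_value (q !! k)\<bar> \<le> 1 / 2 ^ k))"

text \<open>
  A name of a tuple of \<open>k\<close> reals interleaves names of its components:
  \<open>p\<^sub>0(0) \<dots> p\<^sub>k\<^sub>-\<^sub>1(0) p\<^sub>0(1) \<dots> p\<^sub>k\<^sub>-\<^sub>1(1) \<dots>\<close>
\<close>

definition component :: "nat \<Rightarrow> nat \<Rightarrow> bool stream \<Rightarrow> bool stream" where
  "component k i p = smap (\<lambda>j. p !! (j * k + i)) nats"

definition cauchy_tuple_name :: "bool stream \<Rightarrow> real list \<Rightarrow> bool" where
  "cauchy_tuple_name p xs \<longleftrightarrow>
     (\<forall>i < length xs. cauchy_name (component (length xs) i p) (xs ! i))"


section \<open>Symmetric matrices\<close>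

text \<open>Row by row, diagonal included: \<open>n * (n + 1) / 2\<close> entries for an \<open>n \<times> n\<close> matrix.\<close>

definition upper_entries :: "'a mat \<Rightarrow> 'a list" where
  "upper_entries A =
     concat (map (\<lambda>i. map (\<lambda>j. A $$ (i, j)) [i..<dim_col A]) [0..<dim_row A])"

lemma length_upper_entries:
  assumes "A \<in> carrier_mat n n"
  shows "length (upper_entries A) = n * (n + 1) div 2"
proof -
  have "(\<Sum>i<n. n - i) = n * (n + 1) div 2"
  proof -
    have "(\<Sum>i<n. n - i) = (\<Sum>i<n. Suc i)"
      by (subst sum.nat_diff_reindex[symmetric]) (auto intro: sum.cong)
    also have "\<dots> = (\<Sum>i\<le>n. i)"
      by (simp add: sum.atMost_shift)
    also have "\<dots> = n * (n + 1) div 2"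
      using gauss_sum_nat[of n] by (simp add: atMost_atLeast0)
    finally show ?thesis .
  qed
  with assms show ?thesis
    by (simp add: upper_entries_def length_concat comp_def interv_sum_list_conv_sum_set_nat
        atLeast0LessThan)
qed

definition min_multiplicity :: "real mat \<Rightarrow> nat" where
  "min_multiplicity A =
     Min ((\<lambda>l. kernel_dim (A - l \<cdot>\<^sub>m 1\<^sub>m (dim_row A))) ` spectrum A)"

end

theory Submission
  imports
    Defs
    "HOL-Library.Countable"
    "HOL-Analysis.Function_Topology"
    "HOL-Analysis.L2_Norm"
    "HOL-Analysis.Product_Topology"
    "Jordan_Normal_Form.Jordan_Normal_Form_Uniqueness"
begin

text \<open>
  Let \<open>2 ^ k \<le> m(A) < 2 ^ (k + 1)\<close>. A set of fewer than \<open>2 ^ (k + 1)\<close> eigenvalues (counted with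
  multiplicity) contains at most one distinct eigenvalue, since each has multiplicity at least \<open>2 ^ k\<close>.
  That an interval around \<open>\<mu>\<close> holds at most \<open>q = 2 ^ (k + 1) - 1\<close> eigenvalues is certified by matrices
  \<open>P\<close> and \<open>W\<close>, the latter with \<open>q\<close> columns, such that \<open>P (A - \<mu>) + W W\<^sup>T\<close> is close to the identity:
  then \<open>A - \<mu>\<close> is bounded below on the orthogonal complement of the columns of \<open>W\<close>, which every
  subspace of dimension greater than \<open>q\<close> meets. Such certificates are stable under rounding, so an exhaustive
  search over integer matrices finds one; it is met at an eigenvalue of multiplicity \<open>m(A)\<close>. This isolates
  one eigenspace \<open>E\<close>, after which a small residual \<open>(A - \<mu>') u\<close> certifies that a rational vector \<open>u\<close> is
  close to \<open>E\<close>. Searching for ever better \<open>u\<^sub>j\<^sub>+\<^sub>1\<close> near \<open>u\<^sub>j\<close> gives a Cauchy sequence whose limit lies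
  in \<open>E\<close> and is nonzero.

  The search is run by a machine whose work tapes are counters: each stage reads one bit of each input,
  replaces finitely many counters by computable functions of them, and writes at most one bit.
\<close>

section \<open>Counter programs on Type-2 machines\<close>

text \<open>Only inequalities can be confirmed from approximations: a gap between eigenvalues shows
  itself eventually, an equality never. The advice turns a certified count into the statement that
  all eigenvalues in the window are equal. The search need not find an eigenspace of least
  dimension; that one only guarantees termination, and whichever certificate comes first isolates
  its own eigenspace. Since \<open>E\<close> may have dimension above 1, small residuals alone would
  let successive vectors wander in it. Comparing with the previous vector prevents this and never
  blocks the search: a vector of \<open>E\<close> within \<open>1 / (8 * p)\<close> of
  \<open>u_j\<close> is known to exist while \<open>1 / (4 * p)\<close> is allowed, so it passes
  strictly and survives rounding. Here \<open>p = 2 ^ j\<close>. The steps add up to a drift of at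
  most 1/2, less than the coordinate of absolute value at least 1 in the first vector. All tests are
  polynomial inequalities between integers. A stage bounds its candidates by its own number and
  hence halts; every fixed certificate is a candidate in all late stages.\<close>

datatype input = Name | Advice

datatype basic = Inc nat | Dec nat | Add_In input "bool option" nat | Adv input | Out bool

datatype prog = Skip | Basic basic | Seq prog prog (infixr \<open>;;\<close> 60) | While nat prog

type_synonym pstate = "(nat \<Rightarrow> nat) \<times> (input \<Rightarrow> nat) \<times> bool list"

fun basic_step :: "(input \<Rightarrow> input_tape) \<Rightarrow> basic \<Rightarrow> pstate \<Rightarrow> pstate" where
  "basic_step ins (Inc r) (e, h, w) = (e(r := Suc (e r)), h, w)"
| "basic_step ins (Dec r) (e, h, w) = (e(r := e r - 1), h, w)"
| "basic_step ins (Add_In i x r) (e, h, w) = (if ins i (h i) = x then e(r := Suc (e r)) else e, h, w)"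
| "basic_step ins (Adv i) (e, h, w) = (e, h(i := Suc (h i)), w)"
| "basic_step ins (Out b) (e, h, w) = (e, h, w @ [b])"

inductive exec :: "(input \<Rightarrow> input_tape) \<Rightarrow> prog \<Rightarrow> pstate \<Rightarrow> pstate \<Rightarrow> bool" for ins where
  exec_Skip: "exec ins Skip s s"
| exec_Basic: "s' = basic_step ins b s \<Longrightarrow> exec ins (Basic b) s s'"
| exec_Seq: "exec ins P s s' \<Longrightarrow> exec ins Q s' s'' \<Longrightarrow> exec ins (P ;; Q) s s''"
| exec_While_0: "fst s r = 0 \<Longrightarrow> exec ins (While r P) s s"
| exec_While_Suc: "fst s r \<noteq> 0 \<Longrightarrow> exec ins P s s' \<Longrightarrow> exec ins (While r P) s' s'' \<Longrightarrow>
    exec ins (While r P) s s''"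

section \<open>Compilation of structured programs to jump code\<close>

datatype instr = Do basic | Jz nat nat | Jmp nat

fun instr_step :: "(input \<Rightarrow> input_tape) \<Rightarrow> instr \<Rightarrow> nat \<times> pstate \<Rightarrow> nat \<times> pstate" where
  "instr_step ins (Do b) (pc, s) = (Suc pc, basic_step ins b s)"
| "instr_step ins (Jz r l) (pc, s) = (if fst s r = 0 then l else Suc pc, s)"
| "instr_step ins (Jmp l) (pc, s) = (l, s)"

definition code_step :: "(input \<Rightarrow> input_tape) \<Rightarrow> instr list \<Rightarrow> nat \<times> pstate \<Rightarrow> nat \<times> pstate" where
  "code_step ins C c = (if fst c < length C then instr_step ins (C ! fst c) c else c)"

fun compile :: "nat \<Rightarrow> prog \<Rightarrow> instr list" where
  "compile l Skip = []"
| "compile l (Basic b) = [Do b]"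
| "compile l (P ;; Q) = (let c = compile l P in c @ compile (l + length c) Q)"
| "compile l (While r P) = (let c = compile (Suc l) P in Jz r (l + length c + 2) # c @ [Jmp l])"

lemma funpow_trans:
  assumes "(f ^^ j) a = b" "(f ^^ k) b = c"
  shows "(f ^^ (k + j)) a = c"
  using assms by (simp add: funpow_add)

lemma code_step_at:
  assumes "C = X @ I # Y" "pc = length X"
  shows "code_step ins C (pc, s) = instr_step ins I (pc, s)"
  using assms by (simp add: code_step_def)

text \<open>Jump targets are absolute, so the code sits behind an arbitrary prefix \<open>X\<close>
  and is compiled for the address \<open>length X\<close>. Induction over the execution rather than
  over the program handles loops: the remaining iterations are a smaller derivation of the same
  \<open>While\<close>.\<close>

lemma compile_correct:
  assumes "exec ins P s s'" "C = X @ compile (length X) P @ Y"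
  shows "\<exists>k. (code_step ins C ^^ k) (length X, s) = (length X + length (compile (length X) P), s')"
  using assms
proof (induction arbitrary: X Y rule: exec.induct)
  case (exec_Skip s)
  show ?case by (rule exI[of _ 0]) simp
next
  case (exec_Basic s' b s)
  then show ?case
    by (intro exI[of _ 1]) (simp add: code_step_at[of _ X "Do b" Y])
next
  case (exec_Seq P s s' Q s'')
  let ?p = "compile (length X) P"
  let ?q = "compile (length X + length ?p) Q"
  obtain j where j: "(code_step ins C ^^ j) (length X, s) = (length X + length ?p, s')"
    using exec_Seq.IH(1)[of X "?q @ Y"] exec_Seq.prems by (auto simp: Let_def)
  obtain k where k: "(code_step ins C ^^ k) (length X + length ?p, s')
      = (length X + length ?p + length ?q, s'')"
    using exec_Seq.IH(2)[of "X @ ?p" Y] exec_Seq.prems by (auto simp: Let_def)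
  show ?case using funpow_trans[OF j k] by (auto simp: Let_def add.assoc)
next
  case (exec_While_0 s r P)
  let ?c = "compile (Suc (length X)) P"
  have "C = X @ Jz r (length X + length ?c + 2) # (?c @ [Jmp (length X)] @ Y)"
    using exec_While_0.prems by (simp add: Let_def)
  from code_step_at[OF this refl] show ?case
    using exec_While_0.hyps by (intro exI[of _ 1]) (simp add: Let_def)
next
  case (exec_While_Suc s r P s' s'')
  let ?p = "compile (Suc (length X)) P"
  let ?l = "length X + length ?p + 2"
  have C: "C = X @ Jz r ?l # ?p @ Jmp (length X) # Y"
    using exec_While_Suc.prems by (simp add: Let_def)
  have a: "(code_step ins C ^^ 1) (length X, s) = (Suc (length X), s)"
    using exec_While_Suc.hyps by (simp add: code_step_at[OF C])
  obtain j where j: "(code_step ins C ^^ j) (Suc (length X), s) = (Suc (length X) + length ?p, s')"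
    using exec_While_Suc.IH(1)[of "X @ [Jz r ?l]" "Jmp (length X) # Y"] C by auto
  have b: "(code_step ins C ^^ 1) (Suc (length X) + length ?p, s') = (length X, s')"
    using code_step_at[of C "X @ Jz r ?l # ?p" "Jmp (length X)" Y "Suc (length X) + length ?p"] C by simp
  obtain k where k: "(code_step ins C ^^ k) (length X, s')
      = (length X + length (compile (length X) (While r P)), s'')"
    using exec_While_Suc.IH(2)[OF exec_While_Suc.prems] by auto
  show ?case using funpow_trans[OF funpow_trans[OF funpow_trans[OF a j] b] k] by blast
qed

section \<open>Simulation of jump code by a Type-2 machine\<close>

fun basic_bound :: "basic \<Rightarrow> nat" where
  "basic_bound (Inc r) = Suc r"
| "basic_bound (Dec r) = Suc r"
| "basic_bound (Add_In i x r) = Suc r"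
| "basic_bound (Adv i) = 0"
| "basic_bound (Out b) = 0"

fun instr_bound :: "instr \<Rightarrow> nat" where
  "instr_bound (Do b) = basic_bound b"
| "instr_bound (Jz r l) = Suc r"
| "instr_bound (Jmp l) = 0"

text \<open>The number of states must be bounded in advance, also for jumps beyond the code. Sums
  over all instructions bound both the registers and the targets; unlike a maximum they need no care
  for the empty list.\<close>

fun jump_target :: "instr \<Rightarrow> nat" where
  "jump_target (Do b) = 0"
| "jump_target (Jz r l) = l"
| "jump_target (Jmp l) = l"

definition input_index :: "input \<Rightarrow> nat" where
  "input_index i = (case i of Name \<Rightarrow> 0 | Advice \<Rightarrow> 1)"

text \<open>The mark 1 under the head of tape \<open>r\<close> means that the register is 0; then
  \<open>Dec\<close> stays put, which is the truncated subtraction of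
  \<open>basic_step\<close>.\<close>

fun head_action :: "basic \<Rightarrow> bool option list \<Rightarrow> nat list \<Rightarrow> nat \<Rightarrow> head_move" where
  "head_action (Inc r) xs ws j = (if j = r then Move_Right else Move_None)"
| "head_action (Dec r) xs ws j = (if j = r \<and> ws ! j \<noteq> 1 then Move_Left else Move_None)"
| "head_action (Add_In i x r) xs ws j = (if j = r \<and> xs ! input_index i = x then Move_Right else Move_None)"
| "head_action _ xs ws j = Move_None"

text \<open>
  A register is a work tape whose only nonblank cell is cell \<open>0\<close>; its value is the position of the
  head. State \<open>0\<close> writes the marks, and state \<open>Suc pc\<close> stands for the program counter \<open>pc\<close>.
\<close>

definition machine :: "instr list \<Rightarrow> type2_machine" where
  "machine C =
     (let K = sum_list (map instr_bound C) in
     \<lparr> num_states = Suc (Suc (length C + sum_list (map jump_target C))),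
       num_symbols = 2,
       num_inputs = 2,
       num_work = K,
       trans_fun = (\<lambda>q xs ws.
         if q = 0 then Some (1, [False, False], replicate K (1, Move_None), None)
         else if q \<le> length C then
           (case C ! (q - 1) of
              Do b \<Rightarrow> Some (Suc q, [b = Adv Name, b = Adv Advice],
                map (\<lambda>j. (ws ! j, head_action b xs ws j)) [0..<K],
                (case b of Out c \<Rightarrow> Some c | _ \<Rightarrow> None))
            | Jz r l \<Rightarrow> Some (if ws ! r = 1 then Suc l else Suc q, [False, False],
                map (\<lambda>j. (ws ! j, Move_None)) [0..<K], None)
            | Jmp l \<Rightarrow> Some (Suc l, [False, False], map (\<lambda>j. (ws ! j, Move_None)) [0..<K], None))
         else None) \<rparr>)"

lemma sum_list_map_ge:
  fixes f :: "'a \<Rightarrow> nat"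
  assumes "x \<in> set xs"
  shows "f x \<le> sum_list (map f xs)"
  using assms by (intro member_le_sum_list) auto

lemma wf_machine: "wf_type2_machine (machine C)"
proof -
  have t: "jump_target (C ! (q - 1)) \<le> sum_list (map jump_target C)" if "q \<noteq> 0" "q \<le> length C" for q
    using that by (intro sum_list_map_ge) auto
  show ?thesis
    unfolding wf_type2_machine_def
  proof (intro conjI allI impI, goal_cases)
    case (3 q xs ws q' adv acts ob)
    then show ?case using t[of q] by (auto simp: machine_def Let_def split: if_splits instr.splits)
  next
    case (4 q xs ws q' adv acts ob)
    then show ?case by (auto simp: machine_def Let_def split: if_splits instr.splits)
  next
    case (5 q xs ws q' adv acts ob)
    then show ?case by (auto simp: machine_def Let_def split: if_splits instr.splits)
  next
    case (6 q xs ws q' adv acts ob)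
    then show ?case
      by (auto simp: machine_def Let_def subset_iff lessThan_def split: if_splits instr.splits)
  qed (auto simp: machine_def Let_def)
qed

definition mark :: "int \<Rightarrow> nat" where
  "mark z = (if z = 0 then 1 else 0)"

definition config_of :: "nat \<Rightarrow> nat \<Rightarrow> pstate \<Rightarrow> config" where
  "config_of K q s = (case s of (e, h, w) \<Rightarrow>
     \<lparr> cur_state = q, input_heads = [h Name, h Advice],
       work_tapes = map (\<lambda>j. (mark, int (e j))) [0..<K], written = w \<rparr>)"

lemma map2_map_upt: "map2 f (map g [0..<K]) (map h [0..<K]) = map (\<lambda>j. f (g j) (h j)) [0..<K]"
  by (induction K) auto

lemma step_init:
  "step_config (machine C) ins (init_config (machine C)) =
     config_of (num_work (machine C)) 1 (\<lambda>_. 0, \<lambda>_. 0, [])"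
  by (auto simp: step_config_def init_config_def machine_def Let_def config_of_def mark_def
      map2_map_upt numeral_2_eq_2 map_replicate_const[symmetric] simp flip: map_replicate_trivial
      intro!: nth_equalityI)

lemma step_config_of:
  assumes "ins = [tp Name, tp Advice]" "K = num_work (machine C)" "code_step tp C (pc, s) = (pc', s')"
  shows "step_config (machine C) ins (config_of K (Suc pc) s) = config_of K (Suc pc') s'"
proof (cases "pc < length C")
  case True
  obtain e h w where s: "s = (e, h, w)" by (cases s)
  have K: "K = sum_list (map instr_bound C)" using assms by (simp add: machine_def Let_def)
  have bd: "instr_bound (C ! pc) \<le> K" unfolding K using True by (intro sum_list_map_ge) auto
  have inp: "[tp Name (h Name), tp Advice (h Advice)] ! input_index i = tp i (h i)" for i
    by (cases i) (auto simp: input_index_def)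
  have st: "instr_step tp (C ! pc) (pc, e, h, w) = (pc', s')"
    using assms(3) True s by (simp add: code_step_def)
  show ?thesis
  proof (cases "C ! pc")
    case (Do b)
    then show ?thesis using bd st True
      by (cases b; force simp: step_config_def s assms(1) config_of_def machine_def Let_def
          map2_map_upt comp_def mark_def inp K[symmetric] fun_eq_iff)
  next
    case (Jz r l)
    then show ?thesis using bd st True
      by (auto simp: step_config_def s assms(1) config_of_def machine_def Let_def
          map2_map_upt comp_def mark_def inp K[symmetric] fun_eq_iff split: if_splits)
  next
    case (Jmp l)
    then show ?thesis using bd st True
      by (auto simp: step_config_def s assms(1) config_of_def machine_def Let_def
          map2_map_upt comp_def mark_def inp K[symmetric] fun_eq_iff)
  qed
next
  \<comment> \<open>Outside the code the machine halts, which \<open>step_config\<close> renders as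
    standing still, just as \<open>code_step\<close> does.\<close>
  case False
  then have "pc' = pc" "s' = s" using assms(3) by (auto simp: code_step_def)
  with False show ?thesis
    by (simp add: step_config_def config_of_def machine_def Let_def split: prod.splits)
qed

lemma run_config_code_step:
  assumes "ins = [tp Name, tp Advice]" "K = num_work (machine C)"
    and "(code_step tp C ^^ k) (0, \<lambda>_. 0, \<lambda>_. 0, []) = (pc, s)"
  shows "run_config (machine C) ins (Suc k) = config_of K (Suc pc) s"
  using assms(3)
proof (induction k arbitrary: pc s)
  case 0
  then show ?case using step_init[of C ins] assms(2) by (auto simp: run_config_def)
next
  case (Suc k)
  obtain pc1 s1 where 1: "(code_step tp C ^^ k) (0, \<lambda>_. 0, \<lambda>_. 0, []) = (pc1, s1)"
    by (meson surj_pair)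
  then have "code_step tp C (pc1, s1) = (pc, s)" using Suc.prems by simp
  then show ?case using Suc.IH[OF 1] step_config_of[OF assms(1,2)]
    by (simp add: run_config_def)
qed

lemma written_mono:
  assumes "t \<le> t'"
  shows "\<exists>z. written (run_config M ins t') = written (run_config M ins t) @ z"
  using assms
proof (induction rule: dec_induct)
  case (step u)
  have "\<exists>z. written (step_config M ins c) = written c @ z" for c
    by (auto simp: step_config_def split: option.splits prod.splits)
  with step.IH show ?case unfolding run_config_def by (metis append.assoc comp_def funpow.simps(2))
qed simp

text \<open>\<open>outputs\<close> constrains the written word at every time, but \<open>S\<close>
  describes it only at the loop heads. As output is only ever appended, a word that is later
  extended to a prefix of \<open>y\<close> is a prefix of \<open>y\<close> itself.\<close>

theorem loop_machine:
  assumes S0: "S 0 = (\<lambda>_. 0, \<lambda>_. 0, [])"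
    and S: "\<And>t. exec tp P (S t) (S (Suc t))"
    and pre: "\<And>t. snd (snd (S t)) = stake (length (snd (snd (S t)))) y"
    and unb: "\<And>k. \<exists>t. k \<le> length (snd (snd (S t)))"
  shows "outputs (machine (compile 0 P @ [Jmp 0])) [tp Name, tp Advice] y"
proof -
  let ?C = "compile 0 P @ [Jmp 0]"
  let ?run = "run_config (machine ?C) [tp Name, tp Advice]"
  \<comment> \<open>The bound \<open>k \<ge> t\<close> makes every time precede some loop head; each
    round executes at least the closing jump.\<close>
  have *: "\<exists>k\<ge>t. (code_step tp ?C ^^ k) (0, S 0) = (0, S t)" for t
  proof (induction t)
    case (Suc t)
    then obtain k where k: "k \<ge> t" "(code_step tp ?C ^^ k) (0, S 0) = (0, S t)" by blast
    obtain j where j: "(code_step tp ?C ^^ j) (0, S t) = (length (compile 0 P), S (Suc t))"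
      using compile_correct[OF S, of ?C "[]" "[Jmp 0]" t] by auto
    have "(code_step tp ?C ^^ 1) (length (compile 0 P), S (Suc t)) = (0, S (Suc t))"
      by (simp add: code_step_def)
    from funpow_trans[OF funpow_trans[OF k(2) j] this] k(1) show ?case
      by (intro exI[of _ "1 + (j + k)"]) auto
  qed (auto intro: exI[of _ 0])
  have w: "\<exists>k\<ge>t. written (?run k) = snd (snd (S t))" for t
  proof -
    obtain k where k: "k \<ge> t" "(code_step tp ?C ^^ k) (0, S 0) = (0, S t)" using *[of t] by blast
    then show ?thesis
      using run_config_code_step[OF refl refl, where tp = tp and C = ?C and k = k and pc = 0 and s = "S t"] S0
      by (intro exI[of _ "Suc k"]) (auto simp: config_of_def split: prod.splits)
  qed
  show ?thesis
    unfolding outputs_def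
  proof (intro conjI allI)
    fix t
    obtain k where k: "k \<ge> t" "written (?run k) = snd (snd (S t))" using w by blast
    then obtain z where z: "snd (snd (S t)) = written (?run t) @ z"
      using written_mono[OF k(1)] by metis
    then have "written (?run t) @ z = stake (length (written (?run t)) + length z) y"
      using pre[of t] by simp
    then show "written (?run t) = stake (length (written (?run t))) y"
      by (metis append_eq_conv_conj take_stake min.absorb1 le_add1)
  next
    fix k
    obtain t where "k \<le> length (snd (snd (S t)))" using unb by blast
    moreover obtain k' where "written (?run k') = snd (snd (S t))" using w by blast
    ultimately show "\<exists>t. k \<le> length (written (?run t))" by metis
  qed
qed

section \<open>Computable functions of the registers\<close>

definition runs :: "prog \<Rightarrow> (nat \<Rightarrow> nat) \<Rightarrow> (nat \<Rightarrow> nat) \<Rightarrow> bool" where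
  "runs P e e' \<longleftrightarrow> (\<forall>ins h w. exec ins P (e, h, w) (e', h, w))"

lemma runs_Skip: "runs Skip e e"
  by (simp add: runs_def exec_Skip)

lemma runs_Inc: "runs (Basic (Inc r)) e (e(r := Suc (e r)))"
  by (simp add: runs_def exec_Basic)

lemma runs_Dec: "runs (Basic (Dec r)) e (e(r := e r - 1))"
  by (simp add: runs_def exec_Basic)

lemma runs_Seq: "runs P e e' \<Longrightarrow> runs Q e' e'' \<Longrightarrow> runs (P ;; Q) e e''"
  unfolding runs_def by (meson exec_Seq)

text \<open>A closed form replaces the loop invariant: \<open>f i\<close> is the register state
  before iteration \<open>i\<close>.\<close>

lemma runs_While:
  assumes "\<And>i. i < k \<Longrightarrow> f i r \<noteq> 0 \<and> runs P (f i) (f (Suc i))" "f k r = 0"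
    and "e = f 0" "e' = f k"
  shows "runs (While r P) e e'"
  using assms
proof (induction k arbitrary: f e)
  case 0
  then show ?case by (simp add: runs_def exec_While_0)
next
  case (Suc k)
  have "runs (While r P) (f 1) e'"
    by (rule Suc.IH[of "\<lambda>i. f (Suc i)"]) (use Suc.prems in auto)
  moreover have "f 0 r \<noteq> 0" "runs P (f 0) (f 1)" using Suc.prems(1)[of 0] by auto
  ultimately show ?case using Suc.prems(3) unfolding runs_def by (metis exec_While_Suc fst_conv)
qed

definition clear :: "nat \<Rightarrow> prog" where
  "clear r = While r (Basic (Dec r))"

lemma runs_clear: "runs (clear r) e (e(r := 0))"
  unfolding clear_def
proof (rule runs_While[where k = "e r" and f = "\<lambda>i. e(r := e r - i)"])
  fix i assume "i < e r"
  then show "(e(r := e r - i)) r \<noteq> 0 \<and> runs (Basic (Dec r)) (e(r := e r - i)) (e(r := e r - Suc i))"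
    using runs_Dec[of r "e(r := e r - i)"] by simp
qed auto

definition pour :: "nat \<Rightarrow> nat \<Rightarrow> prog" where
  "pour a d = While a (Basic (Dec a) ;; Basic (Inc d))"

lemma runs_pour:
  assumes "a \<noteq> d"
  shows "runs (pour a d) e (e(a := 0, d := e d + e a))"
  unfolding pour_def
proof (rule runs_While[where k = "e a" and f = "\<lambda>i. e(a := e a - i, d := e d + i)"])
  fix i assume i: "i < e a"
  let ?e = "e(a := e a - i, d := e d + i)"
  have "runs (Basic (Dec a) ;; Basic (Inc d)) ?e (?e(a := ?e a - 1, d := Suc (?e d)))"
    using runs_Seq[OF runs_Dec runs_Inc, of a d ?e] assms by simp
  moreover have "?e(a := ?e a - 1, d := Suc (?e d)) = e(a := e a - Suc i, d := e d + Suc i)"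
    using assms by auto
  ultimately show "?e a \<noteq> 0 \<and>
      runs (Basic (Dec a) ;; Basic (Inc d)) ?e (e(a := e a - Suc i, d := e d + Suc i))"
    using i assms by auto
qed (use assms in auto)

definition move :: "nat \<Rightarrow> nat \<Rightarrow> prog" where
  "move a d = clear d ;; pour a d"

lemma runs_move:
  assumes "a \<noteq> d"
  shows "runs (move a d) e (e(a := 0, d := e a))"
  using runs_Seq[OF runs_clear runs_pour[OF assms], of d e] assms
  by (simp add: move_def fun_upd_twist)

text \<open>Counting down destroys the source, so every unit also goes to \<open>t\<close>, from
  which the source is restored.\<close>

definition add_copy :: "nat \<Rightarrow> nat \<Rightarrow> nat \<Rightarrow> prog" where
  "add_copy a d t = While a (Basic (Dec a) ;; Basic (Inc d) ;; Basic (Inc t)) ;; pour t a"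

lemma runs_add_copy:
  assumes "a \<noteq> d" "a \<noteq> t" "d \<noteq> t" "e t = 0"
  shows "runs (add_copy a d t) e (e(d := e d + e a))"
proof -
  let ?P = "Basic (Dec a) ;; Basic (Inc d) ;; Basic (Inc t)"
  let ?f = "\<lambda>i. e(a := e a - i, d := e d + i, t := i)"
  have "runs (While a ?P) e (?f (e a))"
  proof (rule runs_While[where k = "e a" and f = ?f])
    fix i assume i: "i < e a"
    have "runs ?P (?f i) ((?f i)(a := ?f i a - 1, d := Suc (?f i d), t := Suc (?f i t)))"
      using runs_Seq[OF runs_Dec runs_Seq[OF runs_Inc runs_Inc], of a d t "?f i"] assms by simp
    moreover have "(?f i)(a := ?f i a - 1, d := Suc (?f i d), t := Suc (?f i t)) = ?f (Suc i)"
      using assms by auto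
    ultimately show "?f i a \<noteq> 0 \<and> runs ?P (?f i) (?f (Suc i))"
      using i assms by auto
  qed (use assms in auto)
  moreover have "runs (pour t a) (?f (e a)) (e(d := e d + e a))"
    using runs_pour[of t a "?f (e a)"] assms
    by (smt (verit) fun_upd_apply fun_upd_twist fun_upd_upd fun_upd_triv add_cancel_left_left diff_self_eq_0)
  ultimately show ?thesis unfolding add_copy_def by (rule runs_Seq)
qed

definition computes :: "prog \<Rightarrow> nat \<Rightarrow> nat \<Rightarrow> ((nat \<Rightarrow> nat) \<Rightarrow> nat) \<Rightarrow> bool" where
  "computes P K d f \<longleftrightarrow> (\<forall>e. (\<forall>r\<ge>K. e r = 0) \<longrightarrow> runs P e (e(d := f e)))"

text \<open>Finite support allows intermediate results to be parked in high registers without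
  disturbing the functions evaluated afterwards.\<close>

definition supported :: "nat \<Rightarrow> ((nat \<Rightarrow> nat) \<Rightarrow> nat) \<Rightarrow> bool" where
  "supported K f \<longleftrightarrow> (\<forall>e e'. (\<forall>r<K. e r = e' r) \<longrightarrow> f e = f e')"

text \<open>The registers from \<open>K\<close> on are scratch space, blank before and after the computation.\<close>

definition computable :: "((nat \<Rightarrow> nat) \<Rightarrow> nat) \<Rightarrow> bool" where
  "computable f \<longleftrightarrow> (\<exists>K0. supported K0 f \<and> (\<forall>K\<ge>K0. \<forall>d<K. \<exists>P. computes P K d f))"

lemma supportedD: "supported K f \<Longrightarrow> (\<And>r. r < K \<Longrightarrow> e r = e' r) \<Longrightarrow> f e = f e'"
  by (auto simp: supported_def)

lemma supported_upd: "supported K f \<Longrightarrow> K \<le> r \<Longrightarrow> f (e(r := x)) = f e"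
  by (auto elim: supportedD)

lemma computable_var: "computable (\<lambda>e. e i)"
  unfolding computable_def
proof (intro exI[of _ "Suc i"] conjI allI impI)
  show "supported (Suc i) (\<lambda>e. e i)" by (simp add: supported_def)
  fix K d assume K: "Suc i \<le> K" "d < K"
  show "\<exists>P. computes P K d (\<lambda>e. e i)"
  proof (cases "d = i")
    case True
    then show ?thesis by (intro exI[of _ Skip]) (simp add: computes_def runs_Skip)
  next
    case False
    show ?thesis
      unfolding computes_def
    proof (intro exI[of _ "clear d ;; add_copy i d K"] allI impI)
      fix e :: "nat \<Rightarrow> nat" assume e: "\<forall>r\<ge>K. e r = 0"
      show "runs (clear d ;; add_copy i d K) e (e(d := e i))"
        using runs_Seq[OF runs_clear runs_add_copy, of i d K e d] False K e by simp
    qed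
  qed
qed

lemma computable_const: "computable (\<lambda>_. c)"
  unfolding computable_def
proof (intro exI[of _ 0] conjI allI impI)
  fix K d :: nat
  have "\<exists>P. \<forall>e. runs P e (e(d := c))"
  proof (induction c)
    case 0
    then show ?case using runs_clear by blast
  next
    case (Suc c)
    then obtain P where P: "\<And>e. runs P e (e(d := c))" by blast
    have "runs (P ;; Basic (Inc d)) e (e(d := Suc c))" for e
      using runs_Seq[OF P[of e] runs_Inc[of d]] by simp
    then show ?case by blast
  qed
  then show "\<exists>P. computes P K d (\<lambda>_. c)" unfolding computes_def by blast
qed (simp add: supported_def)

text \<open>This is where \<open>computable\<close> must hold for all large \<open>K\<close>: the
  value of \<open>f\<close> goes to register \<open>K\<close> with scratch space above it, the value
  of \<open>g\<close> to \<open>Suc K\<close> with scratch space above that, and \<open>op\<close>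
  then works in place on the two neighbours.\<close>

lemma computable_binop:
  assumes op: "\<And>a. \<exists>P. \<forall>e. (\<forall>r\<ge>a + 2. e r = 0) \<longrightarrow> runs P e (e(a := op (e a) (e (Suc a)), Suc a := 0))"
    and "computable f" "computable g"
  shows "computable (\<lambda>e. op (f e) (g e))"
proof -
  obtain Kf where f: "supported Kf f" "\<And>K d. K \<ge> Kf \<Longrightarrow> d < K \<Longrightarrow> \<exists>P. computes P K d f"
    using assms(2) unfolding computable_def by blast
  obtain Kg where g: "supported Kg g" "\<And>K d. K \<ge> Kg \<Longrightarrow> d < K \<Longrightarrow> \<exists>P. computes P K d g"
    using assms(3) unfolding computable_def by blast
  show ?thesis
    unfolding computable_def
  proof (intro exI[of _ "max Kf Kg"] conjI allI impI)
    show "supported (max Kf Kg) (\<lambda>e. op (f e) (g e))"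
      using f(1) g(1) unfolding supported_def by (metis less_max_iff_disj)
    fix K d assume K: "max Kf Kg \<le> K" "d < K"
    obtain Pf where Pf: "computes Pf (Suc K) K f" using f(2)[of "Suc K" K] K by auto
    obtain Pg where Pg: "computes Pg (K + 2) (Suc K) g" using g(2)[of "K + 2" "Suc K"] K by auto
    obtain Q where Q: "\<forall>e. (\<forall>r\<ge>K + 2. e r = 0) \<longrightarrow> runs Q e (e(K := op (e K) (e (Suc K)), Suc K := 0))"
      using op[of K] by blast
    show "\<exists>P. computes P K d (\<lambda>e. op (f e) (g e))"
      unfolding computes_def
    proof (intro exI[of _ "Pf ;; Pg ;; Q ;; move K d"] allI impI)
      fix e :: "nat \<Rightarrow> nat" assume e: "\<forall>r\<ge>K. e r = 0"
      let ?e1 = "e(K := f e)"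
      let ?e2 = "?e1(Suc K := g e)"
      let ?e3 = "?e2(K := op (f e) (g e), Suc K := 0)"
      have "runs Pf e ?e1" using Pf e by (auto simp: computes_def)
      moreover have "g ?e1 = g e" using supported_upd[OF g(1)] K by auto
      then have "runs Pg ?e1 ?e2" using Pg[unfolded computes_def, rule_format, of ?e1] e by auto
      moreover have "runs Q ?e2 ?e3" using Q[rule_format, of ?e2] e by simp
      moreover have "?e3(K := 0, d := ?e3 K) = e(d := op (f e) (g e))"
        using e K by (auto simp: fun_eq_iff)
      then have "runs (move K d) ?e3 (e(d := op (f e) (g e)))"
        using runs_move[of K d ?e3] K by auto
      ultimately show "runs (Pf ;; Pg ;; Q ;; move K d) e (e(d := op (f e) (g e)))"
        by (intro runs_Seq)
    qed
  qed
qed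

lemma computable_plus:
  assumes "computable f" "computable g"
  shows "computable (\<lambda>e. f e + g e)"
proof (rule computable_binop[OF _ assms])
  fix a
  have "runs (pour (Suc a) a) e (e(a := e a + e (Suc a), Suc a := 0))" for e
    using runs_pour[of "Suc a" a e] by (simp add: fun_upd_twist)
  then show "\<exists>P. \<forall>e. (\<forall>r\<ge>a + 2. e r = 0) \<longrightarrow> runs P e (e(a := e a + e (Suc a), Suc a := 0))"
    by blast
qed

lemma computable_minus:
  assumes "computable f" "computable g"
  shows "computable (\<lambda>e. f e - g e)"
proof (rule computable_binop[OF _ assms])
  fix a
  let ?P = "Basic (Dec (Suc a)) ;; Basic (Dec a)"
  have "runs (While (Suc a) ?P) e (e(a := e a - e (Suc a), Suc a := 0))" for e
  proof (rule runs_While[where k = "e (Suc a)" and f = "\<lambda>i. e(a := e a - i, Suc a := e (Suc a) - i)"])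
    fix i assume i: "i < e (Suc a)"
    let ?f = "\<lambda>i. e(a := e a - i, Suc a := e (Suc a) - i)"
    have "runs ?P (?f i) ((?f i)(Suc a := ?f i (Suc a) - 1, a := ?f i a - 1))"
      using runs_Seq[OF runs_Dec runs_Dec, of "Suc a" a "?f i"] by simp
    moreover have "(?f i)(Suc a := ?f i (Suc a) - 1, a := ?f i a - 1) = ?f (Suc i)" by auto
    ultimately show "?f i (Suc a) \<noteq> 0 \<and> runs ?P (?f i) (?f (Suc i))" using i by auto
  qed auto
  then show "\<exists>P. \<forall>e. (\<forall>r\<ge>a + 2. e r = 0) \<longrightarrow> runs P e (e(a := e a - e (Suc a), Suc a := 0))"
    by blast
qed

lemma computable_times:
  assumes "computable f" "computable g"
  shows "computable (\<lambda>e. f e * g e)"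
proof (rule computable_binop[OF _ assms])
  fix a
  \<comment> \<open>Register \<open>a\<close> accumulates, \<open>?b\<close> counts down,
    \<open>?c\<close> keeps the multiplicand and \<open>?t\<close> is the temporary of
    \<open>add_copy\<close>.\<close>
  let ?b = "Suc a" and ?c = "a + 2" and ?t = "a + 3"
  let ?P = "Basic (Dec ?b) ;; add_copy ?c a ?t"
  let ?Q = "move a ?c ;; While ?b ?P ;; clear ?c"
  have "runs ?Q e (e(a := e a * e ?b, ?b := 0))" if e: "\<forall>r\<ge>a + 2. e r = 0" for e
  proof -
    let ?f = "\<lambda>i. e(a := i * e a, ?b := e ?b - i, ?c := e a)"
    have "?f 0 = e(a := 0, ?c := e a)" by auto
    then have "runs (move a ?c) e (?f 0)" using runs_move[of a ?c e] by simp
    moreover have "runs (While ?b ?P) (?f 0) (?f (e ?b))"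
    proof (rule runs_While[where k = "e ?b" and f = ?f])
      fix i assume i: "i < e ?b"
      let ?e1 = "(?f i)(?b := ?f i ?b - 1)"
      have "runs ?P (?f i) (?e1(a := ?e1 a + ?e1 ?c))"
        using runs_Seq[OF runs_Dec[of ?b "?f i"] runs_add_copy[of ?c a ?t]] e by simp
      moreover have "?e1(a := ?e1 a + ?e1 ?c) = ?f (Suc i)" by auto
      ultimately show "?f i ?b \<noteq> 0 \<and> runs ?P (?f i) (?f (Suc i))" using i by auto
    qed auto
    moreover have "(?f (e ?b))(?c := 0) = e(a := e a * e ?b, ?b := 0)" using e by auto
    then have "runs (clear ?c) (?f (e ?b)) (e(a := e a * e ?b, ?b := 0))"
      using runs_clear[of ?c "?f (e ?b)"] by simp
    ultimately show ?thesis by (intro runs_Seq)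
  qed
  then show "\<exists>P. \<forall>e. (\<forall>r\<ge>a + 2. e r = 0) \<longrightarrow> runs P e (e(a := e a * e (Suc a), Suc a := 0))"
    by blast
qed

text \<open>With truncated subtraction, \<open>1 - (1 - x)\<close> is the sign of
  \<open>x\<close>.\<close>

lemma of_bool_computable_conv:
  "of_bool (a < b) = 1 - (1 - (b - a :: nat))" "of_bool (m \<noteq> 0) = 1 - (1 - (m::nat))"
  by auto

lemma computable_less:
  assumes "computable f" "computable g"
  shows "computable (\<lambda>e. of_bool (f e < g e))"
  unfolding of_bool_computable_conv by (intro computable_minus computable_const assms)

text \<open>Bounded minimization; the bound \<open>B\<close> keeps the search total. The predicate
  reads its candidate from the ordinary register \<open>r\<close>, whose old value is therefore
  saved in \<open>Suc K\<close>, while \<open>K\<close> holds the bound and \<open>K + 2\<close> the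
  loop flag.\<close>

lemma computable_Least:
  assumes "computable B" "computable P"
  shows "computable (\<lambda>e. LEAST x. B e \<le> x \<or> P (e(r := x)) \<noteq> 0)"
proof -
  define F where "F = (\<lambda>e. LEAST x. B e \<le> x \<or> P (e(r := x)) \<noteq> 0)"
  obtain KB where B: "supported KB B" "\<And>K d. K \<ge> KB \<Longrightarrow> d < K \<Longrightarrow> \<exists>Q. computes Q K d B"
    using assms(1) unfolding computable_def by blast
  obtain KP where P: "supported KP P" "\<And>K d. K \<ge> KP \<Longrightarrow> d < K \<Longrightarrow> \<exists>Q. computes Q K d P"
    using assms(2) unfolding computable_def by blast
  define K0 where "K0 = Max {KB, KP, Suc r}"
  have K0: "KB \<le> K0" "KP \<le> K0" "r < K0" unfolding K0_def by auto
  have supp: "supported K0 F"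
    unfolding supported_def
  proof (intro allI impI)
    fix e e' :: "nat \<Rightarrow> nat" assume e: "\<forall>r<K0. e r = e' r"
    have "B e = B e'" by (rule supportedD[OF B(1)]) (use e K0 in auto)
    moreover have "P (e(r := x)) = P (e'(r := x))" for x
      by (rule supportedD[OF P(1)]) (use e K0 in auto)
    ultimately show "F e = F e'" by (simp add: F_def)
  qed
  have "\<exists>Q. computes Q K d F" if K: "K0 \<le> K" "d < K" for K d
  proof -
    \<comment> \<open>The continuation flag: 1 as long as the candidate is below the bound kept in
      register \<open>K\<close> and the predicate fails.\<close>
    define g where "g = (\<lambda>e. of_bool (e r < e K) * (1 - P e))"
    have "computable g"
      unfolding g_def
      by (intro computable_times computable_minus computable_less computable_var computable_const assms)
    then obtain Kg where g: "supported Kg g" "\<And>L d. L \<ge> Kg \<Longrightarrow> d < L \<Longrightarrow> \<exists>Q. computes Q L d g"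
      unfolding computable_def by blast
    \<comment> \<open>The scratch space of \<open>g\<close> starts above the three registers
      \<open>K\<close>, \<open>Suc K\<close>, \<open>K + 2\<close> and above the support of
      \<open>g\<close>.\<close>
    define L where "L = max Kg (K + 3)"
    have L: "Kg \<le> L" "K + 3 \<le> L" unfolding L_def by auto
    obtain QB where QB: "computes QB (Suc K) K B" using B(2)[of "Suc K" K] K K0 by auto
    obtain Qg where Qg: "computes Qg L (K + 2) g" using g(2)[of L "K + 2"] L by auto
    let ?W = "While (K + 2) (Basic (Inc r) ;; Qg)"
    \<comment> \<open>The result waits in \<open>K + 2\<close> while \<open>r\<close> gets its old
      value back, since \<open>d\<close> may be \<open>r\<close> itself.\<close>
    let ?fin = "move r (K + 2) ;; move (Suc K) r ;; clear K ;; move (K + 2) d"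
    have "runs (QB ;; move r (Suc K) ;; Qg ;; ?W ;; ?fin) e (e(d := F e))" if e: "\<forall>r\<ge>K. e r = 0" for e
    proof -
      have ge0: "e j = 0" if "j \<ge> K" for j using e that by blast
      define stop where "stop = (\<lambda>x. B e \<le> x \<or> P (e(r := x)) \<noteq> 0)"
      define f where "f = (\<lambda>x t. e(K := B e, Suc K := e r, r := x, K + 2 := t))"
      define c where "c = (\<lambda>x. if stop x then 0 else 1 :: nat)"
      have Pf: "P (f x t) = P (e(r := x))" for x t
        by (rule supportedD[OF P(1)]) (use K K0 in \<open>auto simp: f_def\<close>)
      have gf: "g (f x t) = c x" for x t
        using K K0 by (auto simp: g_def Pf c_def stop_def) (auto simp: f_def)
      have Q: "runs Qg (f x t) (f x (c x))" for x t
        using Qg[unfolded computes_def, rule_format, of "f x t"] ge0 K K0 L gf[of x t]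
        by (auto simp: f_def)
      have F: "F e = (LEAST x. stop x)" by (simp add: F_def stop_def)
      have "stop (B e)" by (simp add: stop_def)
      then have sF: "stop (F e)" unfolding F by (rule LeastI)
      have 1: "runs QB e (e(K := B e))" using QB e by (auto simp: computes_def)
      have "(e(K := B e))(r := 0, Suc K := e r) = f 0 0"
        using ge0 K K0 by (auto simp: f_def)
      then have 2: "runs (move r (Suc K)) (e(K := B e)) (f 0 0)"
        using runs_move[of r "Suc K" "e(K := B e)"] K K0 by auto
      have 3: "runs ?W (f 0 (c 0)) (f (F e) (c (F e)))"
      proof (rule runs_While[where k = "F e" and f = "\<lambda>i. f i (c i)"])
        fix i assume i: "i < F e"
        then have ni: "\<not> stop i" unfolding F by (rule not_less_Least)
        have "(f i (c i))(r := Suc (f i (c i) r)) = f (Suc i) (c i)"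
          using K K0 by (auto simp: f_def)
        then have "runs (Basic (Inc r) ;; Qg) (f i (c i)) (f (Suc i) (c (Suc i)))"
          using runs_Seq[OF runs_Inc, of Qg] Q by metis
        with ni show "f i (c i) (K + 2) \<noteq> 0 \<and>
            runs (Basic (Inc r) ;; Qg) (f i (c i)) (f (Suc i) (c (Suc i)))"
          by (simp add: f_def c_def)
      qed (use sF in \<open>auto simp: f_def c_def\<close>)
      define e4 where "e4 = e(K := B e, Suc K := e r, r := 0, K + 2 := F e)"
      define e5 where "e5 = e(K := B e, K + 2 := F e)"
      define e6 where "e6 = e(K + 2 := F e)"
      have "(f (F e) (c (F e)))(r := 0, K + 2 := f (F e) (c (F e)) r) = e4"
        using K K0 by (auto simp: f_def e4_def)
      then have 4: "runs (move r (K + 2)) (f (F e) (c (F e))) e4"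
        using runs_move[of r "K + 2" "f (F e) (c (F e))"] K K0 by auto
      have "e4(Suc K := 0, r := e4 (Suc K)) = e5"
        using K K0 ge0 by (auto simp: e4_def e5_def)
      then have 5: "runs (move (Suc K) r) e4 e5" using runs_move[of "Suc K" r e4] K K0 by auto
      have "e5(K := 0) = e6" using ge0 by (auto simp: e5_def e6_def)
      then have 6: "runs (clear K) e5 e6" using runs_clear[of K e5] by simp
      have "e6(K + 2 := 0, d := e6 (K + 2)) = e(d := F e)"
        using ge0 K by (auto simp: e6_def)
      then have 7: "runs (move (K + 2) d) e6 (e(d := F e))"
        using runs_move[of "K + 2" d e6] K by auto
      show ?thesis by (intro runs_Seq[OF 1] runs_Seq[OF 2] runs_Seq[OF Q] runs_Seq[OF 3] runs_Seq[OF 4]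
            runs_Seq[OF 5] runs_Seq[OF 6] 7)
    qed
    then show ?thesis unfolding computes_def by blast
  qed
  then show ?thesis unfolding computable_def F_def[symmetric] using supp by blast
qed

text \<open>The quotient is the least \<open>x\<close> with \<open>f e < (x + 1) * g e\<close>, and
  it is at most \<open>f e\<close>. The search register \<open>r\<close> lies beyond both supports,
  so trying values there leaves \<open>f\<close> and \<open>g\<close> alone. The factor
  \<open>of_bool (0 < g e)\<close> realizes the convention that division by 0 gives 0.\<close>

lemma computable_div:
  assumes "computable f" "computable g"
  shows "computable (\<lambda>e. f e div g e)"
proof -
  obtain Kf Kg where K: "supported Kf f" "supported Kg g"
    using assms unfolding computable_def by blast
  define r where "r = max Kf Kg"
  have fg: "f (e(r := x)) = f e" "g (e(r := x)) = g e" for e x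
    using supported_upd[OF K(1)] supported_upd[OF K(2)] by (auto simp: r_def)
  let ?P = "\<lambda>e. of_bool (f e < (e r + 1) * g e) :: nat"
  have "computable (\<lambda>e. of_bool (0 < g e) * (LEAST x. f e \<le> x \<or> ?P (e(r := x)) \<noteq> 0))"
    by (intro computable_Least computable_times computable_less computable_plus computable_var
        computable_const assms)
  moreover have "of_bool (0 < g e) * (LEAST x. f e \<le> x \<or> ?P (e(r := x)) \<noteq> 0) = f e div g e" for e
  proof (cases "g e = 0")
    case False
    have "(LEAST x. f e \<le> x \<or> ?P (e(r := x)) \<noteq> 0) = f e div g e"
    proof (rule Least_equality)
      have "f e < (f e div g e + 1) * g e"
        using False by (metis Suc_eq_plus1 dividend_less_div_times mult_Suc gr0I add.commute)
      then show "f e \<le> f e div g e \<or> ?P (e(r := f e div g e)) \<noteq> 0" by (simp add: fg)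
    next
      fix y assume "f e \<le> y \<or> ?P (e(r := y)) \<noteq> 0"
      then consider "f e \<le> y" | "f e < Suc y * g e" by (auto simp: fg split: if_splits)
      then show "f e div g e \<le> y"
      proof cases
        case 1
        then show ?thesis by (metis div_le_dividend le_trans)
      next
        case 2
        then show ?thesis using less_mult_imp_div_less less_Suc_eq_le by blast
      qed
    qed
    with False show ?thesis by simp
  qed simp
  ultimately show ?thesis by simp
qed


section \<open>Stage-wise machines\<close>

text \<open>A stage updates all variables from their old values. The results are therefore collected
  in a block of scratch registers before \<open>runs_moves\<close> brings them into place.\<close>

lemma computable_scratch:
  assumes "\<And>i. i < L \<Longrightarrow> computable (f i)"
  shows "\<exists>K0. \<forall>K\<ge>K0. \<exists>P. \<forall>e. (\<forall>r\<ge>K. e r = 0) \<longrightarrow>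
    runs P e (\<lambda>r. if K \<le> r \<and> r < K + L then f (r - K) e else e r)"
  using assms
proof (induction L)
  case 0
  have "(K \<le> r \<and> r < K + 0) = False" for K r :: nat by auto
  then show ?case
    by (intro exI[of _ 0] allI impI exI[of _ Skip]) (simp only: if_False runs_Skip)
next
  case (Suc L)
  then obtain K1 where K1: "\<And>K. K1 \<le> K \<Longrightarrow> \<exists>P. \<forall>e. (\<forall>r\<ge>K. e r = 0) \<longrightarrow>
    runs P e (\<lambda>r. if K \<le> r \<and> r < K + L then f (r - K) e else e r)" by auto
  obtain K2 where K2: "supported K2 (f L)" "\<And>K d. K \<ge> K2 \<Longrightarrow> d < K \<Longrightarrow> \<exists>P. computes P K d (f L)"
    using Suc.prems[of L] unfolding computable_def by blast
  show ?case
  proof (intro exI[of _ "max K1 K2"] allI impI)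
    fix K assume K: "max K1 K2 \<le> K"
    obtain P where P: "\<And>e. (\<forall>r\<ge>K. e r = 0) \<Longrightarrow>
        runs P e (\<lambda>r. if K \<le> r \<and> r < K + L then f (r - K) e else e r)"
      using K1[of K] K by auto
    obtain Q where Q: "computes Q (K + L + 1) (K + L) (f L)" using K2(2)[of "K + L + 1" "K + L"] K by auto
    show "\<exists>P. \<forall>e. (\<forall>r\<ge>K. e r = 0) \<longrightarrow>
        runs P e (\<lambda>r. if K \<le> r \<and> r < K + Suc L then f (r - K) e else e r)"
    proof (intro exI[of _ "P ;; Q"] allI impI)
      fix e :: "nat \<Rightarrow> nat" assume e: "\<forall>r\<ge>K. e r = 0"
      let ?e1 = "\<lambda>r. if K \<le> r \<and> r < K + L then f (r - K) e else e r"
      have "f L ?e1 = f L e" by (rule supportedD[OF K2(1)]) (use K in auto)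
      then have "runs Q ?e1 (?e1(K + L := f L e))"
        using Q[unfolded computes_def, rule_format, of ?e1] e by auto
      moreover have "?e1(K + L := f L e) = (\<lambda>r. if K \<le> r \<and> r < K + Suc L then f (r - K) e else e r)"
        by (auto simp: fun_eq_iff)
      ultimately have "runs Q ?e1 (\<lambda>r. if K \<le> r \<and> r < K + Suc L then f (r - K) e else e r)" by simp
      then show "runs (P ;; Q) e (\<lambda>r. if K \<le> r \<and> r < K + Suc L then f (r - K) e else e r)"
        by (rule runs_Seq[OF P[OF e]])
    qed
  qed
qed

lemma runs_moves:
  assumes "L \<le> K"
  shows "\<exists>P. \<forall>e. runs P e (\<lambda>r. if r < L then e (K + r) else if K \<le> r \<and> r < K + L then 0 else e r)"
  using assms
proof (induction L)
  case 0
  have "(K \<le> r \<and> r < K + 0) = False" "(r < 0) = False" for r by auto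
  then show ?case by (intro exI[of _ Skip] allI) (simp only: if_False runs_Skip)
next
  case (Suc L)
  then obtain P where P: "\<And>e. runs P e
      (\<lambda>r. if r < L then e (K + r) else if K \<le> r \<and> r < K + L then 0 else e r)" by auto
  show ?case
  proof (intro exI[of _ "P ;; move (K + L) L"] allI)
    fix e :: "nat \<Rightarrow> nat"
    let ?e1 = "\<lambda>r. if r < L then e (K + r) else if K \<le> r \<and> r < K + L then 0 else e r"
    let ?e2 = "\<lambda>r. if r < Suc L then e (K + r) else if K \<le> r \<and> r < K + Suc L then 0 else e r"
    have "?e1(K + L := 0, L := ?e1 (K + L)) = ?e2" using Suc.prems by (auto simp: fun_eq_iff)
    then have "runs (move (K + L) L) ?e1 ?e2"
      using runs_move[of "K + L" L ?e1] Suc.prems by auto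
    then show "runs (P ;; move (K + L) L) e ?e2" using runs_Seq[OF P] by blast
  qed
qed

lemma computable_simultaneous:
  assumes "\<And>i. i < L \<Longrightarrow> computable (f i)"
  shows "\<exists>P. \<forall>e. (\<forall>r\<ge>L. e r = 0) \<longrightarrow> runs P e (\<lambda>r. if r < L then f r e else e r)"
proof -
  obtain K0 where K0: "\<And>K. K0 \<le> K \<Longrightarrow> \<exists>P. \<forall>e. (\<forall>r\<ge>K. e r = 0) \<longrightarrow>
      runs P e (\<lambda>r. if K \<le> r \<and> r < K + L then f (r - K) e else e r)"
    using computable_scratch[of L f] assms by auto
  define K where "K = max K0 L"
  obtain P where P: "\<And>e. (\<forall>r\<ge>K. e r = 0) \<Longrightarrow>
      runs P e (\<lambda>r. if K \<le> r \<and> r < K + L then f (r - K) e else e r)"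
    using K0[of K] by (auto simp: K_def)
  obtain Q where Q: "\<And>e. runs Q e (\<lambda>r. if r < L then e (K + r) else if K \<le> r \<and> r < K + L then 0 else e r)"
    using runs_moves[of L K] by (auto simp: K_def)
  show ?thesis
  proof (intro exI[of _ "P ;; Q"] allI impI)
    fix e :: "nat \<Rightarrow> nat" assume e: "\<forall>r\<ge>L. e r = 0"
    let ?e1 = "\<lambda>r. if K \<le> r \<and> r < K + L then f (r - K) e else e r"
    have "(\<lambda>r. if r < L then ?e1 (K + r) else if K \<le> r \<and> r < K + L then 0 else ?e1 r)
        = (\<lambda>r. if r < L then f r e else e r)"
      using e by (auto simp: fun_eq_iff K_def)
    then have "runs Q ?e1 (\<lambda>r. if r < L then f r e else e r)" using Q[of ?e1] by simp
    moreover have "runs P e ?e1" by (rule P) (use e in \<open>auto simp: K_def\<close>)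
    ultimately show "runs (P ;; Q) e (\<lambda>r. if r < L then f r e else e r)"
      by (intro runs_Seq)
  qed
qed

text \<open>Registers \<open>0\<close> and \<open>1\<close> request output bits; the variables of a stage-wise machine come after them.\<close>

definition reg :: "'v::countable \<Rightarrow> nat" where
  "reg v = to_nat v + 2"

lemma reg_eq_iff [simp]: "reg v = reg v' \<longleftrightarrow> v = v'"
  by (simp add: reg_def)

definition effective :: "(('v::countable \<Rightarrow> nat) \<Rightarrow> nat) \<Rightarrow> bool" where
  "effective f \<longleftrightarrow> computable (\<lambda>e. f (\<lambda>v. e (reg v)))"

definition symbol_code :: "bool option \<Rightarrow> nat" where
  "symbol_code x = (case x of None \<Rightarrow> 0 | Some False \<Rightarrow> 1 | Some True \<Rightarrow> 2)"

definition with_inputs ::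
  "'v \<Rightarrow> 'v \<Rightarrow> (input \<Rightarrow> input_tape) \<Rightarrow> nat \<Rightarrow> ('v \<Rightarrow> nat) \<Rightarrow> 'v \<Rightarrow> nat" where
  "with_inputs v\<^sub>1 v\<^sub>2 tp t s =
     s(v\<^sub>1 := symbol_code (tp Name t), v\<^sub>2 := symbol_code (tp Advice t))"

text \<open>Registers that belong to no variable, in particular the output requests 0 and 1, are
  blank between stages.\<close>

definition emb :: "('v::countable \<Rightarrow> nat) \<Rightarrow> nat \<Rightarrow> nat" where
  "emb s r = (if \<exists>v::'v. r = reg v then s (THE v. r = reg v) else 0)"

lemma emb_reg [simp]: "emb s (reg v) = s v"
proof -
  have "(THE v'. reg v = reg v') = v" by (rule the_equality) auto
  then show ?thesis by (auto simp: emb_def)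
qed

lemma emb_upd: "(emb s)(reg v := x) = emb (s(v := x))"
proof
  fix r
  show "((emb s)(reg v := x)) r = emb (s(v := x)) r"
  proof (cases "\<exists>v'::'a. r = reg v'")
    case True
    then show ?thesis by auto
  next
    case False
    then show ?thesis by (auto simp: emb_def)
  qed
qed

text \<open>Testing twice for \<open>Some True\<close> yields the code 2; \<open>Some False\<close>
  yields 1 and a blank leaves 0.\<close>

definition read_code :: "input \<Rightarrow> nat \<Rightarrow> prog" where
  "read_code i r = clear r ;; Basic (Add_In i (Some False) r) ;; Basic (Add_In i (Some True) r) ;;
     Basic (Add_In i (Some True) r) ;; Basic (Adv i)"

lemma exec_clear: "exec ins (clear r) (e, h, w) (e(r := 0), h, w)"
  using runs_clear by (simp add: runs_def)

lemma exec_read_code: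
  "exec ins (read_code i r) (e, h, w) (e(r := symbol_code (ins i (h i))), h(i := Suc (h i)), w)"
  unfolding read_code_def
  by (intro exec_Seq[OF exec_clear] exec_Seq[OF exec_Basic[OF refl]] exec_Basic)
    (auto simp: symbol_code_def split: option.splits bool.splits)

text \<open>\<open>While\<close> serves as a conditional: the body clears its own guard, so it runs
  at most once.\<close>

definition emit :: "nat \<Rightarrow> bool \<Rightarrow> prog" where
  "emit r b = While r (clear r ;; Basic (Out b))"

lemma exec_emit:
  "exec ins (emit r b) (e, h, w) (e(r := 0), h, w @ (if e r = 0 then [] else [b]))"
proof (cases "e r = 0")
  case True
  then have "e(r := 0) = e" by auto
  then show ?thesis using True exec_While_0[of "(e, h, w)" r] by (simp add: emit_def)
next
  case False
  have "exec ins (clear r ;; Basic (Out b)) (e, h, w) (e(r := 0), h, w @ [b])"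
    by (intro exec_Seq[OF exec_clear] exec_Basic) simp
  from exec_While_Suc[OF _ this exec_While_0] show ?thesis using False by (simp add: emit_def)
qed

text \<open>One machine has to serve all inputs, so the trajectories \<open>s\<close> and
  \<open>out\<close> are quantified after \<open>M\<close>. They are given by recursion equations,
  which leaves the later correctness proof free of tapes and programs.\<close>

theorem stage_machine:
  fixes F :: "'v::countable \<Rightarrow> ('v \<Rightarrow> nat) \<Rightarrow> nat"
  assumes V: "finite V" and F: "\<And>v. v \<in> V \<Longrightarrow> effective (F v)"
    and o: "effective o0" "effective o1" and v12: "v\<^sub>1 \<noteq> v\<^sub>2"
  shows "\<exists>M. wf_type2_machine M \<and> num_inputs M = 2 \<and>
    (\<forall>tp s out y.
       s 0 = (\<lambda>_. 0) \<and>
       (\<forall>t. s (Suc t) = (\<lambda>v. if v \<in> V then F v (with_inputs v\<^sub>1 v\<^sub>2 tp t (s t))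
                             else with_inputs v\<^sub>1 v\<^sub>2 tp t (s t) v)) \<and>
       out 0 = [] \<and>
       (\<forall>t. out (Suc t) = out t @ (if o0 (with_inputs v\<^sub>1 v\<^sub>2 tp t (s t)) = 0 then [] else [False])
                                @ (if o1 (with_inputs v\<^sub>1 v\<^sub>2 tp t (s t)) = 0 then [] else [True])) \<and>
       (\<forall>t. out t = stake (length (out t)) y) \<and> (\<forall>k. \<exists>t. k \<le> length (out t)) \<longrightarrow>
       outputs M [tp Name, tp Advice] y)"
proof -
  define W where "W = V \<union> {v\<^sub>1, v\<^sub>2}"
  \<comment> \<open>One successor puts \<open>L\<close> above all registers of \<open>W\<close>; the
    other makes \<open>2 \<le> L\<close> immediate, so that the output requests are among the
    assigned registers.\<close>
  define L where "L = Suc (Suc (Max (reg ` W)))"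
  have WL: "reg v < L" if "v \<in> W" for v
  proof -
    have "reg v \<le> Max (reg ` W)" using that V by (intro Max_ge) (auto simp: W_def)
    then show ?thesis by (simp add: L_def)
  qed
  have L2: "2 \<le> L" by (simp add: L_def)
  define f where "f = (\<lambda>r e. if r = 0 then o0 (\<lambda>v. e (reg v)) else if r = 1 then o1 (\<lambda>v. e (reg v))
    else if r \<in> reg ` V then F (THE v. r = reg v) (\<lambda>v. e (reg v)) else e r)"
  have f: "computable (f r)" for r
  proof -
    have 1: "F (THE v. r = reg v) = F v" if "r = reg v" for v
      using that by (metis (mono_tags, lifting) reg_eq_iff the_equality)
    consider "r = 0" | "r = 1" | v where "v \<in> V" "r = reg v" "r \<noteq> 0" "r \<noteq> 1" |
      "r \<notin> reg ` V" "r \<noteq> 0" "r \<noteq> 1" by blast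
    then show ?thesis
      by cases (use o F 1 in \<open>auto simp: f_def[abs_def] effective_def computable_var\<close>)
  qed
  obtain P where P: "\<And>e. (\<forall>r\<ge>L. e r = 0) \<Longrightarrow> runs P e (\<lambda>r. if r < L then f r e else e r)"
    using computable_simultaneous[of L f] f by blast
  define B where "B = read_code Name (reg v\<^sub>1) ;; read_code Advice (reg v\<^sub>2) ;; P ;; emit 0 False ;; emit 1 True"
  let ?M = "machine (compile 0 B @ [Jmp 0])"
  show ?thesis
  proof (intro exI[of _ ?M] conjI allI impI wf_machine)
    show "num_inputs ?M = 2" by (simp add: machine_def Let_def)
    fix tp s out y
    assume H: "s 0 = (\<lambda>_. 0) \<and>
       (\<forall>t. s (Suc t) = (\<lambda>v. if v \<in> V then F v (with_inputs v\<^sub>1 v\<^sub>2 tp t (s t))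
                             else with_inputs v\<^sub>1 v\<^sub>2 tp t (s t) v)) \<and>
       out 0 = [] \<and>
       (\<forall>t. out (Suc t) = out t @ (if o0 (with_inputs v\<^sub>1 v\<^sub>2 tp t (s t)) = 0 then [] else [False])
                                @ (if o1 (with_inputs v\<^sub>1 v\<^sub>2 tp t (s t)) = 0 then [] else [True])) \<and>
       (\<forall>t. out t = stake (length (out t)) y) \<and> (\<forall>k. \<exists>t. k \<le> length (out t))"
    \<comment> \<open>Variables outside \<open>W\<close> never leave 0, so the registers from
      \<open>L\<close> on are blank scratch space at the start of every stage.\<close>
    have s0: "s t v = 0" if "v \<notin> W" for t v
      using H that by (induction t) (auto simp: with_inputs_def W_def)
    have reg01: "reg (v::'v) \<noteq> 0" "reg (v::'v) \<noteq> 1" "reg (v::'v) \<noteq> Suc 0" for v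
      by (auto simp: reg_def)
    let ?S = "\<lambda>t. (emb (s t), \<lambda>_::input. t, out t)"
    show "outputs ?M [tp Name, tp Advice] y"
    proof (rule loop_machine[where S = ?S])
      show "?S 0 = (\<lambda>_. 0, \<lambda>_. 0, [])" using H by (auto simp: emb_def fun_eq_iff)
      fix t
      define i where "i = with_inputs v\<^sub>1 v\<^sub>2 tp t (s t)"
      let ?e2 = "\<lambda>r. if r < L then f r (emb i) else emb i r"
      have i0: "emb i r = 0" if "r \<ge> L" for r
      proof (cases "\<exists>v::'v. r = reg v")
        case True
        then obtain v where v: "r = reg v" "v \<notin> W" using WL \<open>r \<ge> L\<close> by (metis not_le)
        then show ?thesis using s0[of v t] by (auto simp: i_def with_inputs_def W_def)
      qed (auto simp: emb_def)
      have "exec tp (read_code Name (reg v\<^sub>1) ;; read_code Advice (reg v\<^sub>2)) (?S t)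
          (emb i, (\<lambda>_. t)(Name := Suc t, Advice := Suc t), out t)"
        using exec_Seq[OF exec_read_code[of tp Name "reg v\<^sub>1" "emb (s t)" "\<lambda>_. t" "out t"]
            exec_read_code[of tp Advice "reg v\<^sub>2"]]
        by (simp add: emb_upd i_def with_inputs_def)
      moreover have "(\<lambda>_. t)(Name := Suc t, Advice := Suc t) = (\<lambda>_. Suc t)"
        by (auto simp: fun_eq_iff) (metis input.exhaust)
      ultimately have 1: "exec tp (read_code Name (reg v\<^sub>1) ;; read_code Advice (reg v\<^sub>2)) (?S t)
          (emb i, \<lambda>_. Suc t, out t)" by simp
      have 2: "exec tp P (emb i, \<lambda>_. Suc t, out t) (?e2, \<lambda>_. Suc t, out t)"
        using P[of "emb i"] i0 by (simp add: runs_def)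
      define e2 where "e2 = ?e2"
      have e20: "e2 0 = o0 i" "e2 1 = o1 i" using L2 by (auto simp: f_def e2_def)
      have out: "out (Suc t) = out t @ (if o0 i = 0 then [] else [False]) @ (if o1 i = 0 then [] else [True])"
        using H by (simp add: i_def)
      have "?e2(0 := 0, 1 := 0) = emb (s (Suc t))"
      proof
        fix r
        show "(?e2(0 := 0, 1 := 0)) r = emb (s (Suc t)) r"
        proof (cases "\<exists>v::'v. r = reg v")
          case True
          then obtain v :: 'v where v: "r = reg v" by blast
          have "(THE v'. reg v = reg v') = v" by (rule the_equality) auto
          then have "f r (emb i) = s (Suc t) v"
            using H v reg01[of v] by (auto simp: f_def i_def)
          moreover have "emb i r = s (Suc t) v" if "\<not> r < L"
            using WL[of v] that v H by (auto simp: W_def i_def)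
          ultimately show ?thesis using v reg01[of v] by auto
        next
          case False
          then have "r \<notin> reg ` V" by blast
          with False show ?thesis by (auto simp: emb_def f_def)
        qed
      qed
      then have e2E: "e2(0 := 0, 1 := 0) = emb (s (Suc t))" by (simp add: e2_def)
      have 3: "exec tp (emit 0 False ;; emit 1 True) (e2, \<lambda>_. Suc t, out t) (?S (Suc t))"
        using exec_Seq[OF exec_emit[of tp 0 False e2 "\<lambda>_. Suc t" "out t"] exec_emit[of tp 1 True]] e20 e2E out
        by (simp del: One_nat_def)
      \<comment> \<open>\<open>;;\<close> associates to the right, whereas the two reading programs
        were executed as a unit.\<close>
      have assoc: "exec tp (X ;; Y ;; Z) a b" if "exec tp (X ;; Y) a c" "exec tp Z c b" for X Y Z a b c
        using that by (auto elim!: exec.cases[of _ "X ;; Y"] intro: exec_Seq)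
      show "exec tp B (?S t) (?S (Suc t))"
        unfolding B_def by (rule assoc[OF 1 exec_Seq[OF 2[folded e2_def] 3]])
    qed (use H in auto)
  qed
qed

section \<open>Effective functions of the variables\<close>

named_theorems effective_intros

lemma effective_var [effective_intros]: "effective (\<lambda>s. s v)"
  unfolding effective_def by (rule computable_var)

lemma effective_const [effective_intros]: "effective (\<lambda>_. c)"
  unfolding effective_def by (rule computable_const)

lemma effective_plus [effective_intros]:
  "effective f \<Longrightarrow> effective g \<Longrightarrow> effective (\<lambda>s. f s + g s)"
  unfolding effective_def by (rule computable_plus)

lemma effective_minus [effective_intros]:
  "effective f \<Longrightarrow> effective g \<Longrightarrow> effective (\<lambda>s. f s - g s)"
  unfolding effective_def by (rule computable_minus)

lemma effective_times [effective_intros]: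
  "effective f \<Longrightarrow> effective g \<Longrightarrow> effective (\<lambda>s. f s * g s)"
  unfolding effective_def by (rule computable_times)

lemma effective_div [effective_intros]:
  "effective f \<Longrightarrow> effective g \<Longrightarrow> effective (\<lambda>s. f s div g s)"
  unfolding effective_def by (rule computable_div)

lemma effective_mod [effective_intros]:
  assumes "effective f" "effective g"
  shows "effective (\<lambda>s. f s mod g s)"
  unfolding minus_div_mult_eq_mod[symmetric] by (intro effective_intros assms)

lemma effective_power [effective_intros]:
  assumes "effective f"
  shows "effective (\<lambda>s. f s ^ k)"
  by (induction k) (auto intro!: effective_intros assms)

lemma effective_sum [effective_intros]:
  assumes "\<And>i. i \<in> I \<Longrightarrow> effective (\<lambda>s. f s i)"
  shows "effective (\<lambda>s. \<Sum>i\<in>I. f s i)"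
  using assms by (induction I rule: infinite_finite_induct) (auto intro!: effective_intros)

definition effective_pred :: "(('v::countable \<Rightarrow> nat) \<Rightarrow> bool) \<Rightarrow> bool" where
  "effective_pred Q \<longleftrightarrow> effective (\<lambda>s. of_bool (Q s))"

lemma effective_of_bool [effective_intros]: "effective_pred Q \<Longrightarrow> effective (\<lambda>s. of_bool (Q s))"
  by (simp add: effective_pred_def)

lemma effective_pred_less [effective_intros]:
  "effective f \<Longrightarrow> effective g \<Longrightarrow> effective_pred (\<lambda>s. f s < g s)"
  unfolding effective_def effective_pred_def by (rule computable_less)

lemma effective_pred_const [effective_intros]: "effective_pred (\<lambda>_. b)"
  unfolding effective_pred_def by (rule effective_const)

lemma effective_pred_not [effective_intros]:
  assumes "effective_pred P"
  shows "effective_pred (\<lambda>s. \<not> P s)"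
proof -
  have "(\<lambda>s. of_bool (\<not> P s)) = (\<lambda>s. 1 - of_bool (P s) :: nat)" by auto
  then show ?thesis unfolding effective_pred_def by (simp only:) (intro effective_intros assms)
qed

lemma effective_pred_conj [effective_intros]:
  assumes "effective_pred P" "effective_pred Q"
  shows "effective_pred (\<lambda>s. P s \<and> Q s)"
  using assms unfolding effective_pred_def of_bool_conj by (rule effective_times)

lemma effective_pred_disj [effective_intros]:
  assumes "effective_pred P" "effective_pred Q"
  shows "effective_pred (\<lambda>s. P s \<or> Q s)"
proof -
  have "effective_pred (\<lambda>s. \<not> (\<not> P s \<and> \<not> Q s))" by (intro effective_intros assms)
  then show ?thesis by simp
qed

lemma effective_pred_le [effective_intros]:
  assumes "effective f" "effective g"
  shows "effective_pred (\<lambda>s. f s \<le> g s)"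
  unfolding not_less[symmetric] by (intro effective_intros assms)

lemma effective_pred_eq [effective_intros]:
  assumes "effective f" "effective g"
  shows "effective_pred (\<lambda>s. f s = g s)"
  unfolding order_eq_iff by (intro effective_intros assms)

lemma effective_pred_ball [effective_intros]:
  assumes "finite I" "\<And>i. i \<in> I \<Longrightarrow> effective_pred (\<lambda>s. P s i)"
  shows "effective_pred (\<lambda>s. \<forall>i\<in>I. P s i)"
  using assms by (induction I rule: finite_induct) (auto intro!: effective_intros)

lemma effective_pred_bex [effective_intros]:
  assumes "finite I" "\<And>i. i \<in> I \<Longrightarrow> effective_pred (\<lambda>s. P s i)"
  shows "effective_pred (\<lambda>s. \<exists>i\<in>I. P s i)"
  using assms by (induction I rule: finite_induct) (auto intro!: effective_intros)

lemma effective_if [effective_intros]: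
  assumes "effective_pred Q" "effective f" "effective g"
  shows "effective (\<lambda>s. if Q s then f s else g s)"
proof -
  have "(\<lambda>s. if Q s then f s else g s) = (\<lambda>s. of_bool (Q s) * f s + of_bool (\<not> Q s) * g s)"
    by auto
  then show ?thesis by (simp only:) (intro effective_intros assms)
qed

lemma effective_Least:
  assumes "effective B" "effective_pred P"
  shows "effective (\<lambda>s. LEAST x. B s \<le> x \<or> P (s(v := x)))"
proof -
  have *: "(\<lambda>u. (e(reg v := x)) (reg u)) = (\<lambda>u. e (reg u))(v := x)" for e x by auto
  show ?thesis
    using computable_Least[of "\<lambda>e. B (\<lambda>u. e (reg u))" "\<lambda>e. of_bool (P (\<lambda>u. e (reg u)))" "reg v"] assms
    unfolding effective_def effective_pred_def by (simp only: * of_bool_eq_0_iff not_not simp_thms)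
qed

text \<open>Registers hold naturals and subtraction truncates. On pairs of naturals, sums and
  products of integers need no case distinction on signs, and order becomes an inequality between
  sums.\<close>

definition effective_int :: "(('v::countable \<Rightarrow> nat) \<Rightarrow> int) \<Rightarrow> bool" where
  "effective_int f \<longleftrightarrow> (\<exists>p q. effective p \<and> effective q \<and> f = (\<lambda>s. int (p s) - int (q s)))"

lemma effective_intI:
  "effective p \<Longrightarrow> effective q \<Longrightarrow> (\<And>s. f s = int (p s) - int (q s)) \<Longrightarrow> effective_int f"
  unfolding effective_int_def by blast

lemma effective_intE:
  assumes "effective_int f"
  obtains p q where "effective p" "effective q" "\<And>s. f s = int (p s) - int (q s)"
  using assms unfolding effective_int_def by auto

lemma effective_int_of_nat [effective_intros]: "effective f \<Longrightarrow> effective_int (\<lambda>s. int (f s))"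
  by (rule effective_intI[of f "\<lambda>_. 0"]) (auto intro!: effective_intros)

lemma effective_int_minus [effective_intros]:
  assumes "effective_int f" "effective_int g"
  shows "effective_int (\<lambda>s. f s - g s)"
proof -
  obtain p q where f: "effective p" "effective q" "\<And>s. f s = int (p s) - int (q s)"
    using effective_intE[OF assms(1)] by blast
  obtain p' q' where g: "effective p'" "effective q'" "\<And>s. g s = int (p' s) - int (q' s)"
    using effective_intE[OF assms(2)] by blast
  show ?thesis
    by (rule effective_intI[of "\<lambda>s. p s + q' s" "\<lambda>s. q s + p' s"]) (auto intro!: effective_intros f g simp: f(3) g(3))
qed

lemma effective_int_const [effective_intros]: "effective_int (\<lambda>_. c)"
  by (rule effective_intI[of "\<lambda>_. nat c" "\<lambda>_. nat (- c)"]) (auto intro!: effective_intros)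

lemma effective_int_plus [effective_intros]:
  assumes "effective_int f" "effective_int g"
  shows "effective_int (\<lambda>s. f s + g s)"
proof -
  have "effective_int (\<lambda>s. f s - (0 - g s))" by (intro effective_intros assms)
  then show ?thesis by simp
qed

lemma effective_int_times [effective_intros]:
  assumes "effective_int f" "effective_int g"
  shows "effective_int (\<lambda>s. f s * g s)"
proof -
  obtain p q where f: "effective p" "effective q" "\<And>s. f s = int (p s) - int (q s)"
    using effective_intE[OF assms(1)] by blast
  obtain p' q' where g: "effective p'" "effective q'" "\<And>s. g s = int (p' s) - int (q' s)"
    using effective_intE[OF assms(2)] by blast
  show ?thesis
    by (rule effective_intI[of "\<lambda>s. p s * p' s + q s * q' s" "\<lambda>s. p s * q' s + q s * p' s"])
      (auto intro!: effective_intros f g simp: f(3) g(3) algebra_simps)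
qed

lemma effective_int_sum [effective_intros]:
  assumes "\<And>i. i \<in> I \<Longrightarrow> effective_int (\<lambda>s. f s i)"
  shows "effective_int (\<lambda>s. \<Sum>i\<in>I. f s i)"
  using assms by (induction I rule: infinite_finite_induct) (auto intro!: effective_intros)

lemma effective_nat_abs [effective_intros]:
  assumes "effective_int f"
  shows "effective (\<lambda>s. nat \<bar>f s\<bar>)"
proof -
  obtain p q where f: "effective p" "effective q" "\<And>s. f s = int (p s) - int (q s)"
    using effective_intE[OF assms] by blast
  have "(\<lambda>s. nat \<bar>f s\<bar>) = (\<lambda>s. (p s - q s) + (q s - p s))" by (auto simp: f(3))
  then show ?thesis by (simp only:) (intro effective_intros f)
qed

lemma effective_int_abs [effective_intros]:
  assumes "effective_int f"
  shows "effective_int (\<lambda>s. \<bar>f s\<bar>)"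
proof -
  have "effective_int (\<lambda>s. int (nat \<bar>f s\<bar>))" by (intro effective_intros assms)
  then show ?thesis by simp
qed

lemma effective_pred_int_less [effective_intros]:
  assumes "effective_int f" "effective_int g"
  shows "effective_pred (\<lambda>s. f s < g s)"
proof -
  obtain p q where f: "effective p" "effective q" "\<And>s. f s = int (p s) - int (q s)"
    using effective_intE[OF assms(1)] by blast
  obtain p' q' where g: "effective p'" "effective q'" "\<And>s. g s = int (p' s) - int (q' s)"
    using effective_intE[OF assms(2)] by blast
  have "(\<lambda>s. f s < g s) = (\<lambda>s. p s + q' s < p' s + q s)" by (auto simp: f(3) g(3))
  then show ?thesis by (simp only:) (intro effective_intros f g)
qed

lemma effective_pred_int_le [effective_intros]:
  assumes "effective_int f" "effective_int g"
  shows "effective_pred (\<lambda>s. f s \<le> g s)"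
  unfolding not_less[symmetric] by (intro effective_intros assms)

section \<open>The spectral theorem\<close>

text \<open>Fewer homogeneous equations than unknowns: zero rows pad the system to a square matrix,
  and since row \<open>k\<close> is zero its determinant vanishes.\<close>

lemma ex_orthogonal:
  fixes M :: "nat \<Rightarrow> nat \<Rightarrow> real"
  assumes "k < n"
  shows "\<exists>x. (\<exists>i<n. x i \<noteq> 0) \<and> (\<forall>i\<ge>n. x i = 0) \<and> (\<forall>j<k. (\<Sum>i<n. M j i * x i) = 0)"
proof -
  define A where "A = mat n n (\<lambda>(j, i). if j < k then M j i else 0)"
  have A: "A \<in> carrier_mat n n" by (simp add: A_def)
  have "A = mat\<^sub>r n n (\<lambda>j. if j = k then 0\<^sub>v n else row A j)"
    by (rule eq_matI) (use assms in \<open>auto simp: A_def mat_of_rows_def\<close>)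
  also have "det \<dots> = 0" by (rule det_row_0[OF assms]) (auto simp: A_def)
  finally have "det A = 0" .
  then obtain v where v: "v \<in> carrier_vec n" "v \<noteq> 0\<^sub>v n" "A *\<^sub>v v = 0\<^sub>v n"
    using det_0_iff_vec_prod_zero_field[OF A] by blast
  define x where "x = (\<lambda>i. if i < n then v $ i else 0)"
  have "\<exists>i<n. x i \<noteq> 0"
  proof (rule ccontr)
    assume "\<not> ?thesis"
    then have "v = 0\<^sub>v n" using v(1) by (intro eq_vecI) (auto simp: x_def)
    with v(2) show False by simp
  qed
  moreover have "(\<Sum>i<n. M j i * x i) = 0" if j: "j < k" for j
  proof -
    have "(A *\<^sub>v v) $ j = (\<Sum>i<n. M j i * x i)"
      using v(1) j assms by (auto simp: A_def scalar_prod_def x_def atLeast0LessThan intro!: sum.cong)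
    then show ?thesis using v(3) j assms by simp
  qed
  ultimately show ?thesis by (intro exI[of _ x]) (auto simp: x_def)
qed

definition dot :: "nat \<Rightarrow> (nat \<Rightarrow> real) \<Rightarrow> (nat \<Rightarrow> real) \<Rightarrow> real" where
  "dot n x y = (\<Sum>i<n. x i * y i)"

definition app :: "nat \<Rightarrow> (nat \<Rightarrow> nat \<Rightarrow> real) \<Rightarrow> (nat \<Rightarrow> real) \<Rightarrow> nat \<Rightarrow> real" where
  "app n a x i = (\<Sum>j<n. a i j * x j)"

lemma dot_commute: "dot n x y = dot n y x"
  by (simp add: dot_def mult.commute)

lemma dot_add: "dot n x (\<lambda>i. y i + z i) = dot n x y + dot n x z"
  by (simp add: dot_def sum.distrib algebra_simps)

lemma dot_scale: "dot n x (\<lambda>i. c * y i) = c * dot n x y"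
  by (simp add: dot_def sum_distrib_left algebra_simps)

lemma dot_scale_left: "dot n (\<lambda>i. c * y i) x = c * dot n y x"
  by (simp add: dot_def sum_distrib_left algebra_simps)

lemma dot_sum: "dot n x (\<lambda>i. \<Sum>k\<in>I. c k * y k i) = (\<Sum>k\<in>I. c k * dot n x (y k))"
  unfolding dot_def sum_distrib_left by (subst sum.swap) (simp add: algebra_simps)

lemma app_add: "app n a (\<lambda>i. y i + z i) = (\<lambda>i. app n a y i + app n a z i)"
  by (rule ext) (simp add: app_def sum.distrib algebra_simps)

lemma app_scale: "app n a (\<lambda>i. c * y i) = (\<lambda>i. c * app n a y i)"
  by (rule ext) (simp add: app_def sum_distrib_left algebra_simps)

lemma app_sum: "app n a (\<lambda>i. \<Sum>k\<in>I. c k * y k i) = (\<lambda>i. \<Sum>k\<in>I. c k * app n a (y k) i)"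
  unfolding app_def sum_distrib_left by (subst sum.swap) (simp add: algebra_simps)

lemma dot_app_symmetric:
  assumes "\<And>i j. i < n \<Longrightarrow> j < n \<Longrightarrow> a i j = a j i"
  shows "dot n x (app n a y) = dot n (app n a x) y"
proof -
  have "dot n x (app n a y) = (\<Sum>i<n. \<Sum>j<n. x i * (a i j * y j))"
    by (simp add: dot_def app_def sum_distrib_left)
  also have "\<dots> = (\<Sum>j<n. \<Sum>i<n. x i * (a j i * y j))"
    by (subst sum.swap) (auto intro!: sum.cong simp: assms)
  also have "\<dots> = dot n (app n a x) y"
    by (simp add: dot_def app_def sum_distrib_left sum_distrib_right algebra_simps)
  finally show ?thesis .
qed

lemma dot_self_eq_0: "dot n x x = 0 \<longleftrightarrow> (\<forall>i<n. x i = 0)"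
  unfolding dot_def by (subst sum_nonneg_eq_0_iff) auto

lemma dot_self_nonneg: "0 \<le> dot n x x"
  unfolding dot_def by (intro sum_nonneg) auto

text \<open>Vectors are functions on all naturals under the product topology. With the coordinates
  from \<open>n\<close> on fixed at 0, the section is a closed part of a product of compact sets,
  hence compact by Tychonoff.\<close>

lemma compact_sphere_section:
  "compact {x::nat \<Rightarrow> real. (\<forall>i\<ge>n. x i = 0) \<and> dot n x x = 1 \<and> (\<forall>k<K. dot n (v k) x = 0)}"
proof -
  let ?S = "\<lambda>i. if i < n then {-1..1} else {0::real}"
  have "compactin (product_topology (\<lambda>_. euclidean) UNIV) (PiE UNIV ?S)"
    by (subst compactin_PiE) auto
  then have C: "compact (PiE UNIV ?S)" by (simp add: euclidean_product_topology)
  have c: "continuous_on UNIV (\<lambda>x. dot n y x)" "continuous_on UNIV (\<lambda>x. dot n x x)" for y :: "nat \<Rightarrow> real"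
    unfolding dot_def by (intro continuous_intros continuous_on_product_coordinates)+
  have "closed {x. dot n x x = 1 \<and> (\<forall>k<K. dot n (v k) x = 0)}"
    by (intro closed_Collect_conj closed_Collect_all closed_Collect_imp open_Collect_const closed_Collect_eq c
        continuous_on_const)
  moreover have "\<bar>x i\<bar> \<le> 1" if "dot n x x = 1" "i < n" for x :: "nat \<Rightarrow> real" and i
  proof -
    have "x i * x i \<le> dot n x x"
      unfolding dot_def using that by (intro member_le_sum) auto
    with that show ?thesis by (metis abs_le_square_iff abs_one one_power2 power2_eq_square)
  qed
  then have "{x. (\<forall>i\<ge>n. x i = 0) \<and> dot n x x = 1 \<and> (\<forall>k<K. dot n (v k) x = 0)}
      = PiE UNIV ?S \<inter> {x. dot n x x = 1 \<and> (\<forall>k<K. dot n (v k) x = 0)}"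
    by (fastforce simp: PiE_def Pi_def abs_le_iff split: if_splits)
  ultimately show ?thesis using compact_Int_closed[OF C] by simp
qed

text \<open>Rayleigh quotient: the quadratic form attains its maximum over the unit vectors
  orthogonal to the eigenvectors found so far, and a maximizer is an eigenvector because the first
  variation vanishes there.\<close>

lemma ex_next_eigenvector:
  assumes sym: "\<And>i j. i < n \<Longrightarrow> j < n \<Longrightarrow> a i j = a j i" and "K < n"
    and ev: "\<And>k i. k < K \<Longrightarrow> i < n \<Longrightarrow> app n a (v k) i = l k * v k i"
  shows "\<exists>x \<rho>. dot n x x = 1 \<and> (\<forall>k<K. dot n (v k) x = 0) \<and> (\<forall>i<n. app n a x i = \<rho> * x i)"
proof -
  define S where "S = {x::nat \<Rightarrow> real. (\<forall>i\<ge>n. x i = 0) \<and> dot n x x = 1 \<and> (\<forall>k<K. dot n (v k) x = 0)}"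
  define q where "q = (\<lambda>x. dot n x (app n a x))"
  have scaled: "(\<lambda>i. 1 / sqrt (dot n y y) * y i) \<in> S"
    if "\<forall>i\<ge>n. y i = 0" "\<exists>i<n. y i \<noteq> 0" "\<forall>k<K. dot n (v k) y = 0" for y
  proof -
    have "dot n y y > 0" using that(2) dot_self_eq_0[of n y] dot_self_nonneg[of n y] by force
    then have "1 / sqrt (dot n y y) * (1 / sqrt (dot n y y) * dot n y y) = 1" by (simp add: field_simps)
    then show ?thesis
      using that unfolding S_def dot_scale dot_scale_left mem_Collect_eq by simp
  qed
  obtain y where "\<exists>i<n. y i \<noteq> 0" "\<forall>i\<ge>n. y i = 0" "\<forall>k<K. dot n (v k) y = 0"
    using ex_orthogonal[OF \<open>K < n\<close>, of v] unfolding dot_def by blast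
  then have "S \<noteq> {}" using scaled by blast
  moreover have "compact S" unfolding S_def by (rule compact_sphere_section)
  moreover have "continuous_on S q"
    unfolding q_def dot_def app_def
    by (intro continuous_intros continuous_on_subset[OF continuous_on_product_coordinates]) auto
  ultimately obtain x where x: "x \<in> S" "\<And>y. y \<in> S \<Longrightarrow> q y \<le> q x"
    using continuous_attains_sup[of S q] by blast
  define \<rho> where "\<rho> = q x"
  have q_le: "q y \<le> \<rho> * dot n y y" if "\<forall>i\<ge>n. y i = 0" "\<forall>k<K. dot n (v k) y = 0" for y
  proof (cases "\<exists>i<n. y i \<noteq> 0")
    case True
    have pos: "dot n y y > 0" using True dot_self_eq_0[of n y] dot_self_nonneg[of n y] by force
    have qs: "q (\<lambda>i. c * y i) = c * (c * q y)" for c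
      unfolding q_def app_scale dot_scale dot_scale_left ..
    then have "q y / dot n y y = q (\<lambda>i. 1 / sqrt (dot n y y) * y i)"
      unfolding qs using pos by (simp add: field_simps)
    also have "\<dots> \<le> \<rho>" unfolding \<rho>_def by (rule x(2)[OF scaled[OF that(1) True that(2)]])
    finally show ?thesis using pos by (simp add: field_simps)
  next
    case False
    then have "q y = 0" "dot n y y = 0" by (auto simp: q_def dot_def)
    then show ?thesis by simp
  qed
  \<comment> \<open>The defect of the eigenvalue equation, proposed as a direction of ascent. It is
    orthogonal to \<open>x\<close> and, by symmetry of \<open>a\<close>, to all \<open>v k\<close>,
    so \<open>x + t w\<close> is admissible in \<open>q_le\<close>.\<close>
  define w where "w = (\<lambda>i. if i < n then app n a x i - \<rho> * x i else 0)"
  have w_app: "dot n y w = dot n y (app n a x) - \<rho> * dot n y x" for y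
    unfolding dot_def w_def by (simp add: sum_distrib_left sum_subtractf algebra_simps)
  have vw: "dot n (v k) w = 0" if "k < K" for k
  proof -
    have "dot n (v k) (app n a x) = dot n (app n a (v k)) x" by (rule dot_app_symmetric[OF sym])
    also have "\<dots> = l k * dot n (v k) x"
      unfolding dot_def sum_distrib_left using ev[OF that] by (intro sum.cong) (auto simp: algebra_simps)
    finally show ?thesis using x(1) that by (simp add: w_app S_def)
  qed
  have xw: "dot n x w = 0" using x(1) by (simp add: w_app S_def \<rho>_def q_def)
  define W where "W = dot n w w"
  have aw: "dot n w (app n a x) = W" using w_app[of w] xw by (simp add: W_def dot_commute)
  \<comment> \<open>The maximum property along \<open>x + t w\<close>; the term linear in
    \<open>t\<close> has coefficient \<open>2 * W\<close>.\<close>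
  have ineq: "2 * t * W + t\<^sup>2 * (q w - \<rho> * W) \<le> 0" for t
  proof -
    let ?y = "\<lambda>i. x i + t * w i"
    have "q ?y \<le> \<rho> * dot n ?y ?y"
      by (rule q_le) (use x(1) vw in \<open>auto simp: S_def w_def dot_add dot_scale\<close>)
    moreover have "dot n ?y ?y = 1 + t\<^sup>2 * W"
    proof -
      have "dot n ?y ?y = dot n x x + 2 * t * dot n x w + t\<^sup>2 * dot n w w"
        by (simp add: dot_def sum_distrib_left sum.distrib power2_eq_square algebra_simps)
      then show ?thesis using x(1) xw by (simp add: S_def W_def)
    qed
    moreover have "q ?y = \<rho> + 2 * t * W + t\<^sup>2 * q w"
    proof -
      have "q ?y = dot n ?y (app n a x) + t * dot n ?y (app n a w)"
        unfolding q_def app_add app_scale by (simp add: dot_add dot_scale)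
      also have "dot n ?y (app n a x) = \<rho> + t * W"
        by (subst dot_commute) (simp add: dot_add dot_scale dot_commute[of n _ x] dot_commute[of n _ w] aw \<rho>_def q_def)
      also have "dot n ?y (app n a w) = dot n x (app n a w) + t * q w"
        by (subst dot_commute) (simp add: dot_add dot_scale dot_commute[of n _ x] dot_commute[of n _ w] q_def)
      also have "dot n x (app n a w) = W"
        using dot_app_symmetric[of n a x w] sym aw by (simp add: dot_commute)
      finally show ?thesis by (simp add: power2_eq_square algebra_simps)
    qed
    ultimately show ?thesis by (simp add: algebra_simps)
  qed
  have "W = 0"
  proof (rule ccontr)
    assume "W \<noteq> 0"
    then have W: "W > 0" using dot_self_nonneg[of n w] by (simp add: W_def)
    define c where "c = q w - \<rho> * W"
    \<comment> \<open>This \<open>t\<close> gives \<open>\<bar>t * c\<bar> \<le> W\<close>, so the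
      linear term dominates the quadratic one.\<close>
    define t where "t = W / (\<bar>c\<bar> + 1)"
    have t: "t > 0" using W by (simp add: t_def)
    have "t * (2 * W + t * c) \<le> 0"
      using ineq[of t] by (simp add: c_def power2_eq_square algebra_simps)
    then have "2 * W + t * c \<le> 0" using t by (auto simp: mult_le_0_iff)
    moreover have "\<bar>t * c\<bar> \<le> W"
      unfolding t_def using W by (simp add: abs_mult field_simps)
    ultimately show False using W by linarith
  qed
  then have "\<forall>i<n. w i = 0" using dot_self_eq_0[of n w] by (simp add: W_def)
  then have "\<forall>i<n. app n a x i = \<rho> * x i" by (simp add: w_def)
  with x(1) show ?thesis unfolding S_def by blast
qed

theorem spectral_theorem:
  assumes sym: "\<And>i j. i < n \<Longrightarrow> j < n \<Longrightarrow> a i j = a j i"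
  shows "\<exists>v l. (\<forall>j<n. \<forall>k<n. dot n (v j) (v k) = of_bool (j = k)) \<and>
    (\<forall>k<n. \<forall>i<n. app n a (v k) i = l k * v k i)"
proof -
  have "\<exists>v l. (\<forall>j<K. \<forall>k<K. dot n (v j) (v k) = of_bool (j = k)) \<and>
    (\<forall>k<K. \<forall>i<n. app n a (v k) i = l k * v k i)" if "K \<le> n" for K
    using that
  proof (induction K)
    case (Suc K)
    then obtain v l where v: "\<forall>j<K. \<forall>k<K. dot n (v j) (v k) = of_bool (j = k)"
      "\<forall>k<K. \<forall>i<n. app n a (v k) i = l k * v k i" by auto
    obtain x \<rho> where x: "dot n x x = 1" "\<forall>k<K. dot n (v k) x = 0" "\<forall>i<n. app n a x i = \<rho> * x i"
      using ex_next_eigenvector[of n a K v l] sym Suc.prems v(2) by auto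
    have "\<forall>k<K. dot n x (v k) = 0" using x(2) by (simp add: dot_commute)
    then show ?case
      by (intro exI[of _ "v(K := x)"] exI[of _ "l(K := \<rho>)"]) (use v x in \<open>auto simp: less_Suc_eq\<close>)
  qed auto
  then show ?thesis by blast
qed

text \<open>For a square matrix, orthonormal rows imply orthonormal columns, since a right inverse
  is a left inverse.\<close>

lemma orthonormal_complete:
  assumes "\<And>j k. j < n \<Longrightarrow> k < n \<Longrightarrow> dot n (v j) (v k) = of_bool (j = k)" "i < n" "j < n"
  shows "(\<Sum>k<n. v k i * v k j) = of_bool (i = j)"
proof -
  define V where "V = mat n n (\<lambda>(k, i). v k i)"
  have V: "V \<in> carrier_mat n n" "transpose_mat V \<in> carrier_mat n n" by (auto simp: V_def)
  have "V * transpose_mat V = 1\<^sub>m n"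
    by (rule eq_matI)
      (use assms(1) in \<open>auto simp: V_def scalar_prod_def dot_def atLeast0LessThan intro!: sum.cong\<close>)
  then have "transpose_mat V * V = 1\<^sub>m n" by (rule mat_mult_left_right_inverse[OF V])
  then have "(transpose_mat V * V) $$ (i, j) = of_bool (i = j)" using assms by auto
  then show ?thesis using assms by (auto simp: V_def scalar_prod_def atLeast0LessThan)
qed

section \<open>Eigenvalue and eigenspace estimates from residuals\<close>

definition residual :: "nat \<Rightarrow> (nat \<Rightarrow> nat \<Rightarrow> real) \<Rightarrow> real \<Rightarrow> (nat \<Rightarrow> real) \<Rightarrow> nat \<Rightarrow> real" where
  "residual n a \<mu> x i = app n a x i - \<mu> * x i"

locale eigensystem =
  fixes n :: nat and a :: "nat \<Rightarrow> nat \<Rightarrow> real" and v :: "nat \<Rightarrow> nat \<Rightarrow> real" and l :: "nat \<Rightarrow> real"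
  assumes sym: "i < n \<Longrightarrow> j < n \<Longrightarrow> a i j = a j i"
    and orth: "j < n \<Longrightarrow> k < n \<Longrightarrow> dot n (v j) (v k) = of_bool (j = k)"
    and eig: "k < n \<Longrightarrow> i < n \<Longrightarrow> app n a (v k) i = l k * v k i"
begin

lemma complete: "i < n \<Longrightarrow> j < n \<Longrightarrow> (\<Sum>k<n. v k i * v k j) = of_bool (i = j)"
  by (rule orthonormal_complete[OF orth])

lemma expansion:
  assumes "i < n"
  shows "x i = (\<Sum>k<n. dot n (v k) x * v k i)"
proof -
  have "(\<Sum>k<n. dot n (v k) x * v k i) = (\<Sum>k<n. \<Sum>j<n. x j * (v k j * v k i))"
    by (simp add: dot_def sum_distrib_left sum_distrib_right algebra_simps)
  also have "\<dots> = (\<Sum>j<n. x j * (\<Sum>k<n. v k j * v k i))"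
    unfolding sum_distrib_left by (rule sum.swap)
  also have "\<dots> = (\<Sum>j<n. x j * of_bool (j = i))"
    using assms by (intro sum.cong refl) (simp add: complete)
  also have "\<dots> = x i" using assms by (simp add: of_bool_def if_distrib cong: if_cong)
  finally show ?thesis by simp
qed

lemma dot_lincomb:
  assumes "k < n"
  shows "dot n (v k) (\<lambda>i. \<Sum>j<n. c j * v j i) = c k"
proof -
  have "dot n (v k) (\<lambda>i. \<Sum>j<n. c j * v j i) = (\<Sum>j<n. c j * of_bool (k = j))"
    unfolding dot_sum using assms by (intro sum.cong refl) (simp add: orth)
  also have "\<dots> = c k" using assms by (simp add: of_bool_def if_distrib cong: if_cong)
  finally show ?thesis .
qed

lemma parseval: "dot n x x = (\<Sum>k<n. (dot n (v k) x)\<^sup>2)"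
proof -
  have "dot n x x = dot n x (\<lambda>i. \<Sum>k<n. dot n (v k) x * v k i)"
    unfolding dot_def[of n x] by (intro sum.cong refl arg_cong2[of _ _ _ _ "(*)"] expansion) simp
  then show ?thesis unfolding dot_sum by (simp add: power2_eq_square dot_commute)
qed

lemma dot_residual:
  assumes "k < n"
  shows "dot n (v k) (residual n a \<mu> x) = (l k - \<mu>) * dot n (v k) x"
proof -
  have "dot n (v k) (app n a x) = dot n (app n a (v k)) x"
    by (rule dot_app_symmetric[OF sym])
  also have "\<dots> = l k * dot n (v k) x"
    unfolding dot_def sum_distrib_left using eig[OF assms] by (intro sum.cong) (auto simp: algebra_simps)
  finally show ?thesis
    by (simp add: residual_def[abs_def] dot_def sum_subtractf sum_distrib_left algebra_simps)
qed

lemma residual_norm: "dot n (residual n a \<mu> x) (residual n a \<mu> x) = (\<Sum>k<n. ((l k - \<mu>) * dot n (v k) x)\<^sup>2)"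
  unfolding parseval[of "residual n a \<mu> x"] by (simp add: dot_residual)

text \<open>The min-max argument: with more than \<open>q\<close> eigenvalues nearer than
  \<open>g\<close>, some nonzero combination of their eigenvectors is orthogonal to all
  \<open>w j\<close>, and its residual would be below \<open>g\<close> times its norm.\<close>

lemma card_eigenvalues_near:
  assumes g: "0 < g"
    and W: "\<And>x. (\<And>j. j < q \<Longrightarrow> dot n (w j) x = 0) \<Longrightarrow>
      g\<^sup>2 * dot n x x \<le> dot n (residual n a \<mu> x) (residual n a \<mu> x)"
  shows "card {k. k < n \<and> \<bar>l k - \<mu>\<bar> < g} \<le> q"
proof (rule ccontr)
  define I where "I = {k. k < n \<and> \<bar>l k - \<mu>\<bar> < g}"
  assume "\<not> ?thesis"
  then have q: "q < card I" by (simp add: I_def)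
  have "finite I" by (simp add: I_def)
  then obtain h where h: "bij_betw h {..<card I} I"
    using ex_bij_betw_nat_finite[of I] by (auto simp: atLeast0LessThan)
  obtain c where c: "\<exists>i<card I. c i \<noteq> 0" "\<forall>j<q. (\<Sum>i<card I. dot n (w j) (v (h i)) * c i) = 0"
    using ex_orthogonal[OF q, of "\<lambda>j i. dot n (w j) (v (h i))"] by blast
  define h' where "h' = inv_into {..<card I} h"
  have h': "h' (h i) = i" if "i < card I" for i
    using h that by (simp add: h'_def bij_betw_def)
  define d where "d = (\<lambda>k. if k \<in> I then c (h' k) else 0)"
  have In: "I \<subseteq> {..<n}" by (auto simp: I_def)
  define x where "x = (\<lambda>i. \<Sum>k<n. d k * v k i)"
  have "dot n (w j) x = 0" if "j < q" for j
  proof -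
    have "dot n (w j) x = (\<Sum>k<n. d k * dot n (w j) (v k))" unfolding x_def dot_sum ..
    also have "\<dots> = (\<Sum>k\<in>I. c (h' k) * dot n (w j) (v k))"
      using In by (intro sum.mono_neutral_cong_right) (auto simp: d_def)
    also have "\<dots> = (\<Sum>i<card I. c (h' (h i)) * dot n (w j) (v (h i)))"
      by (rule sum.reindex_bij_betw[OF h, symmetric])
    also have "\<dots> = 0" using c(2) that by (simp add: h' mult.commute)
    finally show ?thesis .
  qed
  then have le: "g\<^sup>2 * dot n x x \<le> dot n (residual n a \<mu> x) (residual n a \<mu> x)" by (rule W)
  obtain i where i: "i < card I" "c i \<noteq> 0" using c(1) by blast
  have hi: "h i \<in> I" using h i(1) by (auto simp: bij_betw_def)
  have dk: "dot n (v k) x = d k" if "k < n" for k unfolding x_def by (rule dot_lincomb[OF that])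
  have "dot n (residual n a \<mu> x) (residual n a \<mu> x) = (\<Sum>k<n. ((l k - \<mu>) * d k)\<^sup>2)"
    unfolding residual_norm by (intro sum.cong refl) (simp add: dk)
  \<comment> \<open>Strictness comes from one index \<open>h i\<close> with a nonzero coefficient,
    whose eigenvalue is strictly nearer than \<open>g\<close>.\<close>
  also have "\<dots> < (\<Sum>k<n. g\<^sup>2 * (d k)\<^sup>2)"
  proof (rule sum_strict_mono_ex1)
    show "\<forall>k\<in>{..<n}. ((l k - \<mu>) * d k)\<^sup>2 \<le> g\<^sup>2 * (d k)\<^sup>2"
    proof
      fix k assume "k \<in> {..<n}"
      show "((l k - \<mu>) * d k)\<^sup>2 \<le> g\<^sup>2 * (d k)\<^sup>2"
      proof (cases "k \<in> I")
        case True
        then have "\<bar>l k - \<mu>\<bar> \<le> \<bar>g\<bar>" using g by (auto simp: I_def)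
        then have "(l k - \<mu>)\<^sup>2 \<le> g\<^sup>2" by (simp add: abs_le_square_iff)
        then show ?thesis by (simp add: power_mult_distrib mult_right_mono)
      qed (simp add: d_def)
    qed
    have "\<bar>l (h i) - \<mu>\<bar> < \<bar>g\<bar>" using hi g by (auto simp: I_def)
    then have "(l (h i) - \<mu>)\<^sup>2 < g\<^sup>2" by (metis abs_le_square_iff not_le)
    moreover have "d (h i) \<noteq> 0" using i hi by (simp add: d_def h')
    ultimately have "((l (h i) - \<mu>) * d (h i))\<^sup>2 < g\<^sup>2 * (d (h i))\<^sup>2"
      by (simp add: power_mult_distrib)
    then show "\<exists>k\<in>{..<n}. ((l k - \<mu>) * d k)\<^sup>2 < g\<^sup>2 * (d k)\<^sup>2" using hi In by blast
  qed simp
  also have "\<dots> = g\<^sup>2 * dot n x x"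
    unfolding parseval[of x] sum_distrib_left by (intro sum.cong refl) (simp add: dk)
  finally show False using le by simp
qed

text \<open>In the eigenbasis the residual multiplies coefficient \<open>k\<close> by
  \<open>l k - \<mu>\<close>; if all these factors had absolute value at least \<open>g\<close>, the
  residual could not be that small.\<close>

lemma eigenvalue_near:
  assumes "0 < g" "dot n (residual n a \<mu> x) (residual n a \<mu> x) < g\<^sup>2 * dot n x x"
  shows "\<exists>k<n. \<bar>l k - \<mu>\<bar> < g"
proof (rule ccontr)
  assume neg: "\<not> ?thesis"
  have "g\<^sup>2 * dot n x x = (\<Sum>k<n. g\<^sup>2 * (dot n (v k) x)\<^sup>2)"
    unfolding parseval[of x] sum_distrib_left ..
  also have "\<dots> \<le> (\<Sum>k<n. ((l k - \<mu>) * dot n (v k) x)\<^sup>2)"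
  proof (intro sum_mono)
    fix k assume "k \<in> {..<n}"
    then have "\<bar>g\<bar> \<le> \<bar>l k - \<mu>\<bar>" using neg assms(1) by auto
    then have "g\<^sup>2 \<le> (l k - \<mu>)\<^sup>2" by (simp add: abs_le_square_iff)
    then show "g\<^sup>2 * (dot n (v k) x)\<^sup>2 \<le> ((l k - \<mu>) * dot n (v k) x)\<^sup>2"
      by (simp add: power_mult_distrib mult_right_mono)
  qed
  finally show False using assms(2) by (simp add: residual_norm)
qed

text \<open>\<open>w\<close> is the orthogonal projection of \<open>x\<close> to the eigenspace of
  \<open>ev\<close>. The difference has only coefficients with other eigenvalues, which the residual
  enlarges at least by the factor \<open>g\<close>.\<close>

lemma eigenspace_near:
  assumes g: "0 < g" and iso: "\<And>k. k < n \<Longrightarrow> l k \<noteq> ev \<Longrightarrow> g \<le> \<bar>l k - \<mu>\<bar>"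
  shows "\<exists>w. (\<forall>i<n. app n a w i = ev * w i) \<and>
    g\<^sup>2 * dot n (\<lambda>i. x i - w i) (\<lambda>i. x i - w i) \<le> dot n (residual n a \<mu> x) (residual n a \<mu> x)"
proof -
  define c where "c = (\<lambda>k. if l k = ev then dot n (v k) x else 0)"
  define w where "w = (\<lambda>i. \<Sum>k<n. c k * v k i)"
  have "app n a w i = ev * w i" if "i < n" for i
    unfolding w_def app_sum sum_distrib_left
    by (intro sum.cong refl) (use that in \<open>auto simp: eig c_def\<close>)
  moreover have "g\<^sup>2 * dot n (\<lambda>i. x i - w i) (\<lambda>i. x i - w i) \<le> dot n (residual n a \<mu> x) (residual n a \<mu> x)"
  proof -
    have dk: "dot n (v k) (\<lambda>i. x i - w i) = dot n (v k) x - c k" if "k < n" for k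
    proof -
      have "dot n (v k) (\<lambda>i. x i - w i) = dot n (v k) x - dot n (v k) w"
        by (simp add: dot_def sum_subtractf algebra_simps)
      then show ?thesis using dot_lincomb[OF that] by (simp add: w_def)
    qed
    have "g\<^sup>2 * dot n (\<lambda>i. x i - w i) (\<lambda>i. x i - w i) = (\<Sum>k<n. g\<^sup>2 * (dot n (v k) x - c k)\<^sup>2)"
      unfolding parseval[of "\<lambda>i. x i - w i"] sum_distrib_left by (intro sum.cong refl) (simp add: dk)
    also have "\<dots> \<le> (\<Sum>k<n. ((l k - \<mu>) * dot n (v k) x)\<^sup>2)"
    proof (intro sum_mono)
      fix k assume "k \<in> {..<n}"
      show "g\<^sup>2 * (dot n (v k) x - c k)\<^sup>2 \<le> ((l k - \<mu>) * dot n (v k) x)\<^sup>2"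
      proof (cases "l k = ev")
        case False
        then have "\<bar>g\<bar> \<le> \<bar>l k - \<mu>\<bar>" using iso[of k] g \<open>k \<in> {..<n}\<close> by auto
        then have "g\<^sup>2 \<le> (l k - \<mu>)\<^sup>2" by (simp add: abs_le_square_iff)
        with False show ?thesis by (simp add: c_def power_mult_distrib mult_right_mono)
      qed (simp add: c_def)
    qed
    finally show ?thesis by (simp add: residual_norm)
  qed
  ultimately show ?thesis by blast
qed

text \<open>The exact certificate: \<open>P (A - ev)\<close> is the projection to the orthogonal
  complement of the eigenspace, \<open>W W^T\<close> the projection to the eigenspace
  itself.\<close>

lemma left_inverse:
  assumes q: "card {k. k < n \<and> l k = ev} \<le> q"
  shows "\<exists>P W. \<forall>i<n. \<forall>j<n.
    (\<Sum>k<n. P i k * (a k j - ev * of_bool (k = j))) + (\<Sum>k<q. W i k * W j k) = of_bool (i = j)"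
proof -
  define I where "I = {k. k < n \<and> l k = ev}"
  have "finite I" by (simp add: I_def)
  then obtain h where h: "bij_betw h {..<card I} I"
    using ex_bij_betw_nat_finite[of I] by (auto simp: atLeast0LessThan)
  \<comment> \<open>The pseudoinverse of \<open>A - ev\<close>; the convention that
    \<open>inverse 0\<close> is 0 drops the kernel.\<close>
  define P where "P = (\<lambda>i j. \<Sum>t<n. v t i * (inverse (l t - ev) * v t j))"
  \<comment> \<open>An orthonormal basis of the eigenspace as columns, padded with zero columns up
    to \<open>q\<close>.\<close>
  define W where "W = (\<lambda>i k. if k < card I then v (h k) i else 0)"
  have "(\<Sum>k<n. P i k * (a k j - ev * of_bool (k = j))) + (\<Sum>k<q. W i k * W j k) = of_bool (i = j)"
    if ij: "i < n" "j < n" for i j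
  proof -
    have 1: "(\<Sum>k<n. v t k * (a k j - ev * of_bool (k = j))) = (l t - ev) * v t j" if "t < n" for t
    proof -
      have "(\<Sum>k<n. v t k * (a k j - ev * of_bool (k = j))) = (\<Sum>k<n. a j k * v t k) - (\<Sum>k<n. ev * v t k * of_bool (k = j))"
        unfolding sum_subtractf[symmetric] using ij by (intro sum.cong refl) (simp add: sym algebra_simps)
      also have "(\<Sum>k<n. a j k * v t k) = l t * v t j"
        using eig[OF that ij(2)] by (simp add: app_def)
      also have "(\<Sum>k<n. ev * v t k * of_bool (k = j)) = ev * v t j"
        using ij by (simp add: of_bool_def if_distrib cong: if_cong)
      finally show ?thesis by (simp add: algebra_simps)
    qed
    have "(\<Sum>k<n. P i k * (a k j - ev * of_bool (k = j)))
        = (\<Sum>k<n. \<Sum>t<n. v t i * (inverse (l t - ev) * (v t k * (a k j - ev * of_bool (k = j)))))"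
      unfolding P_def sum_distrib_right by (simp add: mult.assoc)
    also have "\<dots> = (\<Sum>t<n. v t i * (inverse (l t - ev) * (\<Sum>k<n. v t k * (a k j - ev * of_bool (k = j)))))"
      unfolding sum_distrib_left by (rule sum.swap)
    also have "\<dots> = (\<Sum>t<n. v t i * (of_bool (l t \<noteq> ev) * v t j))"
      by (intro sum.cong refl) (auto simp: 1)
    finally have A: "(\<Sum>k<n. P i k * (a k j - ev * of_bool (k = j)))
        = (\<Sum>t<n. v t i * (of_bool (l t \<noteq> ev) * v t j))" .
    have "(\<Sum>k<q. W i k * W j k) = (\<Sum>k<card I. v (h k) i * v (h k) j)"
      using q by (intro sum.mono_neutral_cong_right) (auto simp: W_def I_def)
    also have "\<dots> = (\<Sum>t\<in>I. v t i * v t j)" by (rule sum.reindex_bij_betw[OF h])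
    also have "\<dots> = (\<Sum>t<n. v t i * (of_bool (l t = ev) * v t j))"
      by (rule sum.mono_neutral_cong_left) (auto simp: I_def)
    finally have B: "(\<Sum>k<q. W i k * W j k) = (\<Sum>t<n. v t i * (of_bool (l t = ev) * v t j))" .
    have "(\<Sum>k<n. P i k * (a k j - ev * of_bool (k = j))) + (\<Sum>k<q. W i k * W j k)
        = (\<Sum>t<n. v t i * v t j)"
      unfolding A B sum.distrib[symmetric] by (intro sum.cong refl) auto
    then show ?thesis using complete[OF ij] by simp
  qed
  then show ?thesis by blast
qed

end

section \<open>Spectrum and multiplicities in terms of an eigensystem\<close>

lemma eigenvector_iff:
  assumes "A \<in> carrier_mat n n"
  shows "eigenvector A (vec n x) ev \<longleftrightarrow>
    (\<exists>i<n. x i \<noteq> 0) \<and> (\<forall>i<n. app n (\<lambda>i j. A $$ (i, j)) x i = ev * x i)"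
proof -
  have "(A *\<^sub>v vec n x) $ i = app n (\<lambda>i j. A $$ (i, j)) x i" if "i < n" for i
    using assms that by (auto simp: app_def scalar_prod_def atLeast0LessThan intro!: sum.cong)
  moreover have "dim_vec (A *\<^sub>v vec n x) = n" using assms by simp
  ultimately have "A *\<^sub>v vec n x = ev \<cdot>\<^sub>v vec n x \<longleftrightarrow> (\<forall>i<n. app n (\<lambda>i j. A $$ (i, j)) x i = ev * x i)"
    unfolding vec_eq_iff by auto
  moreover have "vec n x = 0\<^sub>v n \<longleftrightarrow> (\<forall>i<n. x i = 0)" unfolding vec_eq_iff by auto
  ultimately show ?thesis using assms by (auto simp: eigenvector_def)
qed

lemma jordan_matrix_diag:
  "jordan_matrix (map (\<lambda>e. (1, e)) es) =
     mat (length es) (length es) (\<lambda>(i, j). if i = j then es ! i else 0)"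
proof (induction es)
  case Nil
  show ?case by (rule eq_matI) (auto simp: jordan_matrix_def)
next
  case (Cons e es)
  show ?case
    using Cons.IH
    by (intro eq_matI) (auto simp: jordan_matrix_def Let_def nth_Cons' jordan_block_def)
qed

text \<open>\<open>A\<close> is orthogonally similar to a diagonal matrix, that is, to a Jordan
  matrix with blocks of size 1. The kernel dimension is the dimension of the generalized eigenspace
  of exponent 1, which counts the blocks with eigenvalue \<open>ev\<close>.\<close>

lemma kernel_dim_eigensystem:
  assumes A: "A \<in> carrier_mat n n" and "eigensystem n (\<lambda>i j. A $$ (i, j)) v l"
  shows "kernel_dim (A - ev \<cdot>\<^sub>m 1\<^sub>m (dim_row A)) = card {k. k < n \<and> l k = ev}"
proof -
  interpret eigensystem n "\<lambda>i j. A $$ (i, j)" v l by (rule assms(2))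
  define P where "P = mat n n (\<lambda>(i, k). v k i)"
  define D where "D = mat n n (\<lambda>(i, j). if i = j then l i else 0)"
  have car: "P \<in> carrier_mat n n" "transpose_mat P \<in> carrier_mat n n" "D \<in> carrier_mat n n"
    by (auto simp: P_def D_def)
  have 1: "transpose_mat P * P = 1\<^sub>m n"
    by (rule eq_matI) (use orth in \<open>auto simp: P_def scalar_prod_def dot_def atLeast0LessThan\<close>)
  then have 2: "P * transpose_mat P = 1\<^sub>m n" by (rule mat_mult_left_right_inverse[OF car(2,1)])
  have "A * P = P * D"
  proof (rule eq_matI)
    fix i k assume ik: "i < dim_row (P * D)" "k < dim_col (P * D)"
    then have ik': "i < n" "k < n" by (auto simp: P_def D_def)
    have "(A * P) $$ (i, k) = app n (\<lambda>i j. A $$ (i, j)) (v k) i"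
      using A ik' by (auto simp: P_def scalar_prod_def app_def atLeast0LessThan)
    also have "\<dots> = (P * D) $$ (i, k)"
      using ik' by (simp add: eig P_def D_def scalar_prod_def if_distrib cong: if_cong)
    finally show "(A * P) $$ (i, k) = (P * D) $$ (i, k)" .
  qed (use A in \<open>auto simp: P_def D_def\<close>)
  then have "A = P * D * transpose_mat P"
    using A 2 car by (metis assoc_mult_mat right_mult_one_mat)
  then have "similar_mat_wit A D P (transpose_mat P)"
    using A 1 2 car by (intro similar_mat_witI) auto
  then have sim: "similar_mat A D" by (auto simp: similar_mat_def)
  have "D = jordan_matrix (map (\<lambda>e. (1, e)) (map l [0..<n]))"
    unfolding jordan_matrix_diag by (auto simp: D_def intro!: eq_matI)
  then have "dim_gen_eigenspace A ev 1
      = (\<Sum>k\<leftarrow>map fst [(k, e)\<leftarrow>map (\<lambda>e. (1, e)) (map l [0..<n]) . e = ev]. min 1 k)"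
    unfolding dim_gen_eigenspace_similar[OF sim] by (simp only: dim_gen_eigenspace_jordan_matrix)
  also have "\<dots> = length (filter (\<lambda>k. l k = ev) [0..<n])"
    by (induction n) auto
  also have "\<dots> = card {k. k < n \<and> l k = ev}"
    using distinct_card[of "filter (\<lambda>k. l k = ev) [0..<n]"]
    by (simp add: atLeast0LessThan lessThan_def Collect_conj_eq Int_commute)
  finally have "dim_gen_eigenspace A ev 1 = card {k. k < n \<and> l k = ev}" .
  moreover have "char_matrix A ev = A - ev \<cdot>\<^sub>m 1\<^sub>m (dim_row A)"
    using A by (intro eq_matI) (auto simp: char_matrix_def)
  ultimately show ?thesis using A by (simp add: dim_gen_eigenspace_def)
qed

text \<open>An eigenvector has some nonzero coefficient in the eigenbasis; pairing its vanishing
  residual with that basis vector identifies the eigenvalue as \<open>l k\<close>.\<close>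

lemma spectrum_eigensystem:
  assumes A: "A \<in> carrier_mat n n" and "eigensystem n (\<lambda>i j. A $$ (i, j)) v l"
  shows "spectrum A = l ` {..<n}"
proof -
  interpret eigensystem n "\<lambda>i j. A $$ (i, j)" v l by (rule assms(2))
  have "l k \<in> spectrum A" if "k < n" for k
  proof -
    have "dot n (v k) (v k) \<noteq> 0" using orth[OF that that] by simp
    then have "\<exists>i<n. v k i \<noteq> 0" unfolding dot_self_eq_0 by blast
    then have "eigenvector A (vec n (v k)) (l k)" using eig[OF that] by (auto simp: eigenvector_iff[OF A])
    then show ?thesis by (auto simp: spectrum_def eigenvalue_def)
  qed
  moreover have "ev \<in> l ` {..<n}" if "ev \<in> spectrum A" for ev
  proof -
    obtain u where u: "eigenvector A u ev" using \<open>ev \<in> spectrum A\<close> by (auto simp: spectrum_def eigenvalue_def)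
    define x where "x = (\<lambda>i. u $ i)"
    have "u = vec n x" using u A by (auto simp: eigenvector_def x_def)
    then have x: "\<exists>i<n. x i \<noteq> 0" "\<forall>i<n. app n (\<lambda>i j. A $$ (i, j)) x i = ev * x i"
      using u eigenvector_iff[OF A] by auto
    have "dot n x x \<noteq> 0" using x(1) unfolding dot_self_eq_0 by blast
    then have "(\<Sum>k<n. (dot n (v k) x)\<^sup>2) \<noteq> 0" unfolding parseval[of x] .
    then obtain k where k: "k < n" "dot n (v k) x \<noteq> 0"
      by (auto elim!: sum.not_neutral_contains_not_neutral)
    have "dot n (v k) (residual n (\<lambda>i j. A $$ (i, j)) ev x) = 0"
      unfolding dot_def by (intro sum.neutral) (use x(2) in \<open>auto simp: residual_def\<close>)
    then have "l k = ev" using dot_residual[OF k(1), of ev x] k(2) by simp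
    then show ?thesis using k(1) by auto
  qed
  ultimately show ?thesis by blast
qed

lemma min_multiplicity_eigensystem:
  assumes A: "A \<in> carrier_mat n n" and es: "eigensystem n (\<lambda>i j. A $$ (i, j)) v l" and "1 \<le> n"
  shows "\<And>k. k < n \<Longrightarrow> min_multiplicity A \<le> card {j. j < n \<and> l j = l k}"
    and "\<exists>k<n. min_multiplicity A = card {j. j < n \<and> l j = l k}"
proof -
  let ?S = "(\<lambda>k. card {j. j < n \<and> l j = l k}) ` {..<n}"
  have m: "min_multiplicity A = Min ?S"
    unfolding min_multiplicity_def spectrum_eigensystem[OF A es] image_image
    by (simp add: kernel_dim_eigensystem[OF A es])
  show "min_multiplicity A \<le> card {j. j < n \<and> l j = l k}" if "k < n" for k
    unfolding m using that by (intro Min_le) auto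
  have "Min ?S \<in> ?S" using \<open>1 \<le> n\<close> by (intro Min_in) (auto simp: lessThan_empty_iff)
  then show "\<exists>k<n. min_multiplicity A = card {j. j < n \<and> l j = l k}" unfolding m by auto
qed

section \<open>Integer certificates\<close>

text \<open>If \<open>B\<close> is within 1 of \<open>R * a\<close> entrywise, this bounds the
  1-norm of the residual of \<open>u / D\<close> at \<open>c / R\<close>, scaled by
  \<open>R * D\<close>. The inner sum over \<open>\<bar>u j\<bar>\<close> pays for the error of
  \<open>B\<close>.\<close>

definition residual_bound :: "nat \<Rightarrow> (nat \<Rightarrow> nat \<Rightarrow> int) \<Rightarrow> int \<Rightarrow> (nat \<Rightarrow> int) \<Rightarrow> int" where
  "residual_bound n B c u =
     (\<Sum>i<n. \<bar>\<Sum>j<n. (B i j - c * of_bool (i = j)) * u j\<bar> + (\<Sum>j<n. \<bar>u j\<bar>))"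

text \<open>\<open>P (B - c) + W W^T\<close> is \<open>s\<close> times the identity up to errors of
  at most \<open>s / (2 * n)\<close> per entry, so that the errors of a row sum to at most
  \<open>s / 2\<close> and can be absorbed. The terms \<open>\<bar>P i k\<bar>\<close> pay for
  replacing \<open>R * a\<close> by \<open>B\<close>. The last inequality makes \<open>1 / H\<close>
  the resulting lower bound on \<open>A - c / R\<close>.\<close>

definition gap_check ::
  "nat \<Rightarrow> nat \<Rightarrow> int \<Rightarrow> (nat \<Rightarrow> nat \<Rightarrow> int) \<Rightarrow> int \<Rightarrow> (nat \<Rightarrow> nat \<Rightarrow> int) \<Rightarrow> (nat \<Rightarrow> nat \<Rightarrow> int) \<Rightarrow> int \<Rightarrow> int \<Rightarrow> bool"
where
  "gap_check n q R B c P W s H \<longleftrightarrow>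
     0 < R \<and> 0 < s \<and> 0 < H \<and>
     (\<forall>i\<in>{..<n}. \<forall>j\<in>{..<n}.
        2 * int n * (\<bar>(\<Sum>k<n. P i k * (B k j - c * of_bool (k = j))) + (\<Sum>k<q. W i k * W j k)
          - s * of_bool (i = j)\<bar> + (\<Sum>k<n. \<bar>P i k\<bar>)) \<le> s) \<and>
     2 * (\<Sum>i<n. \<Sum>k<n. \<bar>P i k\<bar>) * R \<le> s * H"

text \<open>The residual of \<open>u / D\<close> is at most \<open>1 / (16 * H)\<close>, which
  yields an eigenvalue within \<open>1 / (2 * H)\<close> and distance at most 1/8 from its
  eigenspace. The last condition keeps the vector away from 0.\<close>

definition commit_check ::
  "nat \<Rightarrow> nat \<Rightarrow> int \<Rightarrow> (nat \<Rightarrow> nat \<Rightarrow> int) \<Rightarrow> int \<Rightarrow> (nat \<Rightarrow> nat \<Rightarrow> int) \<Rightarrow> (nat \<Rightarrow> nat \<Rightarrow> int) \<Rightarrow> int \<Rightarrow> int \<Rightarrow>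
    (nat \<Rightarrow> int) \<Rightarrow> int \<Rightarrow> bool"
where
  "commit_check n q R B c P W s H u D \<longleftrightarrow>
     gap_check n q R B c P W s H \<and> 0 < D \<and> 16 * H * residual_bound n B c u \<le> R * D \<and>
     (\<exists>i\<in>{..<n}. D \<le> \<bar>u i\<bar>)"

text \<open>The constant \<open>32 * p\<close> gives distance \<open>1 / (16 * p)\<close> from the
  eigenspace, the accuracy due once \<open>p\<close> has doubled. The estimate \<open>c / R\<close>
  may move by half the isolation radius, which leaves the other half as gap. Steps of
  \<open>1 / (4 * p)\<close> with doubling \<open>p\<close> sum to
  \<open>1 / (2 * p)\<close>.\<close>

definition refine_check ::
  "nat \<Rightarrow> int \<Rightarrow> int \<Rightarrow> int \<Rightarrow> int \<Rightarrow> (nat \<Rightarrow> int) \<Rightarrow> int \<Rightarrow>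
    int \<Rightarrow> (nat \<Rightarrow> nat \<Rightarrow> int) \<Rightarrow> int \<Rightarrow> (nat \<Rightarrow> int) \<Rightarrow> int \<Rightarrow> bool"
where
  "refine_check n H p c\<^sub>0 R\<^sub>0 u\<^sub>0 D\<^sub>0 R B c u D \<longleftrightarrow>
     0 < R \<and> 0 < D \<and> 2 * H * \<bar>c * R\<^sub>0 - c\<^sub>0 * R\<bar> \<le> R * R\<^sub>0 \<and>
     32 * p * H * residual_bound n B c u \<le> R * D \<and>
     (\<forall>i\<in>{..<n}. 4 * p * \<bar>u i * D\<^sub>0 - u\<^sub>0 i * D\<bar> \<le> D * D\<^sub>0)"

lemma dot_self_le_sum_abs: "dot n x x \<le> (\<Sum>i<n. \<bar>x i\<bar>)\<^sup>2"
proof -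
  have "L2_set x {..<n} \<le> (\<Sum>i<n. \<bar>x i\<bar>)" by (rule L2_set_le_sum_abs)
  then have "(L2_set x {..<n})\<^sup>2 \<le> (\<Sum>i<n. \<bar>x i\<bar>)\<^sup>2" by (intro power_mono) (auto intro: L2_set_nonneg)
  then show ?thesis by (simp add: L2_set_def dot_def power2_eq_square sum_nonneg)
qed

lemma abs_le_sqrt_dot: "i < n \<Longrightarrow> \<bar>x i\<bar> \<le> sqrt (dot n x x)"
proof -
  assume "i < n"
  then have "x i * x i \<le> dot n x x" unfolding dot_def by (intro member_le_sum) auto
  then show ?thesis by (metis power2_eq_square real_sqrt_abs real_sqrt_le_iff)
qed

lemma sum_of_bool_delta:
  fixes c :: "'a::comm_semiring_1" and k n :: nat
  assumes "k < n"
  shows "(\<Sum>j<n. c * of_bool (k = j) * x j) = c * x k" "(\<Sum>j<n. c * (of_bool (k = j) * x j)) = c * x k"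
proof -
  have "(\<Sum>j<n. c * of_bool (k = j) * x j) = (\<Sum>j<n. if k = j then c * x j else 0)"
    by (intro sum.cong refl) auto
  then show "(\<Sum>j<n. c * of_bool (k = j) * x j) = c * x k" using assms by (simp add: sum.delta')
  then show "(\<Sum>j<n. c * (of_bool (k = j) * x j)) = c * x k" by (simp only: mult.assoc)
qed

text \<open>For \<open>x\<close> orthogonal to the columns of \<open>W\<close>, the certificate
  reads \<open>y = P z = s x + (M + N) x\<close> with \<open>z\<close> the residual scaled by
  \<open>R\<close>. Summing absolute values absorbs half of \<open>s\<close> times the 1-norm
  \<open>S\<close> of \<open>x\<close>, and \<open>y\<close> is bounded through the entries of
  \<open>P\<close>.\<close>

lemma gap_check_sound:
  fixes a :: "nat \<Rightarrow> nat \<Rightarrow> real" and x :: "nat \<Rightarrow> real"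
  assumes chk: "gap_check n q R B c P W s H" and n: "1 \<le> n"
    and approx: "\<And>i j. i < n \<Longrightarrow> j < n \<Longrightarrow> \<bar>R * a i j - B i j\<bar> \<le> 1"
    and x: "\<And>j. j < q \<Longrightarrow> dot n (\<lambda>i. W i j) x = 0"
  shows "(1 / real_of_int H)\<^sup>2 * dot n x x \<le>
    dot n (residual n a (of_int c / of_int R) x) (residual n a (of_int c / of_int R) x)"
proof -
  define r where "r = residual n a (of_int c / of_int R) x"
  define z where "z = (\<lambda>i. R * r i)"
  define S where "S = (\<Sum>j<n. \<bar>x j\<bar>)"
  define Z where "Z = sqrt (dot n r r)"
  define L where "L = (\<Sum>i<n. \<Sum>k<n. \<bar>real_of_int (P i k)\<bar>)"
  define y where "y = (\<lambda>i. \<Sum>k<n. P i k * z k)"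
  have pos: "0 < R" "0 < s" "0 < H" using chk by (auto simp: gap_check_def)
  have LR: "2 * L * R \<le> s * H"
  proof -
    have "real_of_int (2 * (\<Sum>i<n. \<Sum>k<n. \<bar>P i k\<bar>) * R) \<le> real_of_int (s * H)"
      using chk unfolding gap_check_def of_int_le_iff by blast
    then show ?thesis by (simp add: L_def)
  qed
  \<comment> \<open>\<open>M\<close> is the integer defect that the check bounds, \<open>N\<close>
    the error made by \<open>B\<close> in place of \<open>R * a\<close>.\<close>
  define M where "M = (\<lambda>i j. (\<Sum>k<n. P i k * (B k j - c * of_bool (k = j))) + (\<Sum>k<q. W i k * W j k)
          - s * of_bool (i = j))"
  define N where "N = (\<lambda>i j. \<Sum>k<n. P i k * (R * a k j - B k j))"
  have MN: "\<bar>M i j + N i j\<bar> \<le> s / (2 * n)" if ij: "i < n" "j < n" for i j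
  proof -
    have "2 * int n * (\<bar>M i j\<bar> + (\<Sum>k<n. \<bar>P i k\<bar>)) \<le> s"
      using chk ij unfolding gap_check_def M_def by blast
    then have "real_of_int (2 * int n * (\<bar>M i j\<bar> + (\<Sum>k<n. \<bar>P i k\<bar>))) \<le> real_of_int s"
      unfolding of_int_le_iff .
    then have 1: "2 * n * (\<bar>real_of_int (M i j)\<bar> + (\<Sum>k<n. \<bar>real_of_int (P i k)\<bar>)) \<le> s" by simp
    have "\<bar>N i j\<bar> \<le> (\<Sum>k<n. \<bar>P i k * (R * a k j - B k j)\<bar>)" unfolding N_def by (rule sum_abs)
    also have "\<dots> \<le> (\<Sum>k<n. \<bar>real_of_int (P i k)\<bar>)"
      unfolding abs_mult by (intro sum_mono mult_left_le) (use approx ij in auto)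
    finally have "\<bar>M i j + N i j\<bar> \<le> \<bar>real_of_int (M i j)\<bar> + (\<Sum>k<n. \<bar>real_of_int (P i k)\<bar>)" by linarith
    then have "2 * n * \<bar>M i j + N i j\<bar> \<le> 2 * n * (\<bar>real_of_int (M i j)\<bar> + (\<Sum>k<n. \<bar>real_of_int (P i k)\<bar>))"
      by (intro mult_left_mono) auto
    then have "\<bar>M i j + N i j\<bar> * (2 * n) \<le> s" using 1 by (simp only: mult.commute)
    moreover have "0 < 2 * real n" using n by simp
    ultimately show ?thesis by (simp only: pos_le_divide_eq)
  qed
  have zk: "z k = (\<Sum>j<n. (R * a k j - c * of_bool (k = j)) * x j)" if "k < n" for k
  proof -
    have "(\<Sum>j<n. (R * a k j - c * of_bool (k = j)) * x j) = R * app n a x k - (\<Sum>j<n. c * of_bool (k = j) * x j)"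
      by (simp add: app_def sum_distrib_left sum_subtractf algebra_simps)
    also have "(\<Sum>j<n. c * of_bool (k = j) * x j) = c * x k"
      by (simp only: of_int_mult of_int_of_bool sum_of_bool_delta[OF that])
    finally show ?thesis using pos by (simp add: z_def r_def residual_def algebra_simps)
  qed
  have yi: "y i = (\<Sum>j<n. (M i j + N i j) * x j) + s * x i" if "i < n" for i
  proof -
    have "y i = (\<Sum>k<n. \<Sum>j<n. P i k * (R * a k j - c * of_bool (k = j)) * x j)"
      unfolding y_def by (intro sum.cong refl) (simp add: zk sum_distrib_left mult.assoc)
    also have "\<dots> = (\<Sum>j<n. (\<Sum>k<n. P i k * (R * a k j - c * of_bool (k = j))) * x j)"
      by (subst sum.swap) (simp add: sum_distrib_right)
    also have "\<dots> = (\<Sum>j<n. (M i j + N i j) * x j - (\<Sum>k<q. W i k * (W j k * x j)) + s * (of_bool (i = j) * x j))"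
      by (intro sum.cong refl)
        (simp add: M_def N_def sum.distrib sum_subtractf sum_distrib_left sum_distrib_right algebra_simps)
    also have "\<dots> = (\<Sum>j<n. (M i j + N i j) * x j) - (\<Sum>j<n. \<Sum>k<q. W i k * (W j k * x j))
        + (\<Sum>j<n. s * (of_bool (i = j) * x j))"
      by (simp add: sum.distrib sum_subtractf)
    also have "(\<Sum>j<n. \<Sum>k<q. W i k * (W j k * x j)) = (\<Sum>k<q. W i k * dot n (\<lambda>j. W j k) x)"
      by (subst sum.swap) (simp add: dot_def sum_distrib_left)
    also have "\<dots> = 0" using x by simp
    also have "(\<Sum>j<n. s * (of_bool (i = j) * x j)) = s * x i"
      by (simp only: of_int_mult of_int_of_bool sum_of_bool_delta[OF that])
    finally show ?thesis by simp
  qed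
  have S1: "s * \<bar>x i\<bar> \<le> \<bar>y i\<bar> + s / (2 * n) * S" if "i < n" for i
  proof -
    have "\<bar>\<Sum>j<n. (M i j + N i j) * x j\<bar> \<le> (\<Sum>j<n. \<bar>(M i j + N i j) * x j\<bar>)" by (rule sum_abs)
    also have "\<dots> \<le> (\<Sum>j<n. s / (2 * n) * \<bar>x j\<bar>)"
      unfolding abs_mult using that by (intro sum_mono mult_right_mono MN) auto
    also have "\<dots> = s / (2 * n) * S" by (simp add: S_def sum_distrib_left)
    finally have "\<bar>s * x i\<bar> \<le> \<bar>y i\<bar> + s / (2 * n) * S" using yi[OF that] by linarith
    then show ?thesis using pos by (simp add: abs_mult)
  qed
  have "s * S \<le> (\<Sum>i<n. \<bar>y i\<bar> + s / (2 * n) * S)"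
    unfolding S_def sum_distrib_left by (intro sum_mono) (use S1 in \<open>simp add: S_def sum_distrib_left\<close>)
  also have "\<dots> = (\<Sum>i<n. \<bar>y i\<bar>) + s / 2 * S"
    unfolding sum.distrib using n by simp
  finally have sS: "s * S \<le> 2 * (\<Sum>i<n. \<bar>y i\<bar>)" by simp
  have "(\<Sum>i<n. \<bar>y i\<bar>) \<le> (\<Sum>i<n. \<Sum>k<n. \<bar>real_of_int (P i k)\<bar> * (R * Z))"
  proof (intro sum_mono)
    fix i
    have "\<bar>y i\<bar> \<le> (\<Sum>k<n. \<bar>P i k * z k\<bar>)" unfolding y_def by (rule sum_abs)
    also have "\<dots> \<le> (\<Sum>k<n. \<bar>real_of_int (P i k)\<bar> * (R * Z))"
      unfolding abs_mult
      by (intro sum_mono mult_left_mono)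
        (use pos in \<open>auto simp: z_def Z_def abs_mult intro!: mult_left_mono abs_le_sqrt_dot\<close>)
    finally show "\<bar>y i\<bar> \<le> (\<Sum>k<n. \<bar>real_of_int (P i k)\<bar> * (R * Z))" .
  qed
  also have "\<dots> = L * (R * Z)" by (simp add: L_def sum_distrib_right)
  finally have "s * S \<le> (2 * L * R) * Z" using sS by simp
  also have "\<dots> \<le> (s * H) * Z" using LR by (intro mult_right_mono) (auto simp: Z_def dot_self_nonneg)
  finally have "s * S \<le> s * (H * Z)" by (simp add: mult.assoc)
  then have SH: "S \<le> H * Z" using pos by simp
  have "dot n x x \<le> S\<^sup>2" unfolding S_def by (rule dot_self_le_sum_abs)
  also have "\<dots> \<le> (H * Z)\<^sup>2" using SH by (intro power_mono) (auto simp: S_def sum_nonneg)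
  also have "\<dots> = H\<^sup>2 * dot n r r" by (simp add: power_mult_distrib Z_def dot_self_nonneg)
  finally show ?thesis using pos by (simp add: r_def[symmetric] field_simps)
qed

lemma residual_bound_sound:
  fixes a :: "nat \<Rightarrow> nat \<Rightarrow> real" and R D c :: int and u :: "nat \<Rightarrow> int"
  assumes approx: "\<And>i j. i < n \<Longrightarrow> j < n \<Longrightarrow> \<bar>R * a i j - B i j\<bar> \<le> 1" and pos: "0 < R" "0 < D"
  shows "dot n (residual n a (of_int c / of_int R) (\<lambda>i. u i / D)) (residual n a (of_int c / of_int R) (\<lambda>i. u i / D))
    \<le> (residual_bound n B c u / (R * D))\<^sup>2"
proof -
  let ?r = "residual n a (of_int c / of_int R) (\<lambda>i. u i / D)"
  have "(\<Sum>i<n. \<bar>?r i\<bar>) * (R * D) \<le> residual_bound n B c u"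
    unfolding residual_bound_def of_int_sum sum_distrib_right
  proof (intro sum_mono)
    fix i assume "i \<in> {..<n}"
    then have i: "i < n" by simp
    have 1: "(\<Sum>j<n. (c * of_bool (i = j)) * u j) = c * u i"
      by (rule sum_of_bool_delta[OF i])
    have "?r i * (R * D) = (\<Sum>j<n. R * a i j * u j) - c * u i"
      using pos by (simp add: residual_def app_def sum_distrib_left sum_distrib_right field_simps)
    also have "\<dots> = real_of_int (\<Sum>j<n. (B i j - c * of_bool (i = j)) * u j) + (\<Sum>j<n. (R * a i j - B i j) * u j)"
      using arg_cong[OF 1, of real_of_int]
      by (simp add: left_diff_distrib sum_subtractf del: of_int_sum) (simp add: sum_subtractf)
    finally have "?r i * (R * D) = real_of_int (\<Sum>j<n. (B i j - c * of_bool (i = j)) * u j)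
        + (\<Sum>j<n. (R * a i j - B i j) * u j)" .
    moreover have "\<bar>?r i\<bar> * (R * D) = \<bar>?r i * (R * D)\<bar>" using pos by (simp add: abs_mult)
    ultimately have "\<bar>?r i\<bar> * (R * D) \<le> \<bar>real_of_int (\<Sum>j<n. (B i j - c * of_bool (i = j)) * u j)\<bar>
        + \<bar>\<Sum>j<n. (R * a i j - B i j) * u j\<bar>" by (simp only: abs_triangle_ineq)
    also have "\<bar>\<Sum>j<n. (R * a i j - B i j) * u j\<bar> \<le> (\<Sum>j<n. \<bar>(R * a i j - B i j) * u j\<bar>)" by (rule sum_abs)
    also have "\<dots> \<le> (\<Sum>j<n. \<bar>real_of_int (u j)\<bar>)"
      unfolding abs_mult by (intro sum_mono mult_left_le_one_le) (use approx i in auto)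
    finally show "\<bar>?r i\<bar> * (R * D) \<le>
        real_of_int (\<bar>\<Sum>j<n. (B i j - c * of_bool (i = j)) * u j\<bar> + (\<Sum>j<n. \<bar>u j\<bar>))" by simp
  qed
  then have "(\<Sum>i<n. \<bar>?r i\<bar>) \<le> residual_bound n B c u / (R * D)"
    using pos by (simp add: field_simps)
  then have "(\<Sum>i<n. \<bar>?r i\<bar>)\<^sup>2 \<le> (residual_bound n B c u / (R * D))\<^sup>2"
    by (intro power_mono) (auto intro: sum_nonneg)
  then show ?thesis using dot_self_le_sum_abs[of n ?r] by linarith
qed


context eigensystem
begin

text \<open>Isolation \<open>1 / H\<close> around \<open>\<mu>\<close> less a shift of
  \<open>1 / (2 * H)\<close> leaves a gap of \<open>1 / (2 * H)\<close> around \<open>c / R\<close>.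
  Thus one window serves for ever better \<open>c\<close>.\<close>

lemma eigenspace_near_certified:
  fixes R D H c :: int and u :: "nat \<Rightarrow> int" and \<epsilon> :: real
  assumes approx: "\<And>i j. i < n \<Longrightarrow> j < n \<Longrightarrow> \<bar>R * a i j - B i j\<bar> \<le> 1"
    and pos: "0 < R" "0 < D" "0 < H"
    and iso: "\<And>k. k < n \<Longrightarrow> l k \<noteq> ev \<Longrightarrow> 1 / H \<le> \<bar>l k - \<mu>\<bar>"
    and near: "\<bar>c / R - \<mu>\<bar> \<le> 1 / (2 * H)"
    and bound: "2 * H * residual_bound n B c u \<le> \<epsilon> * (R * D)"
  shows "\<exists>w. (\<forall>i<n. app n a w i = ev * w i) \<and> (\<forall>i<n. \<bar>u i / D - w i\<bar> \<le> \<epsilon>)"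
proof -
  define x where "x = (\<lambda>i. u i / D)"
  define g where "g = 1 / (2 * real_of_int H)"
  define b where "b = residual_bound n B c u / (R * D)"
  let ?r = "residual n a (of_int c / of_int R) x"
  have g: "g > 0" using pos by (simp add: g_def)
  have "g \<le> \<bar>l k - c / R\<bar>" if "k < n" "l k \<noteq> ev" for k
  proof -
    have "2 * g \<le> \<bar>l k - \<mu>\<bar>" using iso[OF that] by (simp add: g_def)
    then show ?thesis using near unfolding g_def by linarith
  qed
  then obtain w where w: "\<forall>i<n. app n a w i = ev * w i"
    "g\<^sup>2 * dot n (\<lambda>i. x i - w i) (\<lambda>i. x i - w i) \<le> dot n ?r ?r"
    using eigenspace_near[OF g, of ev "c / R" x] by blast
  have b0: "0 \<le> b" using pos by (simp add: b_def residual_bound_def sum_nonneg)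
  have "dot n ?r ?r \<le> b\<^sup>2"
    unfolding x_def b_def by (rule residual_bound_sound[OF approx pos(1,2)])
  moreover have b: "b \<le> g * \<epsilon>" using bound pos by (simp add: b_def g_def field_simps)
  moreover have "\<bar>u i / D - w i\<bar> \<le> \<epsilon>" if "i < n" for i
  proof -
    let ?d = "dot n (\<lambda>i. x i - w i) (\<lambda>i. x i - w i)"
    have "g\<^sup>2 * ?d \<le> b\<^sup>2" using w(2) \<open>dot n ?r ?r \<le> b\<^sup>2\<close> by linarith
    then have "sqrt (g\<^sup>2 * ?d) \<le> sqrt (b\<^sup>2)" by (rule real_sqrt_le_mono)
    then have "g * sqrt ?d \<le> b" using g b0 by (simp add: real_sqrt_mult)
    then have "g * sqrt ?d \<le> g * \<epsilon>" using b by linarith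
    then have "sqrt ?d \<le> \<epsilon>" using g by simp
    moreover have "\<bar>x i - w i\<bar> \<le> sqrt ?d" using abs_le_sqrt_dot[OF that, of "\<lambda>i. x i - w i"] .
    ultimately show ?thesis by (simp add: x_def)
  qed
  ultimately show ?thesis using w(1) by blast
qed

lemma commit_sound:
  fixes R D H c :: int and u :: "nat \<Rightarrow> int"
  assumes approx: "\<And>i j. i < n \<Longrightarrow> j < n \<Longrightarrow> \<bar>R * a i j - B i j\<bar> \<le> 1" and n: "1 \<le> n"
    and mult: "\<And>k. k < n \<Longrightarrow> q < 2 * card {j. j < n \<and> l j = l k}"
    and chk: "commit_check n q R B c P W s H u D"
  shows "\<exists>k\<^sub>0<n. (\<forall>k<n. l k \<noteq> l k\<^sub>0 \<longrightarrow> 1 / H \<le> \<bar>l k - c / R\<bar>) \<and> \<bar>l k\<^sub>0 - c / R\<bar> < 1 / (2 * H) \<and>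
    (\<exists>w. (\<forall>i<n. app n a w i = l k\<^sub>0 * w i) \<and> (\<forall>i<n. \<bar>u i / D - w i\<bar> \<le> 1 / 8))"
proof -
  have gap: "gap_check n q R B c P W s H" and D: "0 < D"
    and rb: "16 * H * residual_bound n B c u \<le> R * D" and big: "\<exists>i\<in>{..<n}. D \<le> \<bar>u i\<bar>"
    using chk by (auto simp: commit_check_def)
  have pos: "0 < R" "0 < H" using gap by (auto simp: gap_check_def)
  define x where "x = (\<lambda>i. u i / D)"
  let ?r = "residual n a (of_int c / of_int R) x"
  have rb': "2 * H * residual_bound n B c u \<le> 1 / 8 * real_of_int (R * D)"
  proof -
    have "real_of_int (16 * H * residual_bound n B c u) \<le> real_of_int (R * D)"
      using rb unfolding of_int_le_iff .
    then show ?thesis by simp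
  qed
  have "card {k. k < n \<and> \<bar>l k - c / R\<bar> < 1 / H} \<le> q"
    by (rule card_eigenvalues_near[where w = "\<lambda>j i. W i j"])
      (use pos gap_check_sound[OF gap n approx] in auto)
  \<comment> \<open>Two distinct eigenvalues in the window would contribute more than
    \<open>q / 2\<close> each, against the certified count \<open>q\<close>.\<close>
  have uniq: "l j = l k" if jk: "j < n" "k < n" "\<bar>l j - c / R\<bar> < 1 / H" "\<bar>l k - c / R\<bar> < 1 / H" for j k
  proof (rule ccontr)
    let ?I = "\<lambda>k. {j. j < n \<and> l j = l k}"
    assume ne: "l j \<noteq> l k"
    have "card (?I j \<union> ?I k) = card (?I j) + card (?I k)"
      by (rule card_Un_disjoint) (use ne in auto)
    moreover have "card (?I j \<union> ?I k) \<le> card {k. k < n \<and> \<bar>l k - c / R\<bar> < 1 / H}"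
      by (rule card_mono) (use jk in auto)
    ultimately show False
      using mult[OF jk(1)] mult[OF jk(2)] \<open>card {k. k < n \<and> \<bar>l k - c / R\<bar> < 1 / H} \<le> q\<close> by linarith
  qed
  \<comment> \<open>\<open>u / D\<close> has norm at least 1 and residual at most
    \<open>1 / (16 * H)\<close>, so already half the window contains an eigenvalue.\<close>
  have "\<exists>k<n. \<bar>l k - c / R\<bar> < 1 / (2 * H)"
  proof (rule eigenvalue_near)
    show "0 < 1 / real_of_int (2 * H)" using pos by simp
    obtain i where i: "i < n" "D \<le> \<bar>u i\<bar>" using big by auto
    have "1 \<le> \<bar>x i\<bar>" using i(2) D by (simp add: x_def field_simps abs_divide)
    also have "\<dots> \<le> sqrt (dot n x x)" by (rule abs_le_sqrt_dot[OF i(1)])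
    finally have xx: "1 \<le> dot n x x" by simp
    have "dot n ?r ?r \<le> (residual_bound n B c u / (R * D))\<^sup>2"
      unfolding x_def by (rule residual_bound_sound[OF approx pos(1) D])
    also have "\<dots> \<le> (1 / (16 * H))\<^sup>2"
      using rb' pos D by (intro power_mono) (auto simp: field_simps residual_bound_def sum_nonneg)
    also have "\<dots> < (1 / (2 * H))\<^sup>2" using pos by (intro power_strict_mono) (auto simp: field_simps)
    also have "\<dots> \<le> (1 / (2 * H))\<^sup>2 * dot n x x" 
      using mult_left_mono[OF xx, of "(1 / real_of_int (2 * H))\<^sup>2"] by simp
    finally show "dot n ?r ?r < (1 / (2 * H))\<^sup>2 * dot n x x" .
  qed
  then obtain k\<^sub>0 where k0: "k\<^sub>0 < n" "\<bar>l k\<^sub>0 - c / R\<bar> < 1 / (2 * H)" by blast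
  have "1 / (2 * H) \<le> 1 / real_of_int H" using pos by (simp add: field_simps)
  then have iso: "1 / H \<le> \<bar>l k - c / R\<bar>" if "k < n" "l k \<noteq> l k\<^sub>0" for k
    using uniq[OF k0(1) that(1)] k0(2) that(2) by fastforce
  have "\<exists>w. (\<forall>i<n. app n a w i = l k\<^sub>0 * w i) \<and> (\<forall>i<n. \<bar>u i / D - w i\<bar> \<le> 1 / 8)"
    by (rule eigenspace_near_certified[OF approx pos(1) D pos(2) iso _ rb']) (use pos in auto)
  with k0 iso show ?thesis by blast
qed

end

section \<open>Existence of certificates by rounding\<close>

lemma round_tendsto: "(\<lambda>N. of_int (round (real N * x)) / real N) \<longlonglongrightarrow> x"
proof -
  have "(\<lambda>N. of_int (round (real N * x)) / real N - x) \<longlonglongrightarrow> 0"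
  proof (rule tendsto_0_le[where K = 1])
    show "(\<lambda>N. inverse (real N)) \<longlonglongrightarrow> 0" by (rule lim_inverse_n)
    show "\<forall>\<^sub>F N in sequentially. norm (of_int (round (real N * x)) / real N - x) \<le> norm (inverse (real N)) * 1"
    proof (rule eventually_sequentiallyI[of 1])
      fix N :: nat assume N: "1 \<le> N"
      have "\<bar>of_int (round (real N * x)) / real N - x\<bar> * N = \<bar>of_int (round (real N * x)) - real N * x\<bar>"
        using N by (simp add: field_simps flip: abs_mult_pos)
      also have "\<dots> \<le> 1" using of_int_round_abs_le[of "real N * x"] by linarith
      finally show "norm (of_int (round (real N * x)) / real N - x) \<le> norm (inverse (real N)) * 1"
        using N by (simp add: field_simps)
    qed
  qed
  then show ?thesis by (rule LIM_zero_cancel)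
qed

text \<open>The case \<open>N = 0\<close> is included, both sides being 0, so that the equations
  rewrite inside sequences over all naturals.\<close>

lemma rescale_product:
  fixes N :: real
  shows "(A / N - C / N * d) * (u / N) = (A - C * d) * u / (N * N)"
    and "p / N * (A / N - C / N * d) = p * (A - C * d) / (N * N)"
  by (cases "N = 0"; simp add: field_simps)+

text \<open>After division by \<open>N * N\<close> the main term tends to the exact residual, which
  is 0, while the allowance for the rounded matrix is only of order \<open>N\<close>.\<close>

lemma residual_bound_tendsto:
  assumes "\<And>i. i < n \<Longrightarrow> app n a x i = ev * x i"
  shows "(\<lambda>N. of_int (residual_bound n (\<lambda>i j. round (real N * a i j)) (round (real N * ev))
    (\<lambda>i. round (real N * x i))) / (real N * real N)) \<longlonglongrightarrow> 0"
proof -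
  let ?B = "\<lambda>N i j. of_int (round (real N * a i j)) / real N"
  let ?c = "\<lambda>N. of_int (round (real N * ev)) / real N"
  let ?u = "\<lambda>N i. of_int (round (real N * x i)) / real N"
  have "(\<lambda>N. \<Sum>i<n. \<bar>\<Sum>j<n. (?B N i j - ?c N * of_bool (i = j)) * ?u N j\<bar> + (\<Sum>j<n. \<bar>?u N j\<bar>) * inverse (real N))
      \<longlonglongrightarrow> (\<Sum>i<n. \<bar>\<Sum>j<n. (a i j - ev * of_bool (i = j)) * x j\<bar> + (\<Sum>j<n. \<bar>x j\<bar>) * 0)"
    by (intro tendsto_intros round_tendsto lim_inverse_n)
  moreover have "(\<Sum>j<n. (a i j - ev * of_bool (i = j)) * x j) = 0" if "i < n" for i
    using assms[OF that] sum_of_bool_delta(1)[OF that, of ev x]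
    by (simp add: app_def left_diff_distrib sum_subtractf)
  moreover have "(\<Sum>i<n. \<bar>\<Sum>j<n. (?B N i j - ?c N * of_bool (i = j)) * ?u N j\<bar> + (\<Sum>j<n. \<bar>?u N j\<bar>) * inverse (real N))
     = of_int (residual_bound n (\<lambda>i j. round (real N * a i j)) (round (real N * ev))
    (\<lambda>i. round (real N * x i))) / (real N * real N)" for N
    unfolding residual_bound_def of_int_sum sum_divide_distrib
  proof (intro sum.cong refl)
    fix i
    have "\<bar>\<Sum>j<n. (?B N i j - ?c N * of_bool (i = j)) * ?u N j\<bar>
        = \<bar>(\<Sum>j<n. (of_int (round (real N * a i j)) - of_int (round (real N * ev)) * of_bool (i = j))
            * of_int (round (real N * x j))) / (real N * real N)\<bar>"
      by (simp only: sum_divide_distrib rescale_product)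
    moreover have "(\<Sum>j<n. \<bar>?u N j\<bar>) * inverse (real N)
        = (\<Sum>j<n. \<bar>of_int (round (real N * x j))\<bar>) / (real N * real N)"
      by (simp add: sum_divide_distrib sum_distrib_right divide_inverse abs_mult mult.assoc)
    ultimately show "\<bar>\<Sum>j<n. (?B N i j - ?c N * of_bool (i = j)) * ?u N j\<bar> + (\<Sum>j<n. \<bar>?u N j\<bar>) * inverse (real N)
      = of_int (\<bar>\<Sum>j<n. (round (real N * a i j) - round (real N * ev) * of_bool (i = j)) * round (real N * x j)\<bar>
          + (\<Sum>j<n. \<bar>round (real N * x j)\<bar>)) / (real N * real N)"
      by (simp add: add_divide_distrib abs_divide)
  qed
  ultimately show ?thesis by simp
qed

lemma eventually_lt:
  assumes "f \<longlonglongrightarrow> (L::real)" "L < b"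
  shows "\<forall>\<^sub>F N in sequentially. f N < b"
  using assms by (rule order_tendstoD(2))

lemma le_of_divide_less:
  fixes m k x :: real
  assumes "0 < m" "0 < k" "x / m < 1 / k"
  shows "k * x \<le> m"
  using assms by (simp add: field_simps)

text \<open>Round \<open>ev\<close> and the nearby eigenvector \<open>w\<close> with one large
  denominator \<open>N = R = D\<close>. Every test is strict in the limit: the residual tends to 0,
  \<open>near\<close> is strict, and \<open>1 / (8 * p) < 1 / (4 * p)\<close>.\<close>

lemma refine_exists:
  fixes c\<^sub>0 R\<^sub>0 H p D\<^sub>0 :: int and u\<^sub>0 :: "nat \<Rightarrow> int"
  assumes eig: "\<And>i. i < n \<Longrightarrow> app n a w i = ev * w i"
    and pos: "0 < R\<^sub>0" "0 < H" "0 < p" "0 < D\<^sub>0"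
    and near: "\<bar>ev - c\<^sub>0 / R\<^sub>0\<bar> < 1 / (2 * H)"
    and close: "\<And>i. i < n \<Longrightarrow> \<bar>u\<^sub>0 i / D\<^sub>0 - w i\<bar> \<le> 1 / (8 * p)"
  shows "\<exists>R c u D. refine_check n H p c\<^sub>0 R\<^sub>0 u\<^sub>0 D\<^sub>0 R (\<lambda>i j. round (R * a i j)) c u D"
proof -
  let ?B = "\<lambda>N i j. round (real N * a i j)"
  let ?c = "\<lambda>N. round (real N * ev)"
  let ?u = "\<lambda>N i. round (real N * w i)"
  have "\<forall>\<^sub>F N in sequentially. \<bar>of_int (?c N) / real N - c\<^sub>0 / R\<^sub>0\<bar> < 1 / (2 * H)"
    by (intro eventually_lt[OF _ near] tendsto_intros round_tendsto)
  moreover have "\<forall>\<^sub>F N in sequentially. of_int (residual_bound n (?B N) (?c N) (?u N)) / (real N * real N) < 1 / (32 * p * H)"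
    by (rule eventually_lt[OF residual_bound_tendsto[OF eig]]) (use pos in auto)
  moreover have "\<forall>\<^sub>F N in sequentially. \<forall>i\<in>{..<n}. \<bar>of_int (?u N i) / real N - u\<^sub>0 i / D\<^sub>0\<bar> < 1 / (4 * p)"
  proof (intro eventually_ball_finite ballI)
    fix i assume "i \<in> {..<n}"
    have "1 / (8 * p) < 1 / (4 * real_of_int p)" using pos by (simp add: field_simps)
    then have lt: "\<bar>w i - u\<^sub>0 i / D\<^sub>0\<bar> < 1 / (4 * p)" using close[of i] \<open>i \<in> {..<n}\<close> by auto
    show "\<forall>\<^sub>F N in sequentially. \<bar>of_int (?u N i) / real N - u\<^sub>0 i / D\<^sub>0\<bar> < 1 / (4 * p)"
      by (intro eventually_lt[OF _ lt] tendsto_intros round_tendsto)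
  qed simp
  moreover have "\<forall>\<^sub>F N in sequentially. 0 < N" by (rule eventually_gt_at_top)
  ultimately have "\<forall>\<^sub>F N in sequentially. refine_check n H p c\<^sub>0 R\<^sub>0 u\<^sub>0 D\<^sub>0 (int N) (?B N) (?c N) (?u N) (int N)"
  proof eventually_elim
    case (elim N)
    have N: "0 < real N" using elim(4) by simp
    have 1: "real_of_int (2 * H * \<bar>?c N * R\<^sub>0 - c\<^sub>0 * int N\<bar>) \<le> real_of_int (int N * R\<^sub>0)"
    proof -
      have "of_int (?c N) / real N - c\<^sub>0 / R\<^sub>0 = (?c N * R\<^sub>0 - c\<^sub>0 * int N) / (real N * R\<^sub>0)"
        using N pos by (simp add: field_simps)
      then have "\<bar>real_of_int (?c N * R\<^sub>0 - c\<^sub>0 * int N)\<bar> / (real N * R\<^sub>0) < 1 / (2 * H)"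
        using elim(1) N pos by (simp add: abs_divide abs_mult)
      from le_of_divide_less[OF _ _ this] show ?thesis using N pos by (simp add: abs_mult)
    qed
    have 2: "real_of_int (32 * p * H * residual_bound n (?B N) (?c N) (?u N)) \<le> real_of_int (int N * int N)"
      using elim(2) N pos by (simp add: field_simps)
    have 3: "real_of_int (4 * p * \<bar>?u N i * D\<^sub>0 - u\<^sub>0 i * int N\<bar>) \<le> real_of_int (int N * D\<^sub>0)" if "i \<in> {..<n}" for i
    proof -
      have "of_int (?u N i) / real N - u\<^sub>0 i / D\<^sub>0 = (?u N i * D\<^sub>0 - u\<^sub>0 i * int N) / (real N * D\<^sub>0)"
        using N pos by (simp add: field_simps)
      note eq = this
      have "\<bar>real_of_int (?u N i * D\<^sub>0 - u\<^sub>0 i * int N)\<bar> / (real N * D\<^sub>0) < 1 / (4 * p)"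
        using elim(3)[rule_format, OF that] N pos unfolding eq by (simp add: abs_divide abs_mult)
      from le_of_divide_less[OF _ _ this] show ?thesis using N pos by (simp add: abs_mult)
    qed
    show ?case using 1 2 3 elim(4) unfolding refine_check_def of_int_le_iff by simp
  qed
  then obtain N where "refine_check n H p c\<^sub>0 R\<^sub>0 u\<^sub>0 D\<^sub>0 (int N) (?B N) (?c N) (?u N) (int N)"
    using eventually_happens'[OF sequentially_bot] by blast
  then have "refine_check n H p c\<^sub>0 R\<^sub>0 u\<^sub>0 D\<^sub>0 (int N) (\<lambda>i j. round (real_of_int (int N) * a i j)) (?c N) (?u N) (int N)"
    by simp
  then show ?thesis by blast
qed

text \<open>The exact certificate is rounded with a large denominator \<open>N = R = D\<close>. Both
  matrix products multiply two rounded factors, whence the scale \<open>s = N * N\<close>.\<close>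

lemma commit_exists:
  assumes eig: "\<And>i. i < n \<Longrightarrow> app n a x i = ev * x i" and x: "\<exists>i<n. x i \<noteq> 0" and n: "1 \<le> n"
    and inv: "\<And>i j. i < n \<Longrightarrow> j < n \<Longrightarrow>
      (\<Sum>k<n. P i k * (a k j - ev * of_bool (k = j))) + (\<Sum>k<q. W i k * W j k) = of_bool (i = j)"
  shows "\<exists>R c P W s H u D. commit_check n q R (\<lambda>i j. round (R * a i j)) c P W s H u D"
proof -
  obtain i\<^sub>0 where i0: "i\<^sub>0 < n" "x i\<^sub>0 \<noteq> 0" using x by blast
  \<comment> \<open>Scaled to make coordinate \<open>i\<^sub>0\<close> equal to 2, so that its
    approximation still exceeds 1.\<close>
  define y where "y = (\<lambda>i. 2 / x i\<^sub>0 * x i)"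
  have y: "app n a y i = ev * y i" if "i < n" for i
    unfolding y_def app_scale using eig[OF that] by simp
  let ?B = "\<lambda>N i j. round (real N * a i j)"
  let ?c = "\<lambda>N. round (real N * ev)"
  let ?P = "\<lambda>N i j. round (real N * P i j)"
  let ?W = "\<lambda>N i j. round (real N * W i j)"
  let ?u = "\<lambda>N i. round (real N * y i)"
  let ?f = "\<lambda>z N. of_int (round (real N * z)) / real N"
  \<comment> \<open>\<open>H\<close> is chosen before \<open>N\<close> and strictly above twice the
    entry sum of \<open>P\<close>, hence also above that of its rounding for large
    \<open>N\<close>.\<close>
  define H where "H = \<lceil>2 * (\<Sum>i<n. \<Sum>k<n. \<bar>P i k\<bar>)\<rceil> + 1"
  have H: "2 * (\<Sum>i<n. \<Sum>k<n. \<bar>P i k\<bar>) < H" unfolding H_def by linarith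
  have "0 \<le> (\<Sum>i<n. \<Sum>k<n. \<bar>P i k\<bar>)" by (intro sum_nonneg) auto
  with H have H0: "0 < H" by linarith
  have "\<forall>\<^sub>F N in sequentially. \<forall>i\<in>{..<n}. \<forall>j\<in>{..<n}.
      2 * n * (\<bar>(\<Sum>k<n. ?f (P i k) N * (?f (a k j) N - ?f ev N * of_bool (k = j))) + (\<Sum>k<q. ?f (W i k) N * ?f (W j k) N)
          - of_bool (i = j)\<bar> + (\<Sum>k<n. \<bar>?f (P i k) N\<bar>) * inverse (real N)) < 1"
  proof (intro eventually_ball_finite ballI)
    fix i j assume ij: "i \<in> {..<n}" "j \<in> {..<n}"
    show "\<forall>\<^sub>F N in sequentially.
      2 * n * (\<bar>(\<Sum>k<n. ?f (P i k) N * (?f (a k j) N - ?f ev N * of_bool (k = j))) + (\<Sum>k<q. ?f (W i k) N * ?f (W j k) N)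
          - of_bool (i = j)\<bar> + (\<Sum>k<n. \<bar>?f (P i k) N\<bar>) * inverse (real N)) < 1"
    proof (rule eventually_lt)
      show "(\<lambda>N. 2 * n * (\<bar>(\<Sum>k<n. ?f (P i k) N * (?f (a k j) N - ?f ev N * of_bool (k = j))) + (\<Sum>k<q. ?f (W i k) N * ?f (W j k) N)
          - of_bool (i = j)\<bar> + (\<Sum>k<n. \<bar>?f (P i k) N\<bar>) * inverse (real N)))
        \<longlonglongrightarrow> 2 * n * (\<bar>(\<Sum>k<n. P i k * (a k j - ev * of_bool (k = j))) + (\<Sum>k<q. W i k * W j k)
          - of_bool (i = j)\<bar> + (\<Sum>k<n. \<bar>P i k\<bar>) * 0)"
        by (intro tendsto_intros round_tendsto lim_inverse_n)
    qed (use inv ij in simp)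
  qed auto
  moreover have "\<forall>\<^sub>F N in sequentially. 2 * (\<Sum>i<n. \<Sum>k<n. \<bar>?f (P i k) N\<bar>) < H"
    by (intro eventually_lt[OF _ H] tendsto_intros round_tendsto)
  moreover have "\<forall>\<^sub>F N in sequentially. of_int (residual_bound n (?B N) (?c N) (?u N)) / (real N * real N) < 1 / (16 * H)"
    by (rule eventually_lt[OF residual_bound_tendsto[OF y]]) (use H0 in auto)
  moreover have "\<forall>\<^sub>F N in sequentially. 1 < \<bar>?f (y i\<^sub>0) N\<bar>"
  proof (rule order_tendstoD(1))
    show "(\<lambda>N. \<bar>?f (y i\<^sub>0) N\<bar>) \<longlonglongrightarrow> \<bar>y i\<^sub>0\<bar>" by (intro tendsto_intros round_tendsto)
  qed (use i0 in \<open>simp add: y_def\<close>)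
  moreover have "\<forall>\<^sub>F N in sequentially. 0 < N" by (rule eventually_gt_at_top)
  ultimately have "\<forall>\<^sub>F N in sequentially. commit_check n q (int N) (?B N) (?c N) (?P N) (?W N) (int N * int N) H (?u N) (int N)"
  proof eventually_elim
    case (elim N)
    have N: "0 < real N" using elim(5) by simp
    have 1: "real_of_int (2 * int n * (\<bar>(\<Sum>k<n. ?P N i k * (?B N k j - ?c N * of_bool (k = j))) + (\<Sum>k<q. ?W N i k * ?W N j k)
          - int N * int N * of_bool (i = j)\<bar> + (\<Sum>k<n. \<bar>?P N i k\<bar>))) \<le> real_of_int (int N * int N)"
      if ij: "i \<in> {..<n}" "j \<in> {..<n}" for i j
    proof -
      let ?X = "(\<Sum>k<n. ?P N i k * (?B N k j - ?c N * of_bool (k = j))) + (\<Sum>k<q. ?W N i k * ?W N j k)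
          - int N * int N * of_bool (i = j)"
      have "(\<Sum>k<n. ?f (P i k) N * (?f (a k j) N - ?f ev N * of_bool (k = j))) + (\<Sum>k<q. ?f (W i k) N * ?f (W j k) N)
          - of_bool (i = j) = real_of_int ?X / (real N * real N)"
        unfolding rescale_product times_divide_times_eq using N by (simp add: sum_divide_distrib add_divide_distrib diff_divide_distrib)
      moreover have "(\<Sum>k<n. \<bar>?f (P i k) N\<bar>) * inverse (real N) = (\<Sum>k<n. \<bar>real_of_int (?P N i k)\<bar>) / (real N * real N)"
        by (simp add: sum_divide_distrib sum_distrib_right divide_inverse abs_mult mult.assoc)
      ultimately have "2 * n * (\<bar>real_of_int ?X\<bar> / (real N * real N) + (\<Sum>k<n. \<bar>real_of_int (?P N i k)\<bar>) / (real N * real N)) < 1"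
        using elim(1)[rule_format, OF ij] N by (simp only: abs_divide abs_mult)
      then have "2 * n * (\<bar>real_of_int ?X\<bar> + (\<Sum>k<n. \<bar>real_of_int (?P N i k)\<bar>)) / (real N * real N) < 1"
        by (simp only: add_divide_distrib distrib_left times_divide_eq_right)
      then show ?thesis using N by (simp add: pos_divide_less_eq)
    qed
    have 2: "real_of_int (2 * (\<Sum>i<n. \<Sum>k<n. \<bar>?P N i k\<bar>) * int N) \<le> real_of_int (int N * int N * H)"
    proof -
      have "2 * ((\<Sum>i<n. \<Sum>k<n. \<bar>real_of_int (?P N i k)\<bar>) / N) < H"
        using elim(2) by (simp add: sum_divide_distrib abs_divide)
      then have "2 * (\<Sum>i<n. \<Sum>k<n. \<bar>real_of_int (?P N i k)\<bar>) \<le> real N * real_of_int H" using N by (simp add: field_simps)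
      then have "2 * (\<Sum>i<n. \<Sum>k<n. \<bar>real_of_int (?P N i k)\<bar>) * real N \<le> real N * real_of_int H * real N" using N by (intro mult_right_mono) auto
      then show ?thesis by (simp add: mult_ac)
    qed
    have 3: "real_of_int (16 * H * residual_bound n (?B N) (?c N) (?u N)) \<le> real_of_int (int N * int N)"
      using elim(3) N H0 by (simp add: field_simps)
    have 4: "real_of_int (int N) \<le> real_of_int \<bar>?u N i\<^sub>0\<bar>"
      using elim(4) N by (simp add: abs_divide field_simps)
    show ?case using 1 2 3 4 elim(5) i0 H0 unfolding commit_check_def gap_check_def of_int_le_iff by auto
  qed
  then obtain N where "commit_check n q (int N) (?B N) (?c N) (?P N) (?W N) (int N * int N) H (?u N) (int N)"
    using eventually_happens'[OF sequentially_bot] by blast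
  then have "commit_check n q (int N) (\<lambda>i j. round (real_of_int (int N) * a i j)) (?c N) (?P N) (?W N) (int N * int N) H (?u N) (int N)"
    by simp
  then show ?thesis by blast
qed

section \<open>Reading and writing names\<close>

text \<open>The number of bits of component \<open>r\<close> among the first \<open>t\<close> bits
  of an interleaving of \<open>m\<close> streams; used for the input with \<open>m\<close> entries
  and for the output with \<open>n\<close> coordinates.\<close>

primrec count_mod :: "nat \<Rightarrow> nat \<Rightarrow> nat \<Rightarrow> nat" where
  "count_mod m r 0 = 0"
| "count_mod m r (Suc t) = count_mod m r t + of_bool (t mod m = r)"

lemma count_mod_eq: "r < m \<Longrightarrow> count_mod m r t = t div m + of_bool (r < t mod m)"
proof (induction t)
  case (Suc t)
  have "t mod m < m" using Suc.prems by simp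
  with Suc show ?case by (auto simp: mod_Suc div_Suc)
qed simp

lemma nat_code_rec: "nat_code z = (if z = 0 then [False] else True # odd z # nat_code (z div 2))"
  by (simp add: nat_code_def nat_word.simps[of z])

lemma flat_frac_code:
  "flat (smap frac_code (sdrop k q)) = frac_code (q !! k) @- flat (smap frac_code (sdrop (Suc k) q))"
proof -
  have "shd (smap frac_code (sdrop k q)) \<noteq> []" by (simp add: frac_code_def split: prod.splits)
  from flat_unfold[OF this] show ?thesis by (simp add: sdrop_simps)
qed

definition parser_phase :: "nat \<Rightarrow> bool \<Rightarrow> nat" where
  "parser_phase ph b = (if ph = 0 then 1 else if ph = 1 then (if b then 2 else 3) else if ph = 2 then 1
     else if ph = 3 then (if b then 4 else 0) else 3)"

definition parser_sign :: "nat \<Rightarrow> bool \<Rightarrow> nat \<Rightarrow> nat" where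
  "parser_sign ph b sg = (if ph = 0 then of_bool b else sg)"

definition parser_num :: "nat \<Rightarrow> bool \<Rightarrow> nat \<Rightarrow> nat \<Rightarrow> nat" where
  "parser_num ph b x pw = (if ph = 0 then 0 else if ph = 2 \<and> b then x + pw else x)"

definition parser_den :: "nat \<Rightarrow> bool \<Rightarrow> nat \<Rightarrow> nat \<Rightarrow> nat" where
  "parser_den ph b y pw = (if ph = 0 then 0 else if ph = 4 \<and> b then y + pw else y)"

text \<open>Digits arrive least significant first. The weight returns to 1 where a numeral begins,
  after the sign bit and after the end flag of the numerator.\<close>

definition parser_weight :: "nat \<Rightarrow> bool \<Rightarrow> nat \<Rightarrow> nat" where
  "parser_weight ph b pw = (if ph = 0 \<or> ph = 1 \<and> \<not> b then 1 else if ph = 2 \<or> ph = 4 then 2 * pw else pw)"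

text \<open>
  \<open>rem\<close> is the unread part of the code of the fraction \<open>f\<close>. Phase \<open>0\<close> expects the sign bit,
  phases \<open>1\<close> and \<open>2\<close> expect a flag or a bit of the numerator, phases \<open>3\<close> and \<open>4\<close> of the denominator.
\<close>

definition parsing :: "nat \<Rightarrow> nat \<Rightarrow> nat \<Rightarrow> nat \<Rightarrow> nat \<Rightarrow> int \<times> nat \<Rightarrow> bool list \<Rightarrow> bool" where
  "parsing ph sg x y pw f rem \<longleftrightarrow>
     ph = 0 \<and> rem = frac_code f \<or>
     ph = 1 \<and> (\<exists>z. rem = nat_code z @ nat_code (snd f) \<and> nat \<bar>fst f\<bar> = x + pw * z) \<and>
       (sg \<noteq> 0 \<longleftrightarrow> fst f < 0) \<and> y = 0 \<or>
     ph = 2 \<and> (\<exists>z. rem = odd z # nat_code (z div 2) @ nat_code (snd f) \<and> nat \<bar>fst f\<bar> = x + pw * z) \<and>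
       (sg \<noteq> 0 \<longleftrightarrow> fst f < 0) \<and> y = 0 \<or>
     ph = 3 \<and> (\<exists>z. rem = nat_code z \<and> snd f = y + pw * z) \<and>
       (sg \<noteq> 0 \<longleftrightarrow> fst f < 0) \<and> nat \<bar>fst f\<bar> = x \<or>
     ph = 4 \<and> (\<exists>z. rem = odd z # nat_code (z div 2) \<and> snd f = y + pw * z) \<and>
       (sg \<noteq> 0 \<longleftrightarrow> fst f < 0) \<and> nat \<bar>fst f\<bar> = x"

lemma odd_weight: "x + pw * z = (if odd z then x + pw else x) + 2 * pw * (z div 2)" for x pw z :: nat
  by (cases "odd z") (auto elim!: oddE evenE simp: algebra_simps)

text \<open>The value read so far plus the weight times the unread numeral \<open>z\<close> stays
  constant; \<open>odd_weight\<close> is the passage from \<open>z\<close> to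
  \<open>z div 2\<close>. An end flag in phase 3 means \<open>z = 0\<close>, so the registers then
  hold the fraction.\<close>

lemma parsing_step:
  assumes "parsing ph sg x y pw f rem"
  obtains b rem' where "rem = b # rem'"
    and "ph = 3 \<Longrightarrow> \<not> b \<Longrightarrow> rem' = [] \<and> nat \<bar>fst f\<bar> = x \<and> snd f = y \<and> (sg \<noteq> 0 \<longleftrightarrow> fst f < 0)"
    and "\<not> (ph = 3 \<and> \<not> b) \<Longrightarrow> parsing (parser_phase ph b) (parser_sign ph b sg) (parser_num ph b x pw)
      (parser_den ph b y pw) (parser_weight ph b pw) f rem'"
proof -
  note defs = parser_phase_def parser_sign_def parser_num_def parser_den_def parser_weight_def
  consider (0) "ph = 0" "rem = frac_code f"
    | (1) z where "ph = 1" "rem = nat_code z @ nat_code (snd f)" "nat \<bar>fst f\<bar> = x + pw * z"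
       "sg \<noteq> 0 \<longleftrightarrow> fst f < 0" "y = 0"
    | (2) z where "ph = 2" "rem = odd z # nat_code (z div 2) @ nat_code (snd f)" "nat \<bar>fst f\<bar> = x + pw * z"
       "sg \<noteq> 0 \<longleftrightarrow> fst f < 0" "y = 0"
    | (3) z where "ph = 3" "rem = nat_code z" "snd f = y + pw * z" "sg \<noteq> 0 \<longleftrightarrow> fst f < 0" "nat \<bar>fst f\<bar> = x"
    | (4) z where "ph = 4" "rem = odd z # nat_code (z div 2)" "snd f = y + pw * z" "sg \<noteq> 0 \<longleftrightarrow> fst f < 0"
       "nat \<bar>fst f\<bar> = x"
    using assms unfolding parsing_def by blast
  then show ?thesis
  proof cases
    case 0
    then show ?thesis
      by (intro that[of "fst f < 0" "nat_code (nat \<bar>fst f\<bar>) @ nat_code (snd f)"])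
        (auto simp: frac_code_def parsing_def defs split: prod.splits)
  next
    case 1
    show ?thesis
    proof (cases "z = 0")
      case True
      then show ?thesis using 1
        by (intro that[of False "nat_code (snd f)"]) (auto simp: nat_code_rec[of 0] parsing_def defs)
    next
      case False
      then show ?thesis using 1
        by (intro that[of True "odd z # nat_code (z div 2) @ nat_code (snd f)"])
          (auto simp: nat_code_rec[of z] parsing_def defs)
    qed
  next
    case 2
    then show ?thesis using odd_weight[of x pw z]
      by (intro that[of "odd z" "nat_code (z div 2) @ nat_code (snd f)"]) (auto simp: parsing_def defs)
  next
    case 3
    show ?thesis
    proof (cases "z = 0")
      case True
      then show ?thesis using 3
        by (intro that[of False "[]"]) (auto simp: nat_code_rec[of 0] parsing_def defs)
    next
      case False
      then show ?thesis using 3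
        by (intro that[of True "odd z # nat_code (z div 2)"])
          (auto simp: nat_code_rec[of z] parsing_def defs)
    qed
  next
    case 4
    then show ?thesis using odd_weight[of y pw z]
      by (intro that[of "odd z" "nat_code (z div 2)"]) (auto simp: parsing_def defs)
  qed
qed

text \<open>The parser reversed, with phases shifted by one since 0 stands for an idle emitter: 1
  writes the sign, 2 and 3 flag and bit of the numerator, 4 and 5 those of the denominator. A flag
  tests for 0 because the numeral of 0 is the empty word.\<close>

definition emitter_bit :: "nat \<Rightarrow> nat \<Rightarrow> nat \<Rightarrow> nat \<Rightarrow> bool" where
  "emitter_bit ph sg x y \<longleftrightarrow> ph = 1 \<and> sg \<noteq> 0 \<or> ph = 2 \<and> x \<noteq> 0 \<or> ph = 3 \<and> odd x \<or> ph = 4 \<and> y \<noteq> 0 \<or>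
     5 \<le> ph \<and> odd y"

definition emitter_phase :: "nat \<Rightarrow> nat \<Rightarrow> nat \<Rightarrow> nat" where
  "emitter_phase ph x y = (if ph = 1 then 2 else if ph = 2 then (if x = 0 then 4 else 3) else if ph = 3 then 2
     else if ph = 4 then (if y = 0 then 0 else 5) else 4)"

definition emitter_num :: "nat \<Rightarrow> nat \<Rightarrow> nat" where
  "emitter_num ph x = (if ph = 3 then x div 2 else x)"

definition emitter_den :: "nat \<Rightarrow> nat \<Rightarrow> nat" where
  "emitter_den ph y = (if 5 \<le> ph then y div 2 else y)"

definition pending :: "nat \<Rightarrow> nat \<Rightarrow> nat \<Rightarrow> nat \<Rightarrow> bool list" where
  "pending ph sg x y =
     (if ph = 0 then [] else if ph = 1 then (sg \<noteq> 0) # nat_code x @ nat_code y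
      else if ph = 2 then nat_code x @ nat_code y
      else if ph = 3 then odd x # nat_code (x div 2) @ nat_code y
      else if ph = 4 then nat_code y else odd y # nat_code (y div 2))"

lemma pending_step:
  assumes "ph \<noteq> 0"
  shows "pending ph sg x y = emitter_bit ph sg x y #
    pending (emitter_phase ph x y) sg (emitter_num ph x) (emitter_den ph y)"
proof -
  consider "ph = 1" | "ph = 2" | "ph = 3" | "ph = 4" | "5 \<le> ph" using assms by linarith
  then show ?thesis
    by cases (auto simp: pending_def emitter_bit_def emitter_phase_def emitter_num_def emitter_den_def
        nat_code_rec[of x] nat_code_rec[of y])
qed

section \<open>Convergence\<close>

text \<open>\<open>P\<close> doubles with each improvement, and stages without one leave the vector
  alone. The nearby eigenvectors need not be related to one another: their distance to
  \<open>x t\<close> tends to 0, so they share its limit.\<close>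

lemma limit_in_eigenspace:
  fixes x :: "nat \<Rightarrow> nat \<Rightarrow> real" and P :: "nat \<Rightarrow> real"
  assumes pos: "\<And>t. 0 < P t"
    and step: "\<And>t. P (Suc t) = P t \<and> (\<forall>i<n. x (Suc t) i = x t i) \<or>
      P (Suc t) = 2 * P t \<and> (\<forall>i<n. \<bar>x (Suc t) i - x t i\<bar> \<le> 1 / (4 * P t))"
    and unb: "\<And>K. \<exists>t. K \<le> P t"
    and near: "\<And>t. \<exists>w. (\<forall>i<n. app n a w i = ev * w i) \<and> (\<forall>i<n. \<bar>x t i - w i\<bar> \<le> 1 / (8 * P t))"
  shows "\<exists>v. (\<forall>i<n. app n a v i = ev * v i) \<and> (\<forall>t. \<forall>i<n. \<bar>x t i - v i\<bar> \<le> 1 / (2 * P t))"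
proof -
  have mono: "P t \<le> P t'" if "t \<le> t'" for t t'
    using lift_Suc_mono_le[of P, OF _ that] step pos by (smt (verit, best))
  have "filterlim P at_top sequentially"
    unfolding filterlim_at_top eventually_sequentially using unb mono by (meson order_trans)
  then have lim0: "(\<lambda>t. inverse (P t)) \<longlonglongrightarrow> 0" by (rule tendsto_inverse_0_at_top)
  \<comment> \<open>A step of size \<open>1 / (4 * P)\<close> equals the drop of
    \<open>1 / (2 * P)\<close> when \<open>P\<close> doubles, so the sum telescopes.\<close>
  have dist: "\<bar>x t' i - x t i\<bar> \<le> 1 / (2 * P t) - 1 / (2 * P t')" if "t \<le> t'" "i < n" for t t' i
    using that(1)
  proof (induction rule: dec_induct)
    case (step u)
    have "1 / (4 * P u) = 1 / (2 * P u) - 1 / (2 * (2 * P u))" using pos[of u] by (simp add: field_simps)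
    then have "\<bar>x (Suc u) i - x u i\<bar> \<le> 1 / (2 * P u) - 1 / (2 * P (Suc u))"
      using assms(2)[of u] that(2) by auto
    with step.IH show ?case by linarith
  qed simp
  have "Cauchy (\<lambda>t. x t i)" if "i < n" for i
    unfolding Cauchy_def
  proof (intro allI impI)
    fix e :: real assume e: "0 < e"
    obtain M where M: "1 / e + 1 \<le> P M" using unb by blast
    have "0 < 1 / e" using e by simp
    have "1 / e < P M" using M by linarith
    then have "1 / P M < e" using e pos[of M] by (simp add: field_simps)
    have "dist (x j i) (x k i) < e" if "M \<le> j" "M \<le> k" for j k
    proof -
      have "0 < 1 / (2 * P j)" "0 < 1 / (2 * P k)" using pos by auto
      then have "\<bar>x j i - x M i\<bar> \<le> 1 / (2 * P M)" "\<bar>x k i - x M i\<bar> \<le> 1 / (2 * P M)"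
        using dist[OF that(1) \<open>i < n\<close>] dist[OF that(2) \<open>i < n\<close>] by linarith+
      then have "\<bar>x j i - x k i\<bar> \<le> 1 / P M" by (simp add: field_simps abs_if split: if_splits)
      with \<open>1 / P M < e\<close> show ?thesis by (simp add: dist_real_def)
    qed
    then show "\<exists>M. \<forall>m\<ge>M. \<forall>k\<ge>M. dist (x m i) (x k i) < e" by blast
  qed
  then have "\<exists>L. (\<lambda>t. x t i) \<longlonglongrightarrow> L" if "i < n" for i
    using that Cauchy_convergent_iff convergent_def by blast
  then obtain v where v: "\<And>i. i < n \<Longrightarrow> (\<lambda>t. x t i) \<longlonglongrightarrow> v i" by metis
  obtain w where w: "\<And>t i. i < n \<Longrightarrow> app n a (w t) i = ev * w t i"
    "\<And>t i. i < n \<Longrightarrow> \<bar>x t i - w t i\<bar> \<le> 1 / (8 * P t)"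
    using near by metis
  \<comment> \<open>The equation \<open>A w = ev w\<close> can now be passed to the limit by
    continuity of \<open>app\<close>.\<close>
  have wv: "(\<lambda>t. w t i) \<longlonglongrightarrow> v i" if "i < n" for i
  proof -
    have "(\<lambda>t. x t i - w t i) \<longlonglongrightarrow> 0"
    proof (rule tendsto_0_le[OF lim0, where K = "1 / 8"], rule always_eventually, rule allI)
      fix t
      show "norm (x t i - w t i) \<le> norm (inverse (P t)) * (1 / 8)"
        using w(2)[OF that, of t] pos[of t] by (simp add: field_simps)
    qed
    from tendsto_diff[OF v[OF that] this] show ?thesis by simp
  qed
  have "app n a v i = ev * v i" if "i < n" for i
  proof -
    have "(\<lambda>t. app n a (w t) i) \<longlonglongrightarrow> app n a v i"
      unfolding app_def by (intro tendsto_intros wv) simp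
    moreover have "(\<lambda>t. app n a (w t) i) \<longlonglongrightarrow> ev * v i"
      unfolding w(1)[OF that] by (intro tendsto_intros wv that)
    ultimately show ?thesis by (rule LIMSEQ_unique)
  qed
  moreover have "\<bar>x t i - v i\<bar> \<le> 1 / (2 * P t)" if "i < n" for t i
  proof -
    have "(\<lambda>t'. \<bar>x t' i - x t i\<bar>) \<longlonglongrightarrow> \<bar>v i - x t i\<bar>" by (intro tendsto_intros v that)
    moreover have "\<exists>N. \<forall>t'\<ge>N. \<bar>x t' i - x t i\<bar> \<le> 1 / (2 * P t)"
    proof (intro exI[of _ t] allI impI)
      fix t' assume "t \<le> t'"
      have "0 < 1 / (2 * P t')" using pos by simp
      then show "\<bar>x t' i - x t i\<bar> \<le> 1 / (2 * P t)" using dist[OF \<open>t \<le> t'\<close> that] by linarith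
    qed
    ultimately have "\<bar>v i - x t i\<bar> \<le> 1 / (2 * P t)" by (rule LIMSEQ_le_const2)
    then show ?thesis by (simp add: abs_minus_commute)
  qed
  ultimately show ?thesis by blast
qed

section \<open>The algorithm\<close>

text \<open>
  \<open>Ph\<close>, \<open>Sg\<close>, \<open>Nm\<close>, \<open>Dn\<close>, \<open>Wt\<close> form the parser of a matrix entry, and \<open>FS\<close>, \<open>FN\<close>, \<open>FD\<close>, \<open>FP\<close> its
  latest complete fraction with the reciprocal of its precision (\<open>0\<close> if there is none yet).
  \<open>AV\<close>, \<open>AW\<close>, \<open>AD\<close> hold the advice, the current binary weight minus one, and the end mark.
  \<open>PJ = 2 ^ J\<close> once the search has succeeded \<open>J + 1\<close> times, and \<open>PJ = 0\<close> before.
  \<open>UP - UM\<close> over \<open>UD\<close> is the current approximate eigenvector; the eigenvalue is within \<open>1 / HH\<close>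
  of \<open>MP - MN\<close> over \<open>MD\<close>. \<open>EP\<close>, \<open>ES\<close>, \<open>EN\<close>, \<open>ED\<close> form the emitter of a component, \<open>EK\<close> counts its fractions.
\<close>

datatype var =
    Bit | Sym | Stage | Cand
  | Ptr | Ph nat | Sg nat | Nm nat | Dn nat | Wt nat | FS nat | FN nat | FD nat | FP nat
  | AV | AW | AD
  | PJ | J | UP nat | UM nat | UD | MP | MN | MD | HH
  | OP | EP nat | ES nat | EN nat | ED nat | EK nat

instance var :: countable by countable_datatype

text \<open>
  A candidate of the search consists of the arguments of \<open>commit_check\<close>, of which \<open>refine_check\<close> uses
  \<open>CR\<close>, \<open>CB\<close>, \<open>CC\<close>, \<open>CU\<close>, \<open>CD\<close>. It is coded by one number, whose digits in base \<open>Stage\<close> give each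
  integer as a difference of two naturals.
\<close>

datatype cvar = CR | CD | CC | CS | CH | CU nat | CB nat nat | CP nat nat | CW nat nat

instance cvar :: countable by countable_datatype

definition digit :: "nat \<Rightarrow> nat \<Rightarrow> nat \<Rightarrow> nat" where
  "digit T c k = (c div T ^ k) mod T"

definition entry :: "nat \<Rightarrow> nat \<Rightarrow> cvar \<Rightarrow> int" where
  "entry T c v = int (digit T c (2 * to_nat v)) - int (digit T c (2 * to_nat v + 1))"

definition index_pairs :: "nat \<Rightarrow> (nat \<times> nat) list" where
  "index_pairs n = concat (map (\<lambda>i. map (\<lambda>j. (i, j)) [i..<n]) [0..<n])"

text \<open>\<open>W\<close> has \<open>2 ^ (n + 1)\<close> columns here, enough for
  \<open>q = 2 ^ (k + 1) - 1\<close> with any \<open>k \<le> n\<close>.\<close>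

definition cvars :: "nat \<Rightarrow> cvar set" where
  "cvars n = {CR, CD, CC, CS, CH} \<union> CU ` {..<n} \<union> (\<lambda>(i, j). CB i j) ` ({..<n} \<times> {..<n}) \<union>
     (\<lambda>(i, j). CP i j) ` ({..<n} \<times> {..<n}) \<union> (\<lambda>(i, j). CW i j) ` ({..<n} \<times> {..<2 ^ (n + 1)})"

lemma ex_digits:
  assumes "\<And>k. k < M \<Longrightarrow> d k < T"
  shows "\<exists>c<T ^ M. \<forall>k<M. digit T c k = d k"
  using assms
proof (induction M)
  case (Suc M)
  then obtain c where c: "c < T ^ M" "\<And>k. k < M \<Longrightarrow> digit T c k = d k" by force
  have dM: "d M < T" using Suc.prems by simp
  let ?c = "c + d M * T ^ M"
  have "?c < (1 + d M) * T ^ M" using c(1) by simp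
  also have "\<dots> \<le> T * T ^ M" using dM by (intro mult_right_mono) auto
  finally have "?c < T ^ Suc M" by simp
  moreover have "digit T ?c k = d k" if "k < Suc M" for k
  proof (cases "k = M")
    case True
    then show ?thesis using c(1) dM by (simp add: digit_def)
  next
    case False
    then have "k < M" using that by simp
    then obtain e where e: "M = k + Suc e" using less_iff_Suc_add by auto
    let ?e = "T * (d M * T ^ e)"
    have 1: "?c = c + T ^ k * ?e" by (simp add: e power_add algebra_simps)
    have "T ^ k \<noteq> 0" using dM by simp
    then have "(c + T ^ k * ?e) div T ^ k = ?e + c div T ^ k" by (rule div_mult_self2)
    then show ?thesis using c(2)[OF \<open>k < M\<close>] unfolding digit_def 1 by simp
  qed
  ultimately show ?case by blast
qed simp

lemma finite_cvars: "finite (cvars n)"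
  by (simp add: cvars_def)

definition num_digits :: "nat \<Rightarrow> nat" where
  "num_digits n = 2 * Suc (Max (to_nat ` cvars n))"

text \<open>The base grows with the stage, so any fixed finite choice of integers is representable
  in all late stages with the same number of digits.\<close>

lemma ex_candidate:
  "\<exists>T\<^sub>0. \<forall>T\<ge>T\<^sub>0. \<exists>c<T ^ num_digits n. \<forall>v\<in>cvars n. entry T c v = \<zeta> v"
proof -
  define d where "d = (\<lambda>k. if even k then nat (\<zeta> (from_nat (k div 2))) else nat (- \<zeta> (from_nat (k div 2))))"
  define T0 where "T0 = Suc (Max (d ` {..<num_digits n}))"
  have "\<exists>c<T ^ num_digits n. \<forall>v\<in>cvars n. entry T c v = \<zeta> v" if T: "T0 \<le> T" for T
  proof -
    have "d k < T" if "k < num_digits n" for k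
    proof -
      have "d k \<le> Max (d ` {..<num_digits n})" using that by (intro Max_ge) auto
      then show ?thesis using T by (simp add: T0_def)
    qed
    then obtain c where c: "c < T ^ num_digits n" "\<forall>k<num_digits n. digit T c k = d k"
      using ex_digits by blast
    have "entry T c v = \<zeta> v" if "v \<in> cvars n" for v
    proof -
      have "to_nat v \<le> Max (to_nat ` cvars n)" using that finite_cvars by (intro Max_ge) auto
      then have "2 * to_nat v + 1 < num_digits n" by (simp add: num_digits_def)
      then have "entry T c v = int (d (2 * to_nat v)) - int (d (2 * to_nat v + 1))" using c(2) by (simp add: entry_def)
      then show ?thesis by (simp add: d_def)
    qed
    with c(1) show ?thesis by blast
  qed
  then show ?thesis by blast
qed

locale algorithm =
  fixes n :: nat
  assumes n_pos: "1 \<le> n"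
begin

definition m :: nat where "m = length (index_pairs n)"

text \<open>Symmetric by construction, so comparing it with the upper triangle in the input is
  enough.\<close>

definition cand_matrix :: "nat \<Rightarrow> nat \<Rightarrow> nat \<Rightarrow> nat \<Rightarrow> int" where
  "cand_matrix T c i j = entry T c (if i \<le> j then CB i j else CB j i)"

definition latest_num :: "(var \<Rightarrow> nat) \<Rightarrow> nat \<Rightarrow> int" where
  "latest_num s r = int (of_bool (s (FS r) = 0) * s (FN r)) - int (of_bool (s (FS r) \<noteq> 0) * s (FN r))"

text \<open>Guarantees \<open>\<bar>R * a i j - B i j\<bar> \<le> 1\<close> when
  \<open>a i j\<close> is only known to be within \<open>1 / FP\<close> of the latest fraction: the
  distance of \<open>B\<close> from \<open>R\<close> times that fraction plus \<open>R / FP\<close>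
  is at most 1, cleared of the denominators \<open>FD\<close> and \<open>FP\<close>.\<close>

definition name_ok :: "(var \<Rightarrow> nat) \<Rightarrow> nat \<Rightarrow> bool" where
  "name_ok s c \<longleftrightarrow> (\<forall>r\<in>{..<m}. 0 < s (FP r) \<and>
     \<bar>latest_num s r * entry (s Stage) c CR
        - cand_matrix (s Stage) c (fst (index_pairs n ! r)) (snd (index_pairs n ! r)) * int (s (FD r))\<bar> * int (s (FP r))
       + entry (s Stage) c CR * int (s (FD r)) \<le> int (s (FD r)) * int (s (FP r)))"

definition commit_ok :: "(var \<Rightarrow> nat) \<Rightarrow> nat \<Rightarrow> nat \<Rightarrow> bool" where
  "commit_ok s c k \<longleftrightarrow> commit_check n (2 ^ (k + 1) - 1) (entry (s Stage) c CR) (cand_matrix (s Stage) c)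
     (entry (s Stage) c CC) (\<lambda>i j. entry (s Stage) c (CP i j)) (\<lambda>i j. entry (s Stage) c (CW i j))
     (entry (s Stage) c CS) (entry (s Stage) c CH) (\<lambda>i. entry (s Stage) c (CU i)) (entry (s Stage) c CD)"

definition refine_ok :: "(var \<Rightarrow> nat) \<Rightarrow> nat \<Rightarrow> bool" where
  "refine_ok s c \<longleftrightarrow> refine_check n (int (s HH)) (int (s PJ)) (int (s MP) - int (s MN)) (int (s MD))
     (\<lambda>i. int (s (UP i)) - int (s (UM i))) (int (s UD)) (entry (s Stage) c CR) (cand_matrix (s Stage) c)
     (entry (s Stage) c CC) (\<lambda>i. entry (s Stage) c (CU i)) (entry (s Stage) c CD)"

text \<open>The advice is matched against the constants \<open>k \<le> n\<close> because
  \<open>q\<close> bounds an index set in \<open>commit_check\<close>, and effective sums have a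
  fixed index set. No certificate is accepted before the end of the advice has been seen.\<close>

definition found :: "(var \<Rightarrow> nat) \<Rightarrow> nat \<Rightarrow> bool" where
  "found s c \<longleftrightarrow> name_ok s c \<and>
     (s PJ = 0 \<and> s AD \<noteq> 0 \<and> (\<exists>k\<in>{..n}. s AV = k \<and> commit_ok s c k) \<or> s PJ \<noteq> 0 \<and> refine_ok s c)"

definition solution :: "(var \<Rightarrow> nat) \<Rightarrow> nat" where
  "solution s = (LEAST c. s Stage ^ num_digits n \<le> c \<or> found s c)"

definition success :: "(var \<Rightarrow> nat) \<Rightarrow> bool" where
  "success s \<longleftrightarrow> solution s < s Stage ^ num_digits n"

definition sol_digit :: "(var \<Rightarrow> nat) \<Rightarrow> nat \<Rightarrow> nat" where
  "sol_digit s k = digit (s Stage) (solution s) k"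

definition new_entry :: "(var \<Rightarrow> nat) \<Rightarrow> cvar \<Rightarrow> int" where
  "new_entry s v = entry (s Stage) (solution s) v"

definition parsed :: "(var \<Rightarrow> nat) \<Rightarrow> nat \<Rightarrow> bool" where
  "parsed s r \<longleftrightarrow> s Ptr = r \<and> s (Ph r) = 3 \<and> s Bit \<noteq> 2"

text \<open>Fraction number \<open>EK i\<close> must be accurate to \<open>1 / 2 ^ EK i\<close>,
  while the current vector is accurate to \<open>1 / 2 ^ J\<close>.\<close>

definition loads :: "(var \<Rightarrow> nat) \<Rightarrow> nat \<Rightarrow> bool" where
  "loads s i \<longleftrightarrow> s OP = i \<and> s (EP i) = 0 \<and> s PJ \<noteq> 0 \<and> s (EK i) \<le> s J"

definition emits :: "(var \<Rightarrow> nat) \<Rightarrow> bool" where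
  "emits s \<longleftrightarrow> (\<exists>i\<in>{..<n}. s OP = i \<and> s (EP i) \<noteq> 0)"

definition out_bit :: "(var \<Rightarrow> nat) \<Rightarrow> bool" where
  "out_bit s \<longleftrightarrow> (\<exists>i\<in>{..<n}. s OP = i \<and> emitter_bit (s (EP i)) (s (ES i)) (s (EN i)) (s (ED i)))"

text \<open>All right-hand sides refer to the values before the stage. \<open>FP\<close> and
  \<open>PJ\<close> go from 0, for nothing yet, to 1 and then double. The eigenvalue window
  \<open>MP\<close>, \<open>MN\<close>, \<open>MD\<close>, \<open>HH\<close> is frozen at the first
  success, so every refinement stays with the same eigenspace.\<close>

fun update :: "var \<Rightarrow> (var \<Rightarrow> nat) \<Rightarrow> nat" where
  "update Bit s = 0"
| "update Sym s = 0"
| "update Cand s = 0"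
| "update Stage s = s Stage + 1"
| "update Ptr s = (if s Ptr + 1 = m then 0 else s Ptr + 1)"
| "update (Ph r) s = (if s Ptr = r then parser_phase (s (Ph r)) (s Bit = 2) else s (Ph r))"
| "update (Sg r) s = (if s Ptr = r then parser_sign (s (Ph r)) (s Bit = 2) (s (Sg r)) else s (Sg r))"
| "update (Nm r) s = (if s Ptr = r then parser_num (s (Ph r)) (s Bit = 2) (s (Nm r)) (s (Wt r)) else s (Nm r))"
| "update (Dn r) s = (if s Ptr = r then parser_den (s (Ph r)) (s Bit = 2) (s (Dn r)) (s (Wt r)) else s (Dn r))"
| "update (Wt r) s = (if s Ptr = r then parser_weight (s (Ph r)) (s Bit = 2) (s (Wt r)) else s (Wt r))"
| "update (FS r) s = (if parsed s r then s (Sg r) else s (FS r))"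
| "update (FN r) s = (if parsed s r then s (Nm r) else s (FN r))"
| "update (FD r) s = (if parsed s r then s (Dn r) else s (FD r))"
| "update (FP r) s = (if parsed s r then if s (FP r) = 0 then 1 else 2 * s (FP r) else s (FP r))"
| "update AV s = (if s AD = 0 \<and> s Sym = 2 then s AV + (s AW + 1) else s AV)"
| "update AW s = 2 * s AW + 1"
| "update AD s = (if s Sym = 0 then 1 else s AD)"
| "update PJ s = (if success s then if s PJ = 0 then 1 else 2 * s PJ else s PJ)"
| "update J s = (if success s \<and> s PJ \<noteq> 0 then s J + 1 else s J)"
| "update (UP i) s = (if success s then sol_digit s (2 * to_nat (CU i)) else s (UP i))"
| "update (UM i) s = (if success s then sol_digit s (2 * to_nat (CU i) + 1) else s (UM i))"
| "update UD s = (if success s then nat \<bar>new_entry s CD\<bar> else s UD)"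
| "update MP s = (if success s \<and> s PJ = 0 then sol_digit s (2 * to_nat CC) else s MP)"
| "update MN s = (if success s \<and> s PJ = 0 then sol_digit s (2 * to_nat CC + 1) else s MN)"
| "update MD s = (if success s \<and> s PJ = 0 then nat \<bar>new_entry s CR\<bar> else s MD)"
| "update HH s = (if success s \<and> s PJ = 0 then nat \<bar>new_entry s CH\<bar> else s HH)"
| "update OP s = (if emits s then if s OP + 1 = n then 0 else s OP + 1 else s OP)"
| "update (EP i) s = (if loads s i then 1 else if s OP = i \<and> s (EP i) \<noteq> 0
     then emitter_phase (s (EP i)) (s (EN i)) (s (ED i)) else s (EP i))"
| "update (ES i) s = (if loads s i then of_bool (s (UP i) < s (UM i)) else s (ES i))"
| "update (EN i) s = (if loads s i then nat \<bar>int (s (UP i)) - int (s (UM i))\<bar>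
     else if s OP = i then emitter_num (s (EP i)) (s (EN i)) else s (EN i))"
| "update (ED i) s = (if loads s i then s UD
     else if s OP = i then emitter_den (s (EP i)) (s (ED i)) else s (ED i))"
| "update (EK i) s = (if loads s i then s (EK i) + 1 else s (EK i))"

definition vars :: "var set" where
  "vars = {Stage, Ptr, AV, AW, AD, PJ, J, UD, MP, MN, MD, HH, OP} \<union>
     (\<Union>r\<in>{..<m}. {Ph r, Sg r, Nm r, Dn r, Wt r, FS r, FN r, FD r, FP r}) \<union>
     (\<Union>i\<in>{..<n}. {UP i, UM i, EP i, ES i, EN i, ED i, EK i})"

lemma effective_entry [effective_intros]:
  assumes "effective T" "effective c"
  shows "effective_int (\<lambda>s. entry (T s) (c s) v)"
  unfolding entry_def digit_def by (intro effective_intros assms)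

lemma effective_cand_matrix [effective_intros]:
  assumes "effective T" "effective c"
  shows "effective_int (\<lambda>s. cand_matrix (T s) (c s) i j)"
  unfolding cand_matrix_def by (intro effective_intros assms)

lemma effective_found: "effective_pred (\<lambda>s. found s (s Cand))"
  unfolding found_def name_ok_def commit_ok_def refine_ok_def commit_check_def refine_check_def gap_check_def
    residual_bound_def latest_num_def
  by (intro effective_intros finite_lessThan finite_atMost)

text \<open>Lets \<open>effective_Least\<close> search in \<open>Cand\<close>: overwriting it
  supplies the candidate and changes nothing else that \<open>found\<close> reads.\<close>

lemma found_upd [simp]: "found (s(Cand := x)) c = found s c"
  by (simp add: found_def name_ok_def commit_ok_def refine_ok_def latest_num_def)

lemma effective_solution [effective_intros]: "effective solution"
proof -
  have "effective (\<lambda>s. LEAST x. s Stage ^ num_digits n \<le> x \<or> found (s(Cand := x)) ((s(Cand := x)) Cand))"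
    by (intro effective_Least[OF _ effective_found] effective_intros)
  then show ?thesis by (simp add: solution_def[abs_def])
qed

lemma effective_success [effective_intros]: "effective_pred success"
  unfolding success_def[abs_def] by (intro effective_intros)

lemma effective_new_entry [effective_intros]: "effective_int (\<lambda>s. new_entry s v)"
  unfolding new_entry_def by (intro effective_intros)

lemma effective_sol_digit [effective_intros]: "effective (\<lambda>s. sol_digit s k)"
  unfolding sol_digit_def digit_def by (intro effective_intros)

lemma effective_loads [effective_intros]: "effective_pred (\<lambda>s. loads s i)"
  unfolding loads_def by (intro effective_intros)

lemma effective_parsed [effective_intros]: "effective_pred (\<lambda>s. parsed s r)"
  unfolding parsed_def by (intro effective_intros)

lemma effective_pred_odd [effective_intros]:
  assumes "effective f"
  shows "effective_pred (\<lambda>s. odd (f s))"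
  unfolding odd_iff_mod_2_eq_one by (intro effective_intros assms)

lemma effective_emits [effective_intros]: "effective_pred emits"
  unfolding emits_def[abs_def] by (intro effective_intros finite_lessThan)

lemma effective_out_bit [effective_intros]: "effective_pred out_bit"
  unfolding out_bit_def[abs_def] emitter_bit_def by (intro effective_intros finite_lessThan)

lemma effective_update: "effective (update v)"
  by (cases v; simp only: update.simps[abs_def] parser_phase_def parser_sign_def parser_num_def parser_den_def
      parser_weight_def emitter_phase_def emitter_num_def emitter_den_def; intro effective_intros)

lemma finite_vars: "finite vars"
  by (simp add: vars_def)

end

section \<open>Correctness\<close>

lemma set_index_pairs: "(i, j) \<in> set (index_pairs n) \<longleftrightarrow> i \<le> j \<and> j < n"
  by (force simp: index_pairs_def)

section \<open>Reading the matrix entries and the advice\<close>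

locale run = algorithm +
  fixes S :: "nat \<Rightarrow> var \<Rightarrow> nat" and p :: "bool stream" and w :: "bool list"
  assumes S_0: "v \<in> vars \<Longrightarrow> S 0 v = 0"
    and S_Suc: "v \<in> vars \<Longrightarrow> S (Suc t) v = update v (S t)"
    and S_Bit: "S t Bit = 2 \<longleftrightarrow> p !! t"
    and S_Sym: "S t Sym = symbol_code (word_tape w t)"
begin

lemma in_vars [simp]:
  "Stage \<in> vars" "Ptr \<in> vars" "AV \<in> vars" "AW \<in> vars" "AD \<in> vars" "PJ \<in> vars" "J \<in> vars" "UD \<in> vars"
  "MP \<in> vars" "MN \<in> vars" "MD \<in> vars" "HH \<in> vars" "OP \<in> vars"
  "r < m \<Longrightarrow> Ph r \<in> vars" "r < m \<Longrightarrow> Sg r \<in> vars" "r < m \<Longrightarrow> Nm r \<in> vars" "r < m \<Longrightarrow> Dn r \<in> vars"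
  "r < m \<Longrightarrow> Wt r \<in> vars" "r < m \<Longrightarrow> FS r \<in> vars" "r < m \<Longrightarrow> FN r \<in> vars" "r < m \<Longrightarrow> FD r \<in> vars"
  "r < m \<Longrightarrow> FP r \<in> vars"
  "r < n \<Longrightarrow> UP r \<in> vars" "r < n \<Longrightarrow> UM r \<in> vars" "r < n \<Longrightarrow> EP r \<in> vars" "r < n \<Longrightarrow> ES r \<in> vars"
  "r < n \<Longrightarrow> EN r \<in> vars" "r < n \<Longrightarrow> ED r \<in> vars" "r < n \<Longrightarrow> EK r \<in> vars"
  by (auto simp: vars_def)

lemma m_pos: "0 < m"
proof -
  have "(0, 0) \<in> set (index_pairs n)" using n_pos by (simp add: set_index_pairs)
  then show ?thesis by (auto simp: m_def)
qed

lemma S_Stage: "S t Stage = t"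
  by (induction t) (auto simp: S_0 S_Suc)

lemma S_Ptr: "S t Ptr = t mod m"
  using m_pos by (induction t) (auto simp: S_0 S_Suc mod_Suc)

context
  fixes r :: nat and q :: "(int \<times> nat) stream"
  assumes r: "r < m" and q: "component m r p = flat (smap frac_code q)"
begin

text \<open>Here \<open>k\<close> fractions of component \<open>r\<close> are complete and
  \<open>rem\<close> is the rest of fraction \<open>k\<close>. The latest complete fraction has
  index \<open>k - 1\<close>, which explains the precision \<open>2 ^ (k - 1)\<close>.\<close>

definition reading :: "nat \<Rightarrow> nat \<Rightarrow> bool list \<Rightarrow> bool" where
  "reading t k rem \<longleftrightarrow>
     sdrop (count_mod m r t) (component m r p) = rem @- flat (smap frac_code (sdrop (Suc k) q)) \<and>
     parsing (S t (Ph r)) (S t (Sg r)) (S t (Nm r)) (S t (Dn r)) (S t (Wt r)) (q !! k) rem \<and>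
     S t (FP r) = (if k = 0 then 0 else 2 ^ (k - 1)) \<and>
     (0 < k \<longrightarrow> S t (FD r) = snd (q !! (k - 1)) \<and> S t (FN r) = nat \<bar>fst (q !! (k - 1))\<bar> \<and>
       (S t (FS r) \<noteq> 0 \<longleftrightarrow> fst (q !! (k - 1)) < 0))"

lemma reading_0: "reading 0 0 (frac_code (q !! 0))"
  using r flat_frac_code[of 0 q] by (simp add: reading_def S_0 parsing_def q)

lemma reading_idle:
  assumes "reading t k rem" "t mod m \<noteq> r"
  shows "reading (Suc t) k rem"
  using assms r by (simp add: reading_def S_Suc S_Ptr parsed_def)

lemma reading_bit:
  assumes "reading t k (b # rem)" "t mod m = r"
  shows "p !! t = b"
proof -
  have "b = component m r p !! count_mod m r t"
    using assms(1) unfolding reading_def by (metis sdrop_simps(1) shift.simps(2) stream.sel(1))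
  also have "\<dots> = p !! (t div m * m + r)" using assms(2) r by (simp add: component_def count_mod_eq)
  also have "t div m * m + r = t" using assms(2) by (metis div_mult_mod_eq)
  finally show ?thesis by simp
qed

lemma reading_active:
  assumes "reading t k rem" "t mod m = r"
  shows "(\<exists>rem'. length rem' < length rem \<and> reading (Suc t) k rem') \<or>
    reading (Suc t) (Suc k) (frac_code (q !! Suc k))"
proof -
  have P: "parsing (S t (Ph r)) (S t (Sg r)) (S t (Nm r)) (S t (Dn r)) (S t (Wt r)) (q !! k) rem"
    using assms(1) by (simp add: reading_def)
  obtain b rem' where rem: "rem = b # rem'"
    and fin: "S t (Ph r) = 3 \<Longrightarrow> \<not> b \<Longrightarrow> rem' = [] \<and> nat \<bar>fst (q !! k)\<bar> = S t (Nm r) \<and> snd (q !! k) = S t (Dn r)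
      \<and> (S t (Sg r) \<noteq> 0 \<longleftrightarrow> fst (q !! k) < 0)"
    and nxt: "\<not> (S t (Ph r) = 3 \<and> \<not> b) \<Longrightarrow> parsing (parser_phase (S t (Ph r)) b)
      (parser_sign (S t (Ph r)) b (S t (Sg r))) (parser_num (S t (Ph r)) b (S t (Nm r)) (S t (Wt r)))
      (parser_den (S t (Ph r)) b (S t (Dn r)) (S t (Wt r))) (parser_weight (S t (Ph r)) b (S t (Wt r)))
      (q !! k) rem'"
    using parsing_step[OF P] by blast
  have b: "S t Bit = 2 \<longleftrightarrow> b" using reading_bit assms rem by (simp add: S_Bit)
  have drop: "sdrop (count_mod m r (Suc t)) (component m r p) = rem' @- flat (smap frac_code (sdrop (Suc k) q))"
  proof -
    have "sdrop (count_mod m r (Suc t)) (component m r p) = stl (sdrop (count_mod m r t) (component m r p))"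
      using assms(2) by (simp add: sdrop_simps)
    also have "\<dots> = rem' @- flat (smap frac_code (sdrop (Suc k) q))"
      using assms(1) rem by (simp add: reading_def)
    finally show ?thesis .
  qed
  show ?thesis
  proof (cases "S t (Ph r) = 3 \<and> \<not> b")
    case True
    then have "rem' = []" using fin by simp
    then have "sdrop (count_mod m r (Suc t)) (component m r p)
        = frac_code (q !! Suc k) @- flat (smap frac_code (sdrop (Suc (Suc k)) q))"
      using drop flat_frac_code[of "Suc k" q] by simp
    moreover have "S (Suc t) (Ph r) = 0"
      using True r assms(2) b by (simp add: S_Suc S_Ptr parser_phase_def)
    moreover have "S (Suc t) (FP r) = 2 ^ k"
      using True r assms b by (cases k) (auto simp: S_Suc S_Ptr parsed_def reading_def)
    moreover have "S (Suc t) (FD r) = snd (q !! k)" "S (Suc t) (FN r) = nat \<bar>fst (q !! k)\<bar>"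
      "S (Suc t) (FS r) \<noteq> 0 \<longleftrightarrow> fst (q !! k) < 0"
      using True r assms b fin by (simp_all add: S_Suc S_Ptr parsed_def)
    ultimately have "reading (Suc t) (Suc k) (frac_code (q !! Suc k))" by (simp add: reading_def parsing_def)
    then show ?thesis ..
  next
    case False
    have np: "\<not> parsed (S t) r" using False b by (auto simp: parsed_def)
    have "reading (Suc t) k rem'"
      using drop nxt[OF False] assms r np b by (simp add: reading_def S_Suc S_Ptr)
    then show ?thesis using rem by auto
  qed
qed

lemma reading_until_active:
  assumes "reading t k rem"
  shows "\<exists>t'\<ge>t. t' mod m = r \<and> reading t' k rem"
proof -
  have "t \<le> t * m" using m_pos by simp
  then have ex: "t \<le> t * m + r \<and> (t * m + r) mod m = r" using r by (simp add: trans_le_add1)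
  define t' where "t' = (LEAST u. t \<le> u \<and> u mod m = r)"
  have t': "t \<le> t' \<and> t' mod m = r" using LeastI[of "\<lambda>u. t \<le> u \<and> u mod m = r", OF ex] unfolding t'_def .
  have "reading u k rem" if "t \<le> u" "u \<le> t'" for u
    using that
  proof (induction u rule: dec_induct)
    case (step u)
    have "u < t'" using step.prems by simp
    then have "\<not> (t \<le> u \<and> u mod m = r)" unfolding t'_def by (rule not_less_Least)
    then have "u mod m \<noteq> r" using step.hyps by simp
    moreover have "reading u k rem" using step.IH \<open>u < t'\<close> by simp
    ultimately show ?case by (intro reading_idle)
  qed (use assms in simp)
  with t' show ?thesis by blast
qed

text \<open>The turn of component \<open>r\<close> comes every \<open>m\<close> stages, and each
  turn either shortens \<open>rem\<close> or completes the fraction.\<close>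

lemma reading_progress: "reading t k rem \<Longrightarrow> \<exists>t'\<ge>t. \<exists>rem'. reading t' (Suc k) rem'"
proof (induction "length rem" arbitrary: t rem rule: less_induct)
  case less
  obtain t1 where t1: "t1 \<ge> t" "t1 mod m = r" "reading t1 k rem"
    using reading_until_active[OF less.prems] by blast
  from reading_active[OF t1(3,2)] show ?case
  proof
    assume "\<exists>rem'. length rem' < length rem \<and> reading (Suc t1) k rem'"
    then obtain rem' where "length rem' < length rem" "reading (Suc t1) k rem'" by blast
    from less.hyps[OF this] show ?thesis using t1(1) by (meson Suc_leD le_trans)
  next
    assume "reading (Suc t1) (Suc k) (frac_code (q !! Suc k))"
    then show ?thesis using t1(1) by (meson le_SucI)
  qed
qed

lemma ex_reading: "\<exists>k rem. reading t k rem"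
proof (induction t)
  case 0
  then show ?case using reading_0 by blast
next
  case (Suc t)
  then show ?case using reading_idle reading_active by blast
qed

lemma ex_reading_late: "\<exists>t rem. reading t k rem"
proof (induction k)
  case 0
  then show ?case using reading_0 by blast
next
  case (Suc k)
  then show ?case using reading_progress by blast
qed

end

lemma FP_mono:
  assumes "r < m" "t \<le> t'"
  shows "S t (FP r) \<le> S t' (FP r)"
  using assms(2) by (rule lift_Suc_mono_le[rotated]) (use assms(1) in \<open>simp add: S_Suc\<close>)

lemma latest_fraction:
  assumes "r < m" "cauchy_name (component m r p) x" "0 < S t (FP r)"
  shows "0 < S t (FD r)" and "\<bar>x - latest_num (S t) r / S t (FD r)\<bar> \<le> 1 / S t (FP r)"
proof -
  obtain q where q: "component m r p = flat (smap frac_code q)"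
    "\<And>k. 0 < snd (q !! k) \<and> \<bar>x - frac_value (q !! k)\<bar> \<le> 1 / 2 ^ k"
    using assms(2) unfolding cauchy_name_def by blast
  obtain k rem where k: "reading r q t k rem" using ex_reading[OF assms(1) q(1)] by blast
  note R = k[unfolded reading_def[OF assms(1) q(1)]]
  obtain j where j: "k = Suc j" using R assms(3) by (cases k) auto
  have num: "latest_num (S t) r = fst (q !! j)" using R j by (auto simp: latest_num_def)
  show "0 < S t (FD r)" using R j q(2)[of j] by auto
  show "\<bar>x - latest_num (S t) r / S t (FD r)\<bar> \<le> 1 / S t (FP r)"
    using R j q(2)[of j] by (simp add: num frac_value_def split: prod.splits)
qed

lemma FP_unbounded:
  assumes "r < m" "cauchy_name (component m r p) x"
  shows "\<exists>t\<^sub>0. \<forall>t\<ge>t\<^sub>0. K \<le> S t (FP r)"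
proof -
  obtain q where q: "component m r p = flat (smap frac_code q)"
    using assms(2) unfolding cauchy_name_def by blast
  obtain t rem where "reading r q t (Suc K) rem" using ex_reading_late[OF assms(1) q] by blast
  then have "S t (FP r) = 2 ^ K" by (simp add: reading_def[OF assms(1) q])
  then have "K \<le> S t (FP r)" using less_exp[of K] by simp
  then show ?thesis using FP_mono[OF assms(1)] le_trans by blast
qed

text \<open>The weight invariant of the parser again, the weight being \<open>AW + 1\<close>. The
  mark \<open>AD\<close> is set only at a blank, where the unread numeral \<open>z\<close> is 0 and
  \<open>AV\<close> is complete.\<close>

lemma advice_invariant:
  assumes "w = nat_word k"
  shows "\<exists>z. drop t w = nat_word z \<and> k = S t AV + (S t AW + 1) * z \<and> (S t AD \<noteq> 0 \<longrightarrow> z = 0)"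
proof (induction t)
  case 0
  show ?case using assms by (intro exI[of _ k]) (simp add: S_0)
next
  case (Suc t)
  then obtain z where z: "drop t w = nat_word z" "k = S t AV + (S t AW + 1) * z" "S t AD \<noteq> 0 \<longrightarrow> z = 0" by blast
  show ?case
  proof (cases "z = 0")
    case True
    then have "length w \<le> t" using z(1) by (simp add: nat_word.simps[of 0])
    then have "S t Sym = 0" by (simp add: S_Sym word_tape_def symbol_code_def)
    then show ?thesis using True z \<open>length w \<le> t\<close>
      by (intro exI[of _ 0]) (simp add: S_Suc nat_word.simps[of 0])
  next
    case False
    then have d: "drop t w = odd z # nat_word (z div 2)" using z(1) by (simp add: nat_word.simps[of z])
    then have t: "t < length w" by (metis drop_eq_Nil list.distinct(1) not_le)
    then have "w ! t = odd z" "drop (Suc t) w = nat_word (z div 2)"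
      using d by (simp_all add: Cons_nth_drop_Suc[symmetric])
    moreover have "S t Sym = (if odd z then 2 else 1)"
      using t \<open>w ! t = odd z\<close> by (simp add: S_Sym word_tape_def symbol_code_def)
    ultimately show ?thesis using z False odd_weight[of "S t AV" "S t AW + 1" z]
      by (intro exI[of _ "z div 2"]) (auto simp: S_Suc)
  qed
qed

lemma advice_correct: "w = nat_word k \<Longrightarrow> S t AD \<noteq> 0 \<Longrightarrow> S t AV = k"
  using advice_invariant[of k t] by auto

lemma advice_read:
  assumes "length w < t"
  shows "S t AD \<noteq> 0"
proof -
  obtain t' where t: "t = Suc t'" using assms by (cases t) auto
  then have "S t' Sym = 0" using assms by (simp add: S_Sym word_tape_def symbol_code_def)
  then show ?thesis by (simp add: t S_Suc)
qed

end

section \<open>Soundness and completeness of the search\<close>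

lemma residual_bound_cong:
  assumes "\<And>i j. i < n \<Longrightarrow> j < n \<Longrightarrow> B i j = B' i j" "\<And>i. i < n \<Longrightarrow> u i = u' i"
  shows "residual_bound n B c u = residual_bound n B' c u'"
  unfolding residual_bound_def using assms
  by (intro sum.cong refl arg_cong2[of _ _ _ _ "(+)"] arg_cong[of _ _ abs]) auto

lemma refine_check_cong:
  assumes "\<And>i j. i < n \<Longrightarrow> j < n \<Longrightarrow> B i j = B' i j" "\<And>i. i < n \<Longrightarrow> u i = u' i"
  shows "refine_check n H p c\<^sub>0 R\<^sub>0 u\<^sub>0 D\<^sub>0 R B c u D = refine_check n H p c\<^sub>0 R\<^sub>0 u\<^sub>0 D\<^sub>0 R B' c u' D"
proof -
  have "residual_bound n B c u = residual_bound n B' c u'" by (rule residual_bound_cong[OF assms])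
  then show ?thesis unfolding refine_check_def using assms(2) by simp
qed

lemma commit_check_cong:
  assumes "\<And>i j. i < n \<Longrightarrow> j < n \<Longrightarrow> B i j = B' i j" "\<And>i. i < n \<Longrightarrow> u i = u' i"
    and "\<And>i j. i < n \<Longrightarrow> j < n \<Longrightarrow> P i j = P' i j" "\<And>i j. i < n \<Longrightarrow> j < q \<Longrightarrow> W i j = W' i j"
  shows "commit_check n q R B c P W s H u D = commit_check n q R B' c P' W' s H u' D"
proof -
  have "(\<Sum>k<n. P i k * (B k j - c * of_bool (k = j))) = (\<Sum>k<n. P' i k * (B' k j - c * of_bool (k = j)))"
    "(\<Sum>k<q. W i k * W j k) = (\<Sum>k<q. W' i k * W' j k)" "(\<Sum>k<n. \<bar>P i k\<bar>) = (\<Sum>k<n. \<bar>P' i k\<bar>)"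
    if "i < n" "j < n" for i j
    using that assms by (auto intro!: sum.cong)
  moreover have "(\<Sum>i<n. \<Sum>k<n. \<bar>P i k\<bar>) = (\<Sum>i<n. \<Sum>k<n. \<bar>P' i k\<bar>)"
    using assms(3) by (auto intro!: sum.cong)
  ultimately have "gap_check n q R B c P W s H = gap_check n q R B' c P' W' s H"
    unfolding gap_check_def by auto
  moreover have "residual_bound n B c u = residual_bound n B' c u'" by (rule residual_bound_cong[OF assms(1,2)])
  ultimately show ?thesis unfolding commit_check_def using assms(2) by simp
qed

lemma (in algorithm) success_found: "success s \<Longrightarrow> found s (solution s)"
proof -
  assume *: "success s"
  have "s Stage ^ num_digits n \<le> solution s \<or> found s (solution s)"
    unfolding solution_def by (rule LeastI[of _ "s Stage ^ num_digits n"]) simp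
  with * show ?thesis by (simp add: success_def)
qed

lemma (in algorithm) found_success: "found s c \<Longrightarrow> c < s Stage ^ num_digits n \<Longrightarrow> success s"
proof -
  assume "found s c" "c < s Stage ^ num_digits n"
  moreover have "solution s \<le> c" unfolding solution_def by (rule Least_le) (simp add: \<open>found s c\<close>)
  ultimately show ?thesis by (simp add: success_def)
qed

lemma divide_le_of_le:
  fixes m k x :: real
  assumes "0 < m" "0 < k" "k * x \<le> m"
  shows "x / m \<le> 1 / k"
  using assms by (simp add: field_simps)

locale matrix_run = run n S p w + eigensystem n a v l
  for n S p w a v l +
  fixes k :: nat
  assumes entries: "r < m \<Longrightarrow>
      cauchy_name (component m r p) (a (fst (index_pairs n ! r)) (snd (index_pairs n ! r)))"
    and advice: "w = nat_word k"
    and k_le: "k \<le> n"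
    and mult_ge: "i < n \<Longrightarrow> 2 ^ k \<le> card {j. j < n \<and> l j = l i}"
    and mult_less: "\<exists>i<n. card {j. j < n \<and> l j = l i} < 2 ^ (k + 1)"
begin

lemma index_pairs_bounds:
  assumes "r < m" "index_pairs n ! r = (i, j)"
  shows "i \<le> j" "j < n" "i < n"
  using assms set_index_pairs[of i j n] nth_mem[of r "index_pairs n"] by (auto simp: m_def)

lemma name_ok_sound:
  assumes ok: "name_ok (S t) c" and R: "0 < entry (S t Stage) c CR" and ij: "i < n" "j < n"
  shows "\<bar>entry (S t Stage) c CR * a i j - cand_matrix (S t Stage) c i j\<bar> \<le> 1"
proof -
  let ?R = "entry (S t Stage) c CR" and ?B = "cand_matrix (S t Stage) c"
  have "\<bar>?R * a i j - ?B i j\<bar> \<le> 1" if ij: "i \<le> j" "j < n" for i j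
  proof -
    obtain r where r: "r < m" "index_pairs n ! r = (i, j)"
      using ij set_index_pairs[of i j n] by (metis in_set_conv_nth m_def)
    define N where "N = latest_num (S t) r"
    define D where "D = S t (FD r)"
    define F where "F = S t (FP r)"
    have "\<bar>N * ?R - ?B i j * int D\<bar> * int F + ?R * int D \<le> int D * int F" and F: "0 < F"
      using bspec[OF ok[unfolded name_ok_def], of r] r by (simp_all add: N_def D_def F_def)
    then have "real_of_int (\<bar>N * ?R - ?B i j * int D\<bar> * int F + ?R * int D) \<le> real_of_int (int D * int F)"
      by (simp only: of_int_le_iff)
    then have le: "\<bar>real_of_int N * ?R - ?B i j * real D\<bar> * F + ?R * real D \<le> real D * F" by simp
    have D: "0 < D" and x: "\<bar>a i j - N / D\<bar> \<le> 1 / F"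
      using latest_fraction[OF r(1) entries[OF r(1)]] F r(2) by (auto simp: N_def D_def F_def)
    have "real_of_int N * ?R - ?B i j * real D = D * (N / D * ?R - ?B i j)"
      using D by (simp add: field_simps)
    then have "\<bar>real_of_int N * ?R - ?B i j * real D\<bar> = D * \<bar>N / D * ?R - ?B i j\<bar>"
      by (simp only: abs_mult abs_of_nat)
    then have "D * (\<bar>N / D * ?R - ?B i j\<bar> * F + ?R) \<le> D * real F" using le by (simp add: algebra_simps)
    then have "\<bar>N / D * ?R - ?B i j\<bar> * F + ?R \<le> F" using D by simp
    then have 1: "\<bar>N / D * ?R - ?B i j\<bar> \<le> 1 - ?R / F" using F by (simp add: field_simps)
    have "?R * a i j - N / D * ?R = ?R * (a i j - N / D)" by (simp add: algebra_simps)
    then have "\<bar>?R * a i j - N / D * ?R\<bar> = ?R * \<bar>a i j - N / D\<bar>"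
      using R by (simp add: abs_mult)
    also have "\<dots> \<le> ?R * (1 / F)" using x R by (intro mult_left_mono) auto
    finally show ?thesis using 1 by simp
  qed
  from this[of i j] this[of j i] show ?thesis
    using ij sym[OF ij] by (cases "i \<le> j") (auto simp: cand_matrix_def split: if_splits)
qed

text \<open>Rounding costs 1/2, and the inaccuracy of the latest fraction enters twice with
  \<open>R / FP\<close>; the total is at most 1 as soon as \<open>4 * R \<le> FP\<close>.\<close>

lemma name_ok_complete:
  fixes R :: int
  assumes R: "0 < R" "entry (S t Stage) c CR = R"
    and B: "\<And>i j. i < n \<Longrightarrow> j < n \<Longrightarrow> cand_matrix (S t Stage) c i j = round (R * a i j)"
    and F: "\<And>r. r < m \<Longrightarrow> 4 * nat R \<le> S t (FP r)"
  shows "name_ok (S t) c"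
  unfolding name_ok_def R(2)
proof (intro ballI conjI)
  fix r assume "r \<in> {..<m}"
  then have r: "r < m" by simp
  obtain i j where ij: "index_pairs n ! r = (i, j)" by force
  have b: "i < n" "j < n" using index_pairs_bounds[OF r ij] by auto
  show Fp: "0 < S t (FP r)" using F[OF r] R(1) by linarith
  define N where "N = latest_num (S t) r"
  define D where "D = S t (FD r)"
  define F' where "F' = S t (FP r)"
  have D: "0 < D" and x: "\<bar>a i j - N / D\<bar> \<le> 1 / F'"
    using latest_fraction[OF r entries[OF r] Fp] ij by (auto simp: N_def D_def F'_def)
  have F4: "4 * real_of_int R \<le> F'" using F[OF r] R(1) unfolding F'_def by linarith
  have F0: "0 < real F'" using Fp by (simp add: F'_def)
  define Bij where "Bij = round (R * a i j)"
  have B1: "\<bar>R * a i j - Bij\<bar> \<le> 1 / 2" unfolding Bij_def by (metis abs_minus_commute of_int_round_abs_le)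
  have "R * a i j - N / D * R = R * (a i j - N / D)" by (simp add: algebra_simps)
  then have "\<bar>R * a i j - N / D * R\<bar> = R * \<bar>a i j - N / D\<bar>"
    using R by (simp add: abs_mult)
  also have "\<dots> \<le> R * (1 / F')" using x R by (intro mult_left_mono) auto
  also have "\<dots> = R / F'" by simp
  finally have "\<bar>N / D * R - Bij\<bar> \<le> R / F' + 1 / 2" using B1 by linarith
  then have "\<bar>N / D * R - Bij\<bar> * F' \<le> (R / F' + 1 / 2) * F'" using F0 by (intro mult_right_mono) auto
  also have "\<dots> = R + F' / 2" using F0 by (simp add: field_simps)
  finally have "\<bar>N / D * R - Bij\<bar> * F' + R \<le> F'" using F4 by linarith
  then have "D * (\<bar>N / D * R - Bij\<bar> * F' + R) \<le> D * real F'" using D by (intro mult_left_mono) auto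
  moreover have "real_of_int N * R - Bij * real D = D * (N / D * R - Bij)"
    using D by (simp add: field_simps)
  then have "\<bar>real_of_int N * R - Bij * real D\<bar> = D * \<bar>N / D * R - Bij\<bar>"
    by (simp only: abs_mult abs_of_nat)
  ultimately have "\<bar>real_of_int N * R - Bij * real D\<bar> * F' + R * real D \<le> real D * F'" by (simp add: algebra_simps)
  then have "real_of_int (\<bar>N * R - Bij * int D\<bar> * int F' + R * int D) \<le> real_of_int (int D * int F')" by simp
  then have "\<bar>N * R - Bij * int D\<bar> * int F' + R * int D \<le> int D * int F'" unfolding of_int_le_iff .
  then show "\<bar>latest_num (S t) r * R - cand_matrix (S t Stage) c (fst (index_pairs n ! r)) (snd (index_pairs n ! r))
      * int (S t (FD r))\<bar> * int (S t (FP r)) + R * int (S t (FD r)) \<le> int (S t (FD r)) * int (S t (FP r))"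
    using B[OF b] by (simp add: ij N_def D_def F'_def Bij_def)
qed

lemma FP_eventually: "\<exists>t\<^sub>0. \<forall>t\<ge>t\<^sub>0. \<forall>r<m. K \<le> S t (FP r)"
proof -
  have "\<exists>t\<^sub>0. \<forall>t\<ge>t\<^sub>0. K \<le> S t (FP r)" if "r < m" for r
    by (rule FP_unbounded[OF that entries[OF that]])
  then obtain f where f: "\<And>r t. r < m \<Longrightarrow> f r \<le> t \<Longrightarrow> K \<le> S t (FP r)" by metis
  show ?thesis
  proof (intro exI[of _ "Max (f ` {..<m})"] allI impI)
    fix t r assume t: "Max (f ` {..<m}) \<le> t" and r: "r < m"
    have "f r \<le> Max (f ` {..<m})" using r by (intro Max_ge) auto
    with t have "f r \<le> t" by simp
    then show "K \<le> S t (FP r)" by (rule f[OF r])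
  qed
qed

text \<open>Two things improve with the stage: the base of the digits and the precision of the
  entries read. Any certificate built on the rounded true matrix is thus eventually a candidate
  consistent with the name.\<close>

lemma candidate_eventually:
  fixes R :: int
  assumes "0 < R" "\<zeta> CR = R" "\<And>i j. i \<le> j \<Longrightarrow> j < n \<Longrightarrow> \<zeta> (CB i j) = round (R * a i j)"
  shows "\<exists>t\<^sub>0. \<forall>t\<ge>t\<^sub>0. \<exists>c<S t Stage ^ num_digits n. name_ok (S t) c \<and>
    (\<forall>v\<in>cvars n. entry (S t Stage) c v = \<zeta> v) \<and>
    (\<forall>i<n. \<forall>j<n. cand_matrix (S t Stage) c i j = round (R * a i j))"
proof -
  obtain T0 where T0: "\<And>T. T0 \<le> T \<Longrightarrow> \<exists>c<T ^ num_digits n. \<forall>v\<in>cvars n. entry T c v = \<zeta> v"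
    using ex_candidate by blast
  obtain t0 where t0: "\<And>t r. t0 \<le> t \<Longrightarrow> r < m \<Longrightarrow> 4 * nat R \<le> S t (FP r)" using FP_eventually by blast
  show ?thesis
  proof (rule exI[of _ "max T0 t0"], intro allI impI)
    fix t assume t: "max T0 t0 \<le> t"
    then obtain c where c: "c < t ^ num_digits n" "\<forall>v\<in>cvars n. entry t c v = \<zeta> v" using T0[of t] by auto
    have B: "cand_matrix t c i j = round (R * a i j)" if ij: "i < n" "j < n" for i j
    proof (cases "i \<le> j")
      case True
      have "CB i j \<in> cvars n" using ij by (force simp: cvars_def)
      with True show ?thesis using c(2) assms(3)[of i j] ij by (simp add: cand_matrix_def)
    next
      case False
      have "CB j i \<in> cvars n" using ij by (force simp: cvars_def)
      with False show ?thesis using c(2) assms(3)[of j i] ij sym[OF ij] by (simp add: cand_matrix_def)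
    qed
    have "entry t c CR = R" using c(2) assms(2) by (simp add: cvars_def)
    then have "name_ok (S t) c"
      using name_ok_complete[of R t c] assms(1) B t0[of t] t by (simp add: S_Stage)
    with c B show "\<exists>c<S t Stage ^ num_digits n. name_ok (S t) c \<and>
        (\<forall>v\<in>cvars n. entry (S t Stage) c v = \<zeta> v) \<and>
        (\<forall>i<n. \<forall>j<n. cand_matrix (S t Stage) c i j = round (R * a i j))"
      by (auto simp: S_Stage)
  qed
qed

definition approx_vec :: "nat \<Rightarrow> nat \<Rightarrow> real" where
  "approx_vec t i = real_of_int (int (S t (UP i)) - int (S t (UM i))) / real (S t UD)"

definition approx_val :: "nat \<Rightarrow> real" where
  "approx_val t = real_of_int (int (S t MP) - int (S t MN)) / real (S t MD)"

text \<open>The invariant from the first success on. The index \<open>k\<^sub>0\<close> of the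
  isolated eigenvalue is a parameter, since it must remain the same in all later stages.\<close>

definition good :: "nat \<Rightarrow> nat \<Rightarrow> bool" where
  "good k\<^sub>0 t \<longleftrightarrow> 0 < S t PJ \<and> 0 < S t HH \<and> 0 < S t MD \<and> 0 < S t UD \<and> k\<^sub>0 < n \<and>
     (\<forall>k<n. l k \<noteq> l k\<^sub>0 \<longrightarrow> 1 / S t HH \<le> \<bar>l k - approx_val t\<bar>) \<and>
     \<bar>l k\<^sub>0 - approx_val t\<bar> < 1 / (2 * S t HH) \<and>
     (\<exists>w. (\<forall>i<n. app n a w i = l k\<^sub>0 * w i) \<and> (\<forall>i<n. \<bar>approx_vec t i - w i\<bar> \<le> 1 / (8 * S t PJ)))"

text \<open>Without success the machine stays in its first search with \<open>PJ = 0\<close>, and a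
  rounded certificate for an eigenvalue of small multiplicity must turn up.\<close>

lemma commit_eventually: "\<exists>t. S t PJ = 0 \<and> success (S t)"
proof (rule ccontr)
  assume "\<not> ?thesis"
  then have no: "\<not> success (S t)" if "S t PJ = 0" for t using that by blast
  have PJ: "S t PJ = 0" for t
    by (induction t) (use no in \<open>auto simp: S_0 S_Suc\<close>)
  \<comment> \<open>The upper half of the advice: this eigenspace fits into \<open>q\<close>
    columns.\<close>
  obtain i\<^sub>0 where i0: "i\<^sub>0 < n" "card {j. j < n \<and> l j = l i\<^sub>0} < 2 ^ (k + 1)" using mult_less by blast
  define q where "q = (2 ^ (k + 1) - 1 :: nat)"
  have cq: "card {j. j < n \<and> l j = l i\<^sub>0} \<le> q" using i0(2) by (simp add: q_def)
  obtain P W where PW: "\<And>i j. i < n \<Longrightarrow> j < n \<Longrightarrow>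
    (\<Sum>k<n. P i k * (a k j - l i\<^sub>0 * of_bool (k = j))) + (\<Sum>k<q. W i k * W j k) = of_bool (i = j)"
    using left_inverse[OF cq] by blast
  have "\<exists>i<n. v i\<^sub>0 i \<noteq> 0"
  proof -
    have "dot n (v i\<^sub>0) (v i\<^sub>0) \<noteq> 0" using orth[OF i0(1) i0(1)] by simp
    then show ?thesis unfolding dot_self_eq_0 by blast
  qed
  then obtain R c P' W' s H u D where chk:
    "commit_check n q R (\<lambda>i j. round (R * a i j)) c P' W' s H u D"
    using commit_exists[of n a "v i\<^sub>0" "l i\<^sub>0" P W q, OF eig[OF i0(1)] _ n_pos PW] by blast
  have R: "0 < R" using chk by (simp add: commit_check_def gap_check_def)
  define \<zeta> where "\<zeta> = (\<lambda>x. case x of CR \<Rightarrow> R | CD \<Rightarrow> D | CC \<Rightarrow> c | CS \<Rightarrow> s | CH \<Rightarrow> H | CU i \<Rightarrow> u i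
    | CB i j \<Rightarrow> round (R * a i j) | CP i j \<Rightarrow> P' i j | CW i j \<Rightarrow> W' i j)"
  obtain t0 where t0: "\<And>t. t0 \<le> t \<Longrightarrow> \<exists>c<S t Stage ^ num_digits n. name_ok (S t) c \<and>
    (\<forall>v\<in>cvars n. entry (S t Stage) c v = \<zeta> v) \<and>
    (\<forall>i<n. \<forall>j<n. cand_matrix (S t Stage) c i j = round (R * a i j))"
    using candidate_eventually[OF R, of \<zeta>] by (auto simp: \<zeta>_def)
  \<comment> \<open>Late enough for the candidate to be representable and for the end of the advice
    to have been read.\<close>
  define t where "t = max t0 (Suc (length w))"
  obtain d where d: "d < S t Stage ^ num_digits n" "name_ok (S t) d"
    "\<forall>v\<in>cvars n. entry (S t Stage) d v = \<zeta> v"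
    "\<forall>i<n. \<forall>j<n. cand_matrix (S t Stage) d i j = round (R * a i j)"
    using t0[of t] by (auto simp: t_def)
  have q_le: "q < 2 ^ (n + 1)" 
  proof -
    have "(2::nat) ^ (k + 1) \<le> 2 ^ (n + 1)" using k_le by (intro power_increasing) auto
    moreover have "0 < (2::nat) ^ (k + 1)" by simp
    ultimately show ?thesis unfolding q_def by linarith
  qed
  have AD: "S t AD \<noteq> 0" by (rule advice_read) (simp add: t_def)
  have "commit_ok (S t) d k"
    unfolding commit_ok_def q_def[symmetric]
  proof (subst commit_check_cong)
    show "commit_check n q (entry (S t Stage) d CR) (\<lambda>i j. round (R * a i j)) (entry (S t Stage) d CC) P' W'
       (entry (S t Stage) d CS) (entry (S t Stage) d CH) u (entry (S t Stage) d CD)"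
      using chk d(3) by (simp add: cvars_def \<zeta>_def)
  next
    fix i j assume "i < n" "j < q"
    then have "CW i j \<in> cvars n" using q_le by (force simp: cvars_def)
    then show "entry (S t Stage) d (CW i j) = W' i j" using d(3) by (simp add: \<zeta>_def)
  next
    fix i j assume "i < n" "j < n"
    then have "CP i j \<in> cvars n" by (force simp: cvars_def)
    then show "entry (S t Stage) d (CP i j) = P' i j" using d(3) by (simp add: \<zeta>_def)
  qed (use d in \<open>auto simp: cvars_def \<zeta>_def\<close>)
  then have "found (S t) d"
    using d(2) PJ AD k_le advice_correct[OF advice AD] by (auto simp: found_def)
  from found_success[OF this d(1)] no[OF PJ] show False by blast
qed

lemma new_values:
  assumes "success (S t)"
  shows "i < n \<Longrightarrow> int (S (Suc t) (UP i)) - int (S (Suc t) (UM i)) = new_entry (S t) (CU i)"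
    and "S (Suc t) UD = nat \<bar>new_entry (S t) CD\<bar>"
    and "S t PJ = 0 \<Longrightarrow> int (S (Suc t) MP) - int (S (Suc t) MN) = new_entry (S t) CC"
    and "S t PJ = 0 \<Longrightarrow> S (Suc t) MD = nat \<bar>new_entry (S t) CR\<bar>"
    and "S t PJ = 0 \<Longrightarrow> S (Suc t) HH = nat \<bar>new_entry (S t) CH\<bar>"
  using assms by (simp_all add: S_Suc new_entry_def sol_digit_def entry_def)

lemma commit_good:
  assumes "S t PJ = 0" "success (S t)"
  shows "\<exists>k\<^sub>0. good k\<^sub>0 (Suc t) \<and> S (Suc t) PJ = 1 \<and> (\<exists>i<n. 1 \<le> \<bar>approx_vec (Suc t) i\<bar>)"
proof -
  have f: "found (S t) (solution (S t))" by (rule success_found[OF assms(2)])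
  define E where "E = new_entry (S t)"
  have AD: "S t AD \<noteq> 0" and ok: "name_ok (S t) (solution (S t))"
    using f assms(1) by (auto simp: found_def)
  have "commit_ok (S t) (solution (S t)) k"
    using f assms(1) advice_correct[OF advice AD] by (auto simp: found_def)
  then have chk: "commit_check n (2 ^ (k + 1) - 1) (E CR) (cand_matrix (S t Stage) (solution (S t)))
      (E CC) (\<lambda>i j. E (CP i j)) (\<lambda>i j. E (CW i j)) (E CS) (E CH) (\<lambda>i. E (CU i)) (E CD)"
    by (simp add: commit_ok_def E_def new_entry_def)
  have pos: "0 < E CR" "0 < E CD" "0 < E CH" using chk by (auto simp: commit_check_def gap_check_def)
  have approx: "\<bar>E CR * a i j - cand_matrix (S t Stage) (solution (S t)) i j\<bar> \<le> 1" if "i < n" "j < n" for i j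
    using name_ok_sound[OF ok _ that] pos by (simp add: E_def new_entry_def)
  \<comment> \<open>The lower half of the advice: each multiplicity is at least
    \<open>2 ^ k\<close>, so twice it exceeds \<open>q\<close>.\<close>
  have mult: "2 ^ (k + 1) - 1 < 2 * card {j. j < n \<and> l j = l i}" if "i < n" for i
  proof -
    have "(2::nat) ^ (k + 1) \<le> 2 * card {j. j < n \<and> l j = l i}" using mult_ge[OF that] by simp
    moreover have "0 < (2::nat) ^ (k + 1)" by simp
    ultimately show ?thesis by linarith
  qed
  obtain k\<^sub>0 where k0: "k\<^sub>0 < n" "\<forall>k<n. l k \<noteq> l k\<^sub>0 \<longrightarrow> 1 / E CH \<le> \<bar>l k - E CC / E CR\<bar>"
    "\<bar>l k\<^sub>0 - E CC / E CR\<bar> < 1 / (2 * E CH)"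
    "\<exists>w. (\<forall>i<n. app n a w i = l k\<^sub>0 * w i) \<and> (\<forall>i<n. \<bar>E (CU i) / E CD - w i\<bar> \<le> 1 / 8)"
    using commit_sound[OF approx n_pos mult chk] by auto
  have H: "real (S (Suc t) HH) = E CH" and MD: "real (S (Suc t) MD) = E CR" and UD: "real (S (Suc t) UD) = E CD"
    using new_values(2,4,5)[OF assms(2)] assms(1) pos by (simp_all add: E_def)
  have val: "approx_val (Suc t) = E CC / E CR"
    unfolding approx_val_def MD new_values(3)[OF assms(2,1)] E_def ..
  have vec: "approx_vec (Suc t) i = E (CU i) / E CD" if "i < n" for i
    unfolding approx_vec_def UD new_values(1)[OF assms(2) that] E_def ..
  have PJ: "S (Suc t) PJ = 1" using assms by (simp add: S_Suc)
  have "0 < S (Suc t) HH" "0 < S (Suc t) MD" "0 < S (Suc t) UD"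
    using new_values(2,4,5)[OF assms(2)] assms(1) pos by (auto simp: E_def)
  moreover obtain x where "\<forall>i<n. app n a x i = l k\<^sub>0 * x i" "\<forall>i<n. \<bar>E (CU i) / E CD - x i\<bar> \<le> 1 / 8"
    using k0(4) by blast
  then have "\<exists>w. (\<forall>i<n. app n a w i = l k\<^sub>0 * w i) \<and> (\<forall>i<n. \<bar>approx_vec (Suc t) i - w i\<bar> \<le> 1 / (8 * S (Suc t) PJ))"
    using vec PJ by (intro exI[of _ x]) simp
  ultimately have "good k\<^sub>0 (Suc t)"
    unfolding good_def val H by (intro conjI) (use k0(1-3) PJ H in simp_all)
  moreover have "\<exists>i<n. 1 \<le> \<bar>approx_vec (Suc t) i\<bar>"
  proof -
    obtain i where i: "i < n" "E CD \<le> \<bar>E (CU i)\<bar>" using chk by (auto simp: commit_check_def)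
    then have "1 \<le> \<bar>approx_vec (Suc t) i\<bar>" using pos by (simp add: vec abs_divide)
    with i(1) show ?thesis by blast
  qed
  ultimately show ?thesis using PJ by blast
qed

lemma good_idle:
  assumes "good k\<^sub>0 t" "\<not> success (S t)"
  shows "good k\<^sub>0 (Suc t) \<and> S (Suc t) PJ = S t PJ \<and> S (Suc t) J = S t J \<and> (\<forall>i<n. approx_vec (Suc t) i = approx_vec t i)"
  using assms unfolding good_def approx_vec_def approx_val_def by (auto simp: S_Suc)

lemma good_refine:
  assumes "good k\<^sub>0 t" "success (S t)"
  shows "good k\<^sub>0 (Suc t) \<and> S (Suc t) PJ = 2 * S t PJ \<and> S (Suc t) J = S t J + 1 \<and>
    (\<forall>i<n. \<bar>approx_vec (Suc t) i - approx_vec t i\<bar> \<le> 1 / (4 * S t PJ))"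
proof -
  have pos0: "0 < S t PJ" "0 < S t HH" "0 < S t MD" "0 < S t UD" using assms(1) by (auto simp: good_def)
  have f: "found (S t) (solution (S t))" by (rule success_found[OF assms(2)])
  define E where "E = new_entry (S t)"
  have ok: "name_ok (S t) (solution (S t))" and r: "refine_ok (S t) (solution (S t))"
    using f pos0 by (auto simp: found_def)
  let ?B = "cand_matrix (S t Stage) (solution (S t))"
  have chk: "refine_check n (int (S t HH)) (int (S t PJ)) (int (S t MP) - int (S t MN)) (int (S t MD))
     (\<lambda>i. int (S t (UP i)) - int (S t (UM i))) (int (S t UD)) (E CR) ?B (E CC) (\<lambda>i. E (CU i)) (E CD)"
    using r by (simp add: refine_ok_def E_def new_entry_def)
  have pos: "0 < E CR" "0 < E CD" using chk by (auto simp: refine_check_def)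
  have approx: "\<bar>E CR * a i j - ?B i j\<bar> \<le> 1" if "i < n" "j < n" for i j
    using name_ok_sound[OF ok _ that] pos by (simp add: E_def new_entry_def)
  have UD: "real (S (Suc t) UD) = E CD" "0 < S (Suc t) UD"
    using new_values(2)[OF assms(2)] pos by (simp_all add: E_def)
  have vec: "approx_vec (Suc t) i = E (CU i) / E CD" if "i < n" for i
    unfolding approx_vec_def UD(1) new_values(1)[OF assms(2) that] E_def ..
  have same: "S (Suc t) HH = S t HH" "S (Suc t) MD = S t MD" "S (Suc t) MP = S t MP" "S (Suc t) MN = S t MN"
    using pos0 by (simp_all add: S_Suc)
  have PJ: "S (Suc t) PJ = 2 * S t PJ" "S (Suc t) J = S t J + 1" using assms(2) pos0 by (simp_all add: S_Suc)
  define c0 where "c0 = int (S t MP) - int (S t MN)"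
  have val: "approx_val t = c0 / S t MD" by (simp add: approx_val_def c0_def)
  have near: "\<bar>E CC / E CR - approx_val t\<bar> \<le> 1 / (2 * int (S t HH))"
  proof -
    have "2 * int (S t HH) * \<bar>E CC * int (S t MD) - c0 * E CR\<bar> \<le> E CR * int (S t MD)"
      using chk by (simp add: refine_check_def c0_def)
    then have "real_of_int (2 * int (S t HH) * \<bar>E CC * int (S t MD) - c0 * E CR\<bar>) \<le> real_of_int (E CR * int (S t MD))"
      unfolding of_int_le_iff .
    then have le: "2 * real (S t HH) * \<bar>E CC * real (S t MD) - c0 * E CR\<bar> \<le> E CR * real (S t MD)" by simp
    have "E CC / E CR - approx_val t = (E CC * real (S t MD) - c0 * E CR) / (E CR * real (S t MD))"
      using pos pos0 by (simp add: val field_simps)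
    moreover have "\<bar>E CC * real (S t MD) - c0 * E CR\<bar> / (E CR * real (S t MD)) \<le> 1 / (2 * real (S t HH))"
      by (rule divide_le_of_le) (use le pos pos0 in auto)
    ultimately show ?thesis using pos pos0 by (simp only: abs_divide abs_mult; simp)
  qed
  have "32 * int (S t PJ) * int (S t HH) * residual_bound n ?B (E CC) (\<lambda>i. E (CU i)) \<le> E CR * E CD"
    using chk by (simp add: refine_check_def)
  then have "real_of_int (32 * int (S t PJ) * int (S t HH) * residual_bound n ?B (E CC) (\<lambda>i. E (CU i)))
      \<le> real_of_int (E CR * E CD)" unfolding of_int_le_iff .
  \<comment> \<open>\<open>1 / (16 * PJ)\<close> is \<open>1 / (8 * (2 * PJ))\<close>, the accuracy
    that \<open>good\<close> demands after \<open>PJ\<close> has doubled.\<close>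
  then have rb: "2 * int (S t HH) * residual_bound n ?B (E CC) (\<lambda>i. E (CU i))
      \<le> 1 / (16 * S t PJ) * real_of_int (E CR * E CD)"
    using pos0 by (simp add: field_simps)
  have iso: "1 / int (S t HH) \<le> \<bar>l k - approx_val t\<bar>" if "k < n" "l k \<noteq> l k\<^sub>0" for k
    using assms(1) that by (simp add: good_def)
  have "\<exists>w. (\<forall>i<n. app n a w i = l k\<^sub>0 * w i) \<and> (\<forall>i<n. \<bar>E (CU i) / E CD - w i\<bar> \<le> 1 / (16 * S t PJ))"
    by (rule eigenspace_near_certified[OF approx pos _ iso near rb]) (use pos0 in auto)
  then have "\<exists>w. (\<forall>i<n. app n a w i = l k\<^sub>0 * w i) \<and> (\<forall>i<n. \<bar>approx_vec (Suc t) i - w i\<bar> \<le> 1 / (8 * S (Suc t) PJ))"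
    unfolding PJ using vec by auto
  moreover have "approx_val (Suc t) = approx_val t" unfolding approx_val_def same ..
  ultimately have "good k\<^sub>0 (Suc t)"
    using assms(1) UD(2) unfolding good_def same by (auto simp: PJ)
  moreover have "\<bar>approx_vec (Suc t) i - approx_vec t i\<bar> \<le> 1 / (4 * S t PJ)" if "i < n" for i
  proof -
    define u0 where "u0 = int (S t (UP i)) - int (S t (UM i))"
    have "4 * int (S t PJ) * \<bar>E (CU i) * int (S t UD) - u0 * E CD\<bar> \<le> E CD * int (S t UD)"
      using chk that by (simp add: refine_check_def u0_def)
    then have "real_of_int (4 * int (S t PJ) * \<bar>E (CU i) * int (S t UD) - u0 * E CD\<bar>) \<le> real_of_int (E CD * int (S t UD))"
      unfolding of_int_le_iff .
    then have le: "4 * real (S t PJ) * \<bar>E (CU i) * real (S t UD) - u0 * E CD\<bar> \<le> E CD * real (S t UD)" by simp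
    have "approx_vec t i = u0 / S t UD" by (simp add: approx_vec_def u0_def)
    then have "approx_vec (Suc t) i - approx_vec t i = (E (CU i) * real (S t UD) - u0 * E CD) / (E CD * real (S t UD))"
      using pos pos0 by (simp add: vec[OF that] field_simps)
    moreover have "\<bar>E (CU i) * real (S t UD) - u0 * E CD\<bar> / (E CD * real (S t UD)) \<le> 1 / (4 * real (S t PJ))"
      by (rule divide_le_of_le) (use le pos pos0 in auto)
    ultimately show ?thesis using pos pos0 by (simp only: abs_divide abs_mult; simp)
  qed
  ultimately show ?thesis using PJ by blast
qed

text \<open>While the search fails, vector, window and \<open>PJ\<close> stand still. The refinement
  sought thus stays the same, and a solution of it becomes a candidate in a late stage.\<close>

lemma good_eventually_success:
  assumes "good k\<^sub>0 t"
  shows "\<exists>t'\<ge>t. success (S t') \<and> good k\<^sub>0 t'"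
proof (rule ccontr)
  assume no: "\<not> ?thesis"
  have inv: "good k\<^sub>0 u \<and> S u HH = S t HH \<and> S u PJ = S t PJ \<and> S u MP = S t MP \<and> S u MN = S t MN \<and> S u MD = S t MD \<and>
      S u UD = S t UD \<and> (\<forall>i<n. S u (UP i) = S t (UP i) \<and> S u (UM i) = S t (UM i))" if "t \<le> u" for u
    using that
  proof (induction u rule: dec_induct)
    case (step u)
    then have "\<not> success (S u)" using no by blast
    with step good_idle[of k\<^sub>0 u] show ?case by (simp add: S_Suc)
  qed (use assms in simp)
  have pos: "0 < int (S t MD)" "0 < int (S t HH)" "0 < int (S t PJ)" "0 < int (S t UD)"
    using assms by (auto simp: good_def)
  obtain x where x: "\<And>i. i < n \<Longrightarrow> app n a x i = l k\<^sub>0 * x i"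
    "\<And>i. i < n \<Longrightarrow> \<bar>approx_vec t i - x i\<bar> \<le> 1 / (8 * S t PJ)"
    using assms unfolding good_def by blast
  obtain R c u D where chk: "refine_check n (int (S t HH)) (int (S t PJ)) (int (S t MP) - int (S t MN)) (int (S t MD))
     (\<lambda>i. int (S t (UP i)) - int (S t (UM i))) (int (S t UD)) R (\<lambda>i j. round (R * a i j)) c u D"
    using refine_exists[where n = n and a = a and w = x and ev = "l k\<^sub>0" and c\<^sub>0 = "int (S t MP) - int (S t MN)"
        and u\<^sub>0 = "\<lambda>i. int (S t (UP i)) - int (S t (UM i))", OF x(1) pos] x(2) assms
    by (force simp: approx_vec_def approx_val_def good_def)
  have R: "0 < R" using chk by (simp add: refine_check_def)
  define \<zeta> where "\<zeta> = (\<lambda>x. case x of CR \<Rightarrow> R | CD \<Rightarrow> D | CC \<Rightarrow> c | CS \<Rightarrow> 0 | CH \<Rightarrow> 0 | CU i \<Rightarrow> u i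
    | CB i j \<Rightarrow> round (R * a i j) | CP i j \<Rightarrow> 0 | CW i j \<Rightarrow> 0)"
  obtain t0 where t0: "\<And>t. t0 \<le> t \<Longrightarrow> \<exists>c<S t Stage ^ num_digits n. name_ok (S t) c \<and>
    (\<forall>v\<in>cvars n. entry (S t Stage) c v = \<zeta> v) \<and>
    (\<forall>i<n. \<forall>j<n. cand_matrix (S t Stage) c i j = round (R * a i j))"
    using candidate_eventually[OF R, of \<zeta>] by (auto simp: \<zeta>_def)
  define t1 where "t1 = max t0 t"
  obtain d where d: "d < S t1 Stage ^ num_digits n" "name_ok (S t1) d"
    "\<forall>v\<in>cvars n. entry (S t1 Stage) d v = \<zeta> v"
    "\<forall>i<n. \<forall>j<n. cand_matrix (S t1 Stage) d i j = round (R * a i j)"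
    using t0[of t1] by (auto simp: t1_def)
  have t1: "t \<le> t1" by (simp add: t1_def)
  note st = inv[OF t1]
  have "refine_ok (S t1) d"
  proof -
    have "refine_check n (int (S t1 HH)) (int (S t1 PJ)) (int (S t1 MP) - int (S t1 MN)) (int (S t1 MD))
     (\<lambda>i. int (S t1 (UP i)) - int (S t1 (UM i))) (int (S t1 UD)) R (\<lambda>i j. round (R * a i j)) c u D"
      using chk st unfolding refine_check_def by simp
    moreover have "entry (S t1 Stage) d CR = R" "entry (S t1 Stage) d CC = c" "entry (S t1 Stage) d CD = D"
      "\<And>i. i < n \<Longrightarrow> entry (S t1 Stage) d (CU i) = u i"
      using d(3) by (auto simp: cvars_def \<zeta>_def)
    ultimately show ?thesis
      unfolding refine_ok_def using refine_check_cong[of n "cand_matrix (S t1 Stage) d" "\<lambda>i j. round (R * a i j)"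
          "\<lambda>i. entry (S t1 Stage) d (CU i)" u] d(4) by simp
  qed
  then have "found (S t1) d" using d(2) st by (auto simp: found_def good_def)
  from found_success[OF this d(1)] no t1 st show False by blast
qed

end

context matrix_run
begin

lemma PJ_persists: "t \<le> t' \<Longrightarrow> S t PJ \<noteq> 0 \<Longrightarrow> S t' PJ \<noteq> 0"
  by (induction t' rule: dec_induct) (auto simp: S_Suc)

lemma J_mono: "t \<le> t' \<Longrightarrow> S t J \<le> S t' J"
  by (induction t' rule: dec_induct) (auto simp: S_Suc)

theorem convergence:
  "\<exists>ev x. (\<exists>i<n. x i \<noteq> 0) \<and> (\<forall>i<n. app n a x i = ev * x i) \<and>
    (\<forall>t. S t PJ \<noteq> 0 \<longrightarrow> 0 < S t UD \<and> (\<forall>i<n. \<bar>approx_vec t i - x i\<bar> \<le> 1 / 2 ^ S t J)) \<and>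
    (\<forall>K. \<exists>t. S t PJ \<noteq> 0 \<and> K \<le> S t J)"
proof -
  obtain t0 where t0: "S t0 PJ = 0" "success (S t0)" using commit_eventually by blast
  define tc where "tc = Suc t0"
  obtain k\<^sub>0 where k0: "good k\<^sub>0 tc" "S tc PJ = 1" "\<exists>i<n. 1 \<le> \<bar>approx_vec tc i\<bar>"
    using commit_good[OF t0] by (auto simp: tc_def)
  have J0: "S t J = 0" if "S t PJ = 0" for t
    using that by (induction t) (auto simp: S_0 S_Suc split: if_splits)
  have Jtc: "S tc J = 0" using t0 J0[of t0] by (simp add: tc_def S_Suc)
  \<comment> \<open>The first success sets \<open>PJ\<close> to 1 and leaves \<open>J\<close> at 0;
    from then on both advance together.\<close>
  have good: "good k\<^sub>0 (tc + t) \<and> S (tc + t) PJ = 2 ^ S (tc + t) J" for t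
  proof (induction t)
    case 0
    show ?case using k0 Jtc by simp
  next
    case (Suc t)
    then show ?case
      using good_idle[of k\<^sub>0 "tc + t"] good_refine[of k\<^sub>0 "tc + t"] by (cases "success (S (tc + t))") auto
  qed
  have after: "\<exists>u. t = tc + u" if "S t PJ \<noteq> 0" for t
  proof -
    have "\<not> t \<le> t0" using PJ_persists[of t t0] that t0(1) by blast
    then show ?thesis by (intro exI[of _ "t - tc"]) (simp add: tc_def)
  qed
  have unb: "\<exists>t. K \<le> S (tc + t) J" for K
  proof (induction K)
    case (Suc K)
    then obtain t where t: "K \<le> S (tc + t) J" by blast
    obtain t' where t': "tc + t \<le> t'" "success (S t')" "good k\<^sub>0 t'"
      using good_eventually_success good by blast
    have "S (Suc t') J = S t' J + 1" using good_refine[OF t'(3,2)] by blast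
    then have "Suc K \<le> S (Suc t') J" using J_mono[OF t'(1)] t by simp
    moreover have "Suc t' = tc + (Suc t' - tc)" using t'(1) by simp
    ultimately show ?case by metis
  qed auto
  have "\<exists>x. (\<forall>i<n. app n a x i = l k\<^sub>0 * x i) \<and>
      (\<forall>t. \<forall>i<n. \<bar>approx_vec (tc + t) i - x i\<bar> \<le> 1 / (2 * real (S (tc + t) PJ)))"
  proof (rule limit_in_eigenspace)
    show "0 < real (S (tc + t) PJ)" for t using good[of t] by simp
    show "real (S (tc + Suc t) PJ) = real (S (tc + t) PJ) \<and> (\<forall>i<n. approx_vec (tc + Suc t) i = approx_vec (tc + t) i) \<or>
        real (S (tc + Suc t) PJ) = 2 * real (S (tc + t) PJ) \<and>
        (\<forall>i<n. \<bar>approx_vec (tc + Suc t) i - approx_vec (tc + t) i\<bar> \<le> 1 / (4 * real (S (tc + t) PJ)))" for t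
      using good[of t] good_idle[of k\<^sub>0 "tc + t"] good_refine[of k\<^sub>0 "tc + t"] by (cases "success (S (tc + t))") auto
    show "\<exists>t. K \<le> real (S (tc + t) PJ)" for K
    proof -
      obtain N :: nat where N: "K \<le> real N" using real_arch_simple by blast
      obtain t where t: "N \<le> S (tc + t) J" using unb by blast
      have "N < 2 ^ N" by (rule less_exp)
      also have "(2::nat) ^ N \<le> 2 ^ S (tc + t) J" using t by (intro power_increasing) auto
      also have "\<dots> = S (tc + t) PJ" using good[of t] by simp
      finally show ?thesis using N by (intro exI[of _ t]) linarith
    qed
    show "\<exists>w. (\<forall>i<n. app n a w i = l k\<^sub>0 * w i) \<and> (\<forall>i<n. \<bar>approx_vec (tc + t) i - w i\<bar> \<le> 1 / (8 * real (S (tc + t) PJ)))" for t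
      using good[of t] unfolding good_def by auto
  qed
  then obtain x where x: "\<forall>i<n. app n a x i = l k\<^sub>0 * x i"
    "\<And>t i. i < n \<Longrightarrow> \<bar>approx_vec (tc + t) i - x i\<bar> \<le> 1 / (2 * real (S (tc + t) PJ))" by blast
  \<comment> \<open>At the first success \<open>PJ = 1\<close>, so the limit is within 1/2 of a
    vector with a coordinate of absolute value at least 1.\<close>
  have "\<exists>i<n. x i \<noteq> 0"
  proof -
    obtain i where i: "i < n" "1 \<le> \<bar>approx_vec tc i\<bar>" using k0(3) by blast
    have "\<bar>approx_vec tc i - x i\<bar> \<le> 1 / 2" using x(2)[OF i(1), of 0] k0(2) by simp
    with i show ?thesis by (intro exI[of _ i]) auto
  qed
  moreover have "0 < S t UD \<and> (\<forall>i<n. \<bar>approx_vec t i - x i\<bar> \<le> 1 / 2 ^ S t J)" if PJ: "S t PJ \<noteq> 0" for t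
  proof -
    obtain u where u: "t = tc + u" using after[OF PJ] by blast
    have P: "real (S t PJ) = 2 ^ S t J" using good[of u] u by simp
    have "1 / (2 * real (S t PJ)) \<le> 1 / 2 ^ S t J" unfolding P by (simp add: field_simps)
    then have "\<bar>approx_vec t i - x i\<bar> \<le> 1 / 2 ^ S t J" if "i < n" for i
      using x(2)[OF that, of u] u by simp
    moreover have "0 < S t UD" using good[of u] u by (simp add: good_def)
    ultimately show ?thesis by blast
  qed
  moreover have "\<exists>t. S t PJ \<noteq> 0 \<and> K \<le> S t J" for K
  proof -
    obtain t where t: "K \<le> S (tc + t) J" using unb by blast
    have "S (tc + t) PJ \<noteq> 0" using good[of t] by simp
    with t show ?thesis by blast
  qed
  ultimately show ?thesis using x(1) by blast
qed

end

section \<open>Writing the name of the limit\<close>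

locale emission = run n S p w for n S p w +
  fixes out :: "nat \<Rightarrow> bool list"
  assumes out_0: "out 0 = []"
    and out_Suc: "out (Suc t) = out t @ (if emits (S t) then [out_bit (S t)] else [])"
    and PJ_stays: "t \<le> t' \<Longrightarrow> S t PJ \<noteq> 0 \<Longrightarrow> S t' PJ \<noteq> 0"
    and J_stays: "t \<le> t' \<Longrightarrow> S t J \<le> S t' J"
    and J_unbounded: "\<exists>t. S t PJ \<noteq> 0 \<and> K \<le> S t J"
begin

definition current :: "nat \<Rightarrow> nat \<Rightarrow> int \<times> nat" where
  "current i t = (int (S t (UP i)) - int (S t (UM i)), S t UD)"

text \<open>The stream is read off the run: fraction \<open>k\<close> is the approximation current
  when it is loaded. That such a stage exists for every \<open>k\<close> is
  \<open>ex_load\<close>.\<close>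

definition emitted :: "nat \<Rightarrow> (int \<times> nat) stream" where
  "emitted i = smap (\<lambda>k. current i (LEAST t. loads (S t) i \<and> S t (EK i) = k)) nats"

definition name :: "nat \<Rightarrow> bool stream" where
  "name i = flat (smap frac_code (emitted i))"

definition tuple :: "bool stream" where
  "tuple = smap (\<lambda>j. name (j mod n) !! (j div n)) nats"

definition queue :: "nat \<Rightarrow> nat \<Rightarrow> bool list" where
  "queue i t = pending (S t (EP i)) (S t (ES i)) (S t (EN i)) (S t (ED i))"

lemma EK_Suc: "i < n \<Longrightarrow> S (Suc t) (EK i) = S t (EK i) + of_bool (loads (S t) i)"
  by (simp add: S_Suc)

lemma EK_mono: "i < n \<Longrightarrow> t \<le> t' \<Longrightarrow> S t (EK i) \<le> S t' (EK i)"
  by (rule lift_Suc_mono_le) (simp_all add: EK_Suc)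

lemma emitted_at_load:
  assumes "i < n" "loads (S t) i"
  shows "emitted i !! S t (EK i) = current i t"
proof -
  \<comment> \<open>Each load increments \<open>EK i\<close>, so no two loads share a count.\<close>
  have "(LEAST u. loads (S u) i \<and> S u (EK i) = S t (EK i)) = t"
  proof (rule Least_equality)
    fix u assume u: "loads (S u) i \<and> S u (EK i) = S t (EK i)"
    show "t \<le> u"
    proof (rule ccontr)
      assume "\<not> t \<le> u"
      then have "S (Suc u) (EK i) \<le> S t (EK i)" by (intro EK_mono[OF assms(1)]) simp
      with u show False by (simp add: EK_Suc[OF assms(1)])
    qed
  qed (use assms in simp)
  then show ?thesis by (simp add: emitted_def)
qed

lemma OP_less: "S t OP < n"
  using n_pos by (induction t) (auto simp: S_0 S_Suc)

lemma emits_iff: "emits (S t) \<longleftrightarrow> S t (EP (S t OP)) \<noteq> 0"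
  using OP_less[of t] by (auto simp: emits_def)

lemma out_bit_eq:
  "out_bit (S t) = emitter_bit (S t (EP (S t OP))) (S t (ES (S t OP))) (S t (EN (S t OP))) (S t (ED (S t OP)))"
  using OP_less[of t] by (auto simp: out_bit_def)

lemma queue_emit:
  assumes "emits (S t)"
  shows "queue (S t OP) t = out_bit (S t) # queue (S t OP) (Suc t)"
  using pending_step[of "S t (EP (S t OP))"] assms OP_less[of t]
  by (simp add: queue_def emits_iff out_bit_eq S_Suc loads_def)

lemma queue_other:
  assumes "i < n" "S t OP \<noteq> i \<or> \<not> emits (S t) \<and> \<not> loads (S t) i"
  shows "queue i (Suc t) = queue i t" "S (Suc t) (EK i) = S t (EK i)"
  using assms by (auto simp: queue_def S_Suc loads_def emits_iff emitter_num_def emitter_den_def)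

lemma queue_load:
  assumes "i < n" "loads (S t) i"
  shows "queue i t = []" "queue i (Suc t) = frac_code (current i t)"
  using assms by (auto simp: queue_def pending_def S_Suc loads_def frac_code_def current_def)

text \<open>What remains of component \<open>i\<close> is its queue followed by the codes of the
  fractions not yet loaded. Writing a bit removes the head of one queue, and a load moves one code
  from the stream into an empty queue.\<close>

lemma invariant:
  "S t OP = length (out t) mod n \<and> out t = stake (length (out t)) tuple \<and>
   (\<forall>i<n. sdrop (count_mod n i (length (out t))) (name i)
      = queue i t @- flat (smap frac_code (sdrop (S t (EK i)) (emitted i))))"
proof (induction t)
  case 0
  show ?case using n_pos by (simp add: S_0 out_0 queue_def pending_def name_def)
next
  case (Suc t)
  define L where "L = length (out t)"
  define i where "i = S t OP"
  have i: "i < n" "i = L mod n" using Suc OP_less[of t] by (auto simp: i_def L_def)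
  have IH: "sdrop (count_mod n j L) (name j) = queue j t @- flat (smap frac_code (sdrop (S t (EK j)) (emitted j)))"
    if "j < n" for j using Suc that by (simp add: L_def)
  show ?case
  proof (cases "emits (S t)")
    case True
    have len: "length (out (Suc t)) = Suc L" using True by (simp add: out_Suc L_def)
    have q: "queue i t = out_bit (S t) # queue i (Suc t)" using queue_emit[OF True] by (simp add: i_def)
    have "\<not> loads (S t) i" using True by (auto simp: loads_def emits_iff i_def)
    then have EK: "S (Suc t) (EK i) = S t (EK i)" using i(1) by (simp add: EK_Suc)
    have cnt: "count_mod n i (Suc L) = Suc (count_mod n i L)" using i(2) by simp
    have "count_mod n i L = L div n" using count_mod_eq[OF i(1), of L] i(2) by simp
    then have "tuple !! L = name i !! count_mod n i L" by (simp add: tuple_def i(2))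
    also have "\<dots> = shd (sdrop (count_mod n i L) (name i))" by (simp add: sdrop_simps)
    also have "\<dots> = out_bit (S t)" unfolding IH[OF i(1)] q by simp
    finally have bit: "tuple !! L = out_bit (S t)" .
    have "out t = stake L tuple" using Suc unfolding L_def by blast
    then have "out (Suc t) = stake (Suc L) tuple"
      unfolding out_Suc stake_Suc bit using True by simp
    moreover have "S (Suc t) OP = Suc L mod n"
      using True i n_pos by (simp add: S_Suc mod_Suc flip: i_def)
    moreover have "sdrop (count_mod n j (Suc L)) (name j)
        = queue j (Suc t) @- flat (smap frac_code (sdrop (S (Suc t) (EK j)) (emitted j)))" if j: "j < n" for j
    proof (cases "j = i")
      case True
      have "sdrop (Suc (count_mod n i L)) (name i) = stl (sdrop (count_mod n i L) (name i))" by (simp add: sdrop_simps)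
      also have "\<dots> = queue i (Suc t) @- flat (smap frac_code (sdrop (S (Suc t) (EK i)) (emitted i)))"
        unfolding IH[OF i(1)] q EK by simp
      finally show ?thesis unfolding True cnt .
    next
      case False
      then have "count_mod n j (Suc L) = count_mod n j L" using i(2) by simp
      then show ?thesis using IH[OF j] queue_other[OF j, of t] False by (simp add: i_def)
    qed
    ultimately show ?thesis unfolding len by blast
  next
    case False
    have out: "out (Suc t) = out t" using False by (simp add: out_Suc)
    have "S (Suc t) OP = S t OP" using False by (simp add: S_Suc)
    moreover have "sdrop (count_mod n j L) (name j)
        = queue j (Suc t) @- flat (smap frac_code (sdrop (S (Suc t) (EK j)) (emitted j)))" if j: "j < n" for j
    proof (cases "loads (S t) j")
      case True
      have "sdrop (count_mod n j L) (name j) = flat (smap frac_code (sdrop (S t (EK j)) (emitted j)))"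
        unfolding IH[OF j] queue_load(1)[OF j True] by simp
      also have "\<dots> = frac_code (current j t) @- flat (smap frac_code (sdrop (Suc (S t (EK j))) (emitted j)))"
        unfolding flat_frac_code[of "S t (EK j)"] emitted_at_load[OF j True] ..
      finally show ?thesis unfolding queue_load(2)[OF j True] EK_Suc[OF j] using True by simp
    next
      case nl: False
      then show ?thesis using IH[OF j] queue_other[OF j, of t] False by simp
    qed
    ultimately show ?thesis using Suc unfolding out by (simp add: L_def)
  qed
qed

text \<open>The output waits only at a component whose emitter is idle. Its count
  \<open>EK i\<close> then stands still while \<open>J\<close> grows, so a load becomes possible and
  the next stage writes.\<close>

lemma emits_eventually: "\<exists>t'\<ge>t. emits (S t')"
proof (rule ccontr)
  assume no: "\<not> ?thesis"
  define i where "i = S t OP"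
  have i: "i < n" by (simp add: i_def OP_less)
  have OP: "S t' OP = i" if "t \<le> t'" for t'
    using that by (induction t' rule: dec_induct) (use no in \<open>auto simp: i_def S_Suc\<close>)
  have EP: "S t' (EP i) = 0" if "t \<le> t'" for t'
    using no that OP[OF that] emits_iff[of t'] by auto
  have nl: "\<not> loads (S t') i" if "t \<le> t'" for t'
    using EP[of "Suc t'"] that i by (auto simp: S_Suc)
  have EK: "S t' (EK i) = S t (EK i)" if "t \<le> t'" for t'
    using that by (induction t' rule: dec_induct) (use nl i in \<open>auto simp: EK_Suc\<close>)
  obtain u where u: "S u PJ \<noteq> 0" "S t (EK i) \<le> S u J" using J_unbounded by blast
  let ?u = "max t u"
  have "S ?u PJ \<noteq> 0" "S t (EK i) \<le> S ?u J"
    using PJ_stays[of u ?u] J_stays[of u ?u] u by auto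
  then have "loads (S ?u) i" using OP[of ?u] EP[of ?u] EK[of ?u] by (simp add: loads_def)
  with nl[of ?u] show False by simp
qed

lemma out_unbounded: "\<exists>t. K \<le> length (out t)"
proof (induction K)
  case (Suc K)
  then obtain t where t: "K \<le> length (out t)" by blast
  obtain t' where t': "t \<le> t'" "emits (S t')" using emits_eventually by blast
  have "length (out t) \<le> length (out t')" using t'(1)
    by (rule lift_Suc_mono_le[rotated]) (simp add: out_Suc)
  then have "Suc K \<le> length (out (Suc t'))" using t t'(2) by (simp add: out_Suc)
  then show ?case by blast
qed simp

text \<open>Without loads, the number of written bits of component \<open>i\<close> plus the length
  of its queue is constant. But the output is unbounded and serves the components in turn, so the
  first summand grows beyond any bound.\<close>

lemma loads_eventually:
  assumes i: "i < n"
  shows "\<exists>t'\<ge>t. loads (S t') i"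
proof (rule ccontr)
  assume no: "\<not> ?thesis"
  define f where "f = (\<lambda>t. count_mod n i (length (out t)) + length (queue i t))"
  have f: "f t' = f t" if "t \<le> t'" for t'
    using that
  proof (induction t' rule: dec_induct)
    case (step u)
    have nl: "\<not> loads (S u) i" using no step.hyps by blast
    have OP: "S u OP = length (out u) mod n" using invariant by blast
    have "f (Suc u) = f u"
    proof (cases "emits (S u)")
      case True
      show ?thesis
      proof (cases "S u OP = i")
        case i': True
        have "queue i u = out_bit (S u) # queue i (Suc u)" using queue_emit[OF True] i' by simp
        then show ?thesis using True OP i' by (simp add: f_def out_Suc)
      next
        case False
        then show ?thesis using True OP queue_other(1)[OF i, of u] by (simp add: f_def out_Suc)
      qed
    next
      case False
      then show ?thesis using queue_other(1)[OF i, of u] nl by (simp add: f_def out_Suc)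
    qed
    with step.IH show ?case by simp
  qed simp
  obtain u where u: "n * Suc (f t) \<le> length (out u)" using out_unbounded by blast
  have "length (out u) \<le> length (out (max t u))"
    by (rule lift_Suc_mono_le[of "\<lambda>t. length (out t)"]) (simp_all add: out_Suc)
  then have "n * Suc (f t) \<le> length (out (max t u))" using u by simp
  then have "Suc (f t) \<le> length (out (max t u)) div n"
    using n_pos by (simp add: less_eq_div_iff_mult_less_eq mult.commute)
  also have "\<dots> \<le> f (max t u)" by (simp add: f_def count_mod_eq[OF i])
  finally show False using f[of "max t u"] by simp
qed

lemma next_load:
  assumes i: "i < n"
  shows "\<exists>t'\<ge>t. loads (S t') i \<and> S t' (EK i) = S t (EK i)"
proof -
  define t' where "t' = (LEAST u. t \<le> u \<and> loads (S u) i)"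
  have ex: "\<exists>u. t \<le> u \<and> loads (S u) i" using loads_eventually[OF i] by blast
  have t': "t \<le> t' \<and> loads (S t') i" unfolding t'_def by (rule LeastI_ex[OF ex])
  have "S u (EK i) = S t (EK i)" if "t \<le> u" "u \<le> t'" for u
    using that
  proof (induction u rule: dec_induct)
    case (step u)
    then have "u < t'" by simp
    then have "\<not> (t \<le> u \<and> loads (S u) i)" unfolding t'_def by (rule not_less_Least)
    then show ?case using step EK_Suc[OF i] by simp
  qed simp
  with t' show ?thesis by blast
qed

lemma ex_load:
  assumes i: "i < n"
  shows "\<exists>t. loads (S t) i \<and> S t (EK i) = k"
proof (induction k)
  case 0
  then show ?case using next_load[OF i, of 0] i by (auto simp: S_0)
next
  case (Suc k)
  then obtain t where t: "loads (S t) i" "S t (EK i) = k" by blast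
  then have "S (Suc t) (EK i) = Suc k" by (simp add: EK_Suc[OF i])
  then show ?case using next_load[OF i, of "Suc t"] by auto
qed

lemma component_tuple:
  assumes "i < n"
  shows "component n i tuple = name i"
proof -
  have "(\<lambda>j. tuple !! (j * n + i)) = (!!) (name i)" using assms by (auto simp: tuple_def)
  then show ?thesis unfolding component_def by (simp only: stream_smap_nats[symmetric])
qed

lemma cauchy_name_tuple:
  assumes i: "i < n"
    and near: "\<And>t. S t PJ \<noteq> 0 \<Longrightarrow> 0 < S t UD \<and>
      \<bar>real_of_int (int (S t (UP i)) - int (S t (UM i))) / real (S t UD) - x\<bar> \<le> 1 / 2 ^ S t J"
  shows "cauchy_name (component n i tuple) x"
  unfolding cauchy_name_def component_tuple[OF i]
proof (intro exI[of _ "emitted i"] conjI allI)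
  show "name i = flat (smap frac_code (emitted i))" by (simp add: name_def)
  fix k
  obtain t where t: "loads (S t) i" "S t (EK i) = k" using ex_load[OF i] by blast
  have e: "emitted i !! k = current i t" using emitted_at_load[OF i t(1)] t(2) by simp
  have PJ: "S t PJ \<noteq> 0" "k \<le> S t J" using t by (auto simp: loads_def)
  show "0 < snd (emitted i !! k)" using near[OF PJ(1)] by (simp add: e current_def)
  have "(1::real) / 2 ^ S t J \<le> 1 / 2 ^ k" using PJ(2) by (simp add: frac_le power_increasing)
  then show "\<bar>x - frac_value (emitted i !! k)\<bar> \<le> 1 / 2 ^ k"
    using near[OF PJ(1)] by (simp add: e current_def frac_value_def abs_minus_commute)
qed

end

lemma upper_entries_index_pairs:
  assumes "A \<in> carrier_mat n n"
  shows "upper_entries A = map (\<lambda>(i, j). A $$ (i, j)) (index_pairs n)"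
  using assms by (simp add: upper_entries_def index_pairs_def map_concat comp_def)

lemma floor_log2_bounds:
  assumes "1 \<le> m"
  shows "2 ^ nat \<lfloor>log 2 (real m)\<rfloor> \<le> m" "m < 2 ^ (nat \<lfloor>log 2 (real m)\<rfloor> + 1)"
proof -
  have "0 \<le> log 2 (real m)" using assms by simp
  then have f: "0 \<le> \<lfloor>log 2 (real m)\<rfloor>" by simp
  have "2 powr real (nat \<lfloor>log 2 (real m)\<rfloor>) \<le> 2 powr log 2 (real m)"
    using f by (intro powr_mono) (auto simp: of_nat_nat)
  also have "\<dots> = real m" using assms by simp
  finally have "real (2 ^ nat \<lfloor>log 2 (real m)\<rfloor>) \<le> real m" by (simp add: powr_realpow)
  then show "2 ^ nat \<lfloor>log 2 (real m)\<rfloor> \<le> m" by (simp only: of_nat_le_iff)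
  have "real m = 2 powr log 2 (real m)" using assms by simp
  also have "\<dots> < 2 powr real (nat \<lfloor>log 2 (real m)\<rfloor> + 1)"
    using f by (intro powr_less_mono) (auto, linarith)
  finally have "real m < real (2 ^ (nat \<lfloor>log 2 (real m)\<rfloor> + 1))" by (simp only: powr_realpow of_nat_power zero_less_numeral of_nat_numeral)
  then show "m < 2 ^ (nat \<lfloor>log 2 (real m)\<rfloor> + 1)" by (simp only: of_nat_less_iff)
qed

theorem theorem3:
  fixes n :: nat
  assumes "1 \<le> n"
  shows "\<exists>M. wf_type2_machine M \<and> num_inputs M = 2 \<and>
    (\<forall>(A :: real mat) p.
       A \<in> carrier_mat n n \<and> transpose_mat A = A \<and> cauchy_tuple_name p (upper_entries A) \<longrightarrow>
       (\<exists>y v l.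
          outputs M [stream_tape p, word_tape (nat_word (nat \<lfloor>log 2 (real (min_multiplicity A))\<rfloor>))] y \<and>
          eigenvector A v l \<and> cauchy_tuple_name y (list_of_vec v)))"
proof -
  interpret algorithm n by unfold_locales (rule assms)
  let ?o0 = "\<lambda>s. of_bool (emits s \<and> \<not> out_bit s) :: nat" and ?o1 = "\<lambda>s. of_bool (emits s \<and> out_bit s) :: nat"
  have o: "effective ?o0" "effective ?o1" by (intro effective_intros)+
  \<comment> \<open>The machine depends on \<open>n\<close> alone; matrix and name enter only
    afterwards.\<close>
  obtain M where M: "wf_type2_machine M" "num_inputs M = 2"
    "\<forall>tp s out y.
       s 0 = (\<lambda>_. 0) \<and>
       (\<forall>t. s (Suc t) = (\<lambda>v. if v \<in> vars then update v (with_inputs Bit Sym tp t (s t))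
                             else with_inputs Bit Sym tp t (s t) v)) \<and>
       out 0 = [] \<and>
       (\<forall>t. out (Suc t) = out t @ (if ?o0 (with_inputs Bit Sym tp t (s t)) = 0 then [] else [False])
                                @ (if ?o1 (with_inputs Bit Sym tp t (s t)) = 0 then [] else [True])) \<and>
       (\<forall>t. out t = stake (length (out t)) y) \<and> (\<forall>k. \<exists>t. k \<le> length (out t)) \<longrightarrow>
       outputs M [tp Name, tp Advice] y"
    using stage_machine[of vars update ?o0 ?o1 Bit Sym, OF finite_vars effective_update o var.distinct(1)]
    by (elim exE conjE) (rule that)
  show ?thesis
  proof (intro exI[of _ M] conjI allI impI M(1,2))
    fix A :: "real mat" and p
    assume A: "A \<in> carrier_mat n n \<and> transpose_mat A = A \<and> cauchy_tuple_name p (upper_entries A)"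
    then have car: "A \<in> carrier_mat n n" by blast
    define a where "a = (\<lambda>i j. A $$ (i, j))"
    have sym: "a i j = a j i" if "i < n" "j < n" for i j
      using A that unfolding a_def by (metis carrier_matD index_transpose_mat(1))
    obtain v l where "\<forall>j<n. \<forall>k<n. dot n (v j) (v k) = of_bool (j = k)"
      "\<forall>k<n. \<forall>i<n. app n a (v k) i = l k * v k i"
      using spectral_theorem[of n a, OF sym] by blast
    then have es: "eigensystem n a v l" using sym by unfold_locales auto
    define mm where "mm = min_multiplicity A"
    have mm: "\<And>i. i < n \<Longrightarrow> mm \<le> card {j. j < n \<and> l j = l i}" "\<exists>i<n. mm = card {j. j < n \<and> l j = l i}"
      using min_multiplicity_eigensystem[OF car _ assms, of v l] es by (simp_all add: a_def mm_def)
    obtain i0 where i0: "i0 < n" "mm = card {j. j < n \<and> l j = l i0}" using mm(2) by blast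
    have "0 < mm" using i0 by (auto simp: card_gt_0_iff)
    have "mm \<le> card {..<n}" unfolding i0(2) by (rule card_mono) auto
    define k where "k = nat \<lfloor>log 2 (real mm)\<rfloor>"
    have k: "2 ^ k \<le> mm" "mm < 2 ^ (k + 1)" using floor_log2_bounds[of mm] \<open>0 < mm\<close> by (simp_all add: k_def)
    \<comment> \<open>Together with \<open>2 ^ k \<le> mm\<close> and \<open>mm \<le> n\<close>,
      this places the advice among the constants that \<open>found\<close> tries.\<close>
    have "k < 2 ^ k" by (rule less_exp)
    then have "k \<le> n" using k(1) \<open>mm \<le> card {..<n}\<close> unfolding card_lessThan by linarith
    define w where "w = nat_word k"
    define tp where "tp = (\<lambda>i. case i of Name \<Rightarrow> stream_tape p | Advice \<Rightarrow> word_tape w)"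
    define s where "s = rec_nat (\<lambda>_. 0) (\<lambda>t s. \<lambda>v. if v \<in> vars then update v (with_inputs Bit Sym tp t s)
                             else with_inputs Bit Sym tp t s v)"
    have s: "s 0 = (\<lambda>_. 0)" "s (Suc t) = (\<lambda>v. if v \<in> vars then update v (with_inputs Bit Sym tp t (s t))
                             else with_inputs Bit Sym tp t (s t) v)" for t
      by (rule rec_nat_0_imp[OF s_def], rule rec_nat_Suc_imp[OF s_def])
    \<comment> \<open>The valuation that stage \<open>t\<close> works on, with the input symbols of
      that stage already loaded.\<close>
    define S where "S = (\<lambda>t. with_inputs Bit Sym tp t (s t))"
    have S: "S t v = s t v" if "v \<in> vars" for t v
      using that by (auto simp: S_def with_inputs_def vars_def)
    interpret matrix_run n S p w a v l k
    proof (intro matrix_run.intro run.intro matrix_run_axioms.intro run_axioms.intro es)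
      show "algorithm n" by unfold_locales
      show "S 0 v = 0" if "v \<in> vars" for v using that by (simp add: S s)
      show "S (Suc t) v = update v (S t)" if "v \<in> vars" for v t using that by (simp add: S s) (simp add: S_def)
      show "S t Bit = 2 \<longleftrightarrow> p !! t" for t
        by (simp add: S_def with_inputs_def tp_def stream_tape_def symbol_code_def split: bool.splits)
      show "S t Sym = symbol_code (word_tape w t)" for t by (simp add: S_def with_inputs_def tp_def)
      show "cauchy_name (component m r p) (a (fst (index_pairs n ! r)) (snd (index_pairs n ! r)))" if "r < m" for r
      proof -
        have "cauchy_name (component (length (upper_entries A)) r p) (upper_entries A ! r)"
          using A that by (simp add: cauchy_tuple_name_def upper_entries_index_pairs[OF car] m_def)
        then show ?thesis
          using that by (simp add: upper_entries_index_pairs[OF car] m_def a_def split: prod.splits)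
      qed
      show "w = nat_word k" by (simp add: w_def)
      show "2 ^ k \<le> card {j. j < n \<and> l j = l i}" if "i < n" for i using mm(1)[OF that] k(1) by simp
      show "\<exists>i<n. card {j. j < n \<and> l j = l i} < 2 ^ (k + 1)" using i0 k(2) by auto
    qed (rule \<open>k \<le> n\<close>)
    obtain ev x where x: "\<exists>i<n. x i \<noteq> 0" "\<forall>i<n. app n a x i = ev * x i"
      "\<And>t. S t PJ \<noteq> 0 \<Longrightarrow> 0 < S t UD \<and> (\<forall>i<n. \<bar>approx_vec t i - x i\<bar> \<le> 1 / 2 ^ S t J)"
      "\<And>K. \<exists>t. S t PJ \<noteq> 0 \<and> K \<le> S t J"
      using convergence by blast
    define out where "out = rec_nat [] (\<lambda>t out. out @ (if emits (S t) then [out_bit (S t)] else []))"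
    interpret emission n S p w out
      by (unfold_locales; (erule (1) PJ_persists | erule J_mono | rule x(4) | simp add: out_def))
    have "outputs M [tp Name, tp Advice] tuple"
    proof (rule M(3)[rule_format, of s tp out], intro conjI allI)
      show "out (Suc t) = out t @ (if ?o0 (with_inputs Bit Sym tp t (s t)) = 0 then [] else [False])
                                @ (if ?o1 (with_inputs Bit Sym tp t (s t)) = 0 then [] else [True])" for t
      proof -
        have "with_inputs Bit Sym tp t (s t) = S t" by (simp add: S_def)
        then show ?thesis by (simp add: out_Suc)
      qed
      show "out t = stake (length (out t)) tuple" for t using invariant by blast
    qed (use s out_0 out_unbounded in auto)
    then have "outputs M [stream_tape p, word_tape (nat_word (nat \<lfloor>log 2 (real (min_multiplicity A))\<rfloor>))] tuple"
      by (simp add: tp_def w_def k_def mm_def)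
    moreover have "eigenvector A (vec n x) ev"
      using x(1,2) by (simp add: eigenvector_iff[OF car] a_def)
    moreover have "cauchy_tuple_name tuple (list_of_vec (vec n x))"
    proof -
      have "cauchy_name (component n i tuple) (x i)" if "i < n" for i
        by (rule cauchy_name_tuple[OF that]) (use x(3) that in \<open>auto simp: approx_vec_def\<close>)
      then show ?thesis by (simp add: cauchy_tuple_name_def list_of_vec_vec)
    qed
    ultimately show "\<exists>y v l.
          outputs M [stream_tape p, word_tape (nat_word (nat \<lfloor>log 2 (real (min_multiplicity A))\<rfloor>))] y \<and>
          eigenvector A v l \<and> cauchy_tuple_name y (list_of_vec v)" by blast
  qed
qed

end
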